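(* Let $G_1$ and $G_2$ be amenable locally compact $[IN]$ groups, and let $\omega_1$ and $\omega_2$ be weights on $G_1$ and $G_2$, respectively. Then $ZL^1(G_1,\omega_1)\,\widehat{\otimes}\,ZL^1(G_2,\omega_2)$ is weakly amenable if and only if both $ZL^1(G_1,\omega_1)$ and $ZL^1(G_2,\omega_2)$ are weakly amenable.
   Context: A locally compact group $G$ is an $[IN]$ group if there is a compact neighbourhood of the identity that is invariant under all inner automorphisms of $G$. A weight on a locally compact group $G$ is a Borel measurable function $\omega:G\to\mathbb{R}^+=(0,\infty)$ with $\omega(xy)\le\omega(x)\omega(y)$ for all $x,y\in G$. The Beurling algebra $L^1(G,\omega)$ is the Banach algebra (under convolution) of (a.e.-classes of) complex Haar measurable functions $f$ on $G$ with $\|f\|_\omega=\int_G|f(x)|\omega(x)\,dx<\infty$, where $dx$ is a fixed left Haar measure. The central Beurling algebra $ZL^1(G,\omega)$ is the closed subalgebra of all $f\in L^1(G,\omega)$ such that $f^g=f$ (a.e.) for all $g\in G$, where $f^g(x)=f(g^{-1}xg)$; it is a commutative Banach algebra and is the center of $L^1(G,\omega)$. $\widehat{\otimes}$ denotes the projective tensor product of Banach algebras. A commutative Banach algebra $A$ is weakly amenable if every continuous derivation from $A$ into any symmetric Banach $A$-bimodule is zero (equivalently, every continuous derivation $A\to A^*$ is zero). *)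

theory Defs
  imports "HOL-Analysis.Analysis"
begin

section \<open>Normed spaces and algebras with explicit carriers\<close>

text \<open>The algebras below depend on a Haar measure and a weight, which are terms, so they cannot be
  types.  They are records of a carrier and operations that matter only on that carrier.\<close>

record 'a nspace =
  carrier :: "'a set"
  vadd :: "'a \<Rightarrow> 'a \<Rightarrow> 'a"
  vscale :: "complex \<Rightarrow> 'a \<Rightarrow> 'a"
  vnorm :: "'a \<Rightarrow> real"

record 'a nalgebra = "'a nspace" +
  amult :: "'a \<Rightarrow> 'a \<Rightarrow> 'a"

definition vdiff :: "('a, 'm) nspace_scheme \<Rightarrow> 'a \<Rightarrow> 'a \<Rightarrow> 'a" where
  "vdiff V x y = vadd V x (vscale V (-1) y)"

definition bounded_linear_map ::
  "('a, 'm) nspace_scheme \<Rightarrow> ('b, 'n) nspace_scheme \<Rightarrow> ('a \<Rightarrow> 'b) \<Rightarrow> bool" where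
  "bounded_linear_map V W T \<longleftrightarrow>
     (\<forall>x\<in>carrier V. T x \<in> carrier W) \<and>
     (\<forall>x\<in>carrier V. \<forall>y\<in>carrier V. T (vadd V x y) = vadd W (T x) (T y)) \<and>
     (\<forall>c. \<forall>x\<in>carrier V. T (vscale V c x) = vscale W c (T x)) \<and>
     (\<exists>C. \<forall>x\<in>carrier V. vnorm W (T x) \<le> C * vnorm V x)"

definition complex_space :: "complex nspace" where
  "complex_space = \<lparr>carrier = UNIV, vadd = (+), vscale = (*), vnorm = cmod\<rparr>"

text \<open>Functionals are extended by \<open>0\<close> outside the carrier, so that functionals that agree on the
  carrier are equal.\<close>

definition dual :: "('a, 'm) nspace_scheme \<Rightarrow> ('a \<Rightarrow> complex) nspace" where
  "dual V =
     \<lparr>carrier = {\<phi>. bounded_linear_map V complex_space \<phi> \<and> (\<forall>x. x \<notin> carrier V \<longrightarrow> \<phi> x = 0)},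
      vadd = (\<lambda>\<phi> \<psi> x. \<phi> x + \<psi> x),
      vscale = (\<lambda>c \<phi> x. c * \<phi> x),
      vnorm = (\<lambda>\<phi>. Sup {cmod (\<phi> x) | x. x \<in> carrier V \<and> vnorm V x \<le> 1})\<rparr>"


section \<open>Weak amenability\<close>

text \<open>\<open>l a \<phi>\<close> is the left action \<open>a \<cdot> \<phi>\<close> and \<open>r \<phi> a\<close> is the right action \<open>\<phi> \<cdot> a\<close>.\<close>

definition continuous_derivation ::
  "'a nalgebra \<Rightarrow> 'b nspace \<Rightarrow> ('a \<Rightarrow> 'b \<Rightarrow> 'b) \<Rightarrow> ('b \<Rightarrow> 'a \<Rightarrow> 'b) \<Rightarrow> ('a \<Rightarrow> 'b) \<Rightarrow> bool" where
  "continuous_derivation A X l r D \<longleftrightarrow>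
     bounded_linear_map A X D \<and>
     (\<forall>a\<in>carrier A. \<forall>b\<in>carrier A. D (amult A a b) = vadd X (l a (D b)) (r (D a) b))"

definition dual_left :: "'a nalgebra \<Rightarrow> 'a \<Rightarrow> ('a \<Rightarrow> complex) \<Rightarrow> 'a \<Rightarrow> complex" where
  "dual_left A a \<phi> = (\<lambda>x. if x \<in> carrier A then \<phi> (amult A x a) else 0)"

definition dual_right :: "'a nalgebra \<Rightarrow> ('a \<Rightarrow> complex) \<Rightarrow> 'a \<Rightarrow> 'a \<Rightarrow> complex" where
  "dual_right A \<phi> a = (\<lambda>x. if x \<in> carrier A then \<phi> (amult A a x) else 0)"

text \<open>For a commutative Banach algebra \<open>A\<close>: every continuous derivation from \<open>A\<close> to its dual bimodule
  is zero.  This is the standard definition that is equivalent to vanishing on every symmetric Banach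
  bimodule; a single HOL formula cannot quantify over bimodules carried by arbitrary types.\<close>

definition weakly_amenable :: "'a nalgebra \<Rightarrow> bool" where
  "weakly_amenable A \<longleftrightarrow>
     (\<forall>D. continuous_derivation A (dual A) (dual_left A) (dual_right A) D \<longrightarrow>
          (\<forall>a\<in>carrier A. D a = (\<lambda>x. 0)))"


section \<open>Quotients and completions\<close>

text \<open>The algebra of classes of \<open>A\<close> modulo an equivalence relation \<open>R\<close> on its carrier that is
  compatible with the operations and the (semi)norm.\<close>

definition quotient_algebra :: "'a nalgebra \<Rightarrow> ('a \<times> 'a) set \<Rightarrow> 'a set nalgebra" where
  "quotient_algebra A R =
     \<lparr>carrier = carrier A // R,
      vadd = (\<lambda>F G. \<Union>f\<in>F. \<Union>g\<in>G. R `` {vadd A f g}),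
      vscale = (\<lambda>c F. \<Union>f\<in>F. R `` {vscale A c f}),
      vnorm = (\<lambda>F. the_elem (vnorm A ` F)),
      amult = (\<lambda>F G. \<Union>f\<in>F. \<Union>g\<in>G. R `` {amult A f g})\<rparr>"

definition cauchy_sequences :: "'a nalgebra \<Rightarrow> (nat \<Rightarrow> 'a) set" where
  "cauchy_sequences A =
     {X. (\<forall>n. X n \<in> carrier A) \<and>
         (\<forall>e>0. \<exists>N. \<forall>m\<ge>N. \<forall>n\<ge>N. vnorm A (vdiff A (X m) (X n)) < e)}"

definition cauchy_algebra :: "'a nalgebra \<Rightarrow> (nat \<Rightarrow> 'a) nalgebra" where
  "cauchy_algebra A =
     \<lparr>carrier = cauchy_sequences A,
      vadd = (\<lambda>X Y n. vadd A (X n) (Y n)),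
      vscale = (\<lambda>c X n. vscale A c (X n)),
      vnorm = (\<lambda>X. lim (\<lambda>n. vnorm A (X n))),
      amult = (\<lambda>X Y n. amult A (X n) (Y n))\<rparr>"

definition banach_completion :: "'a nalgebra \<Rightarrow> (nat \<Rightarrow> 'a) set nalgebra" where
  "banach_completion A =
     quotient_algebra (cauchy_algebra A)
       {(X, Y). X \<in> cauchy_sequences A \<and> Y \<in> cauchy_sequences A \<and>
                (\<lambda>n. vnorm A (vdiff A (X n) (Y n))) \<longlonglongrightarrow> 0}"


section \<open>The projective tensor product\<close>

definition bilinear_form :: "'a nalgebra \<Rightarrow> 'b nalgebra \<Rightarrow> ('a \<Rightarrow> 'b \<Rightarrow> complex) \<Rightarrow> bool" where
  "bilinear_form A B \<beta> \<longleftrightarrow>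
     (\<forall>a\<in>carrier A. \<forall>a'\<in>carrier A. \<forall>b\<in>carrier B. \<beta> (vadd A a a') b = \<beta> a b + \<beta> a' b) \<and>
     (\<forall>a\<in>carrier A. \<forall>b\<in>carrier B. \<forall>b'\<in>carrier B. \<beta> a (vadd B b b') = \<beta> a b + \<beta> a b') \<and>
     (\<forall>c. \<forall>a\<in>carrier A. \<forall>b\<in>carrier B. \<beta> (vscale A c a) b = c * \<beta> a b) \<and>
     (\<forall>c. \<forall>a\<in>carrier A. \<forall>b\<in>carrier B. \<beta> a (vscale B c b) = c * \<beta> a b)"

text \<open>The algebraic tensor product is realised, as usual, inside the linear functionals on the space
  of all bilinear forms on \<open>A \<times> B\<close> (not only the bounded ones): \<open>a \<otimes> b\<close> is evaluation at \<open>(a, b)\<close>.\<close>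

definition elem_tensor ::
  "'a nalgebra \<Rightarrow> 'b nalgebra \<Rightarrow> 'a \<Rightarrow> 'b \<Rightarrow> ('a \<Rightarrow> 'b \<Rightarrow> complex) \<Rightarrow> complex" where
  "elem_tensor A B a b = (\<lambda>\<beta>. if bilinear_form A B \<beta> then \<beta> a b else 0)"

definition tensor_sum ::
  "'a nalgebra \<Rightarrow> 'b nalgebra \<Rightarrow> ('a \<times> 'b) list \<Rightarrow> ('a \<Rightarrow> 'b \<Rightarrow> complex) \<Rightarrow> complex" where
  "tensor_sum A B xs = (\<lambda>\<beta>. \<Sum>(a, b)\<leftarrow>xs. elem_tensor A B a b \<beta>)"

definition projective_norm ::
  "'a nalgebra \<Rightarrow> 'b nalgebra \<Rightarrow> (('a \<Rightarrow> 'b \<Rightarrow> complex) \<Rightarrow> complex) \<Rightarrow> real" where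
  "projective_norm A B u =
     Inf {(\<Sum>(a, b)\<leftarrow>xs. vnorm A a * vnorm B b) | xs.
            set xs \<subseteq> carrier A \<times> carrier B \<and> u = tensor_sum A B xs}"

text \<open>The product is the bilinear extension of \<open>(a \<otimes> b) (c \<otimes> d) = a c \<otimes> b d\<close>: evaluate the form
  \<open>\<beta> (a c) (b d)\<close> at \<open>v\<close> in the variables \<open>c, d\<close> and at \<open>u\<close> in the variables \<open>a, b\<close>.\<close>

definition tensor_mult ::
  "'a nalgebra \<Rightarrow> 'b nalgebra \<Rightarrow>
     (('a \<Rightarrow> 'b \<Rightarrow> complex) \<Rightarrow> complex) \<Rightarrow> (('a \<Rightarrow> 'b \<Rightarrow> complex) \<Rightarrow> complex) \<Rightarrow>
     ('a \<Rightarrow> 'b \<Rightarrow> complex) \<Rightarrow> complex" where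
  "tensor_mult A B u v =
     (\<lambda>\<beta>. if bilinear_form A B \<beta>
           then u (\<lambda>a b. v (\<lambda>c d. \<beta> (amult A a c) (amult B b d))) else 0)"

definition algebraic_tensor ::
  "'a nalgebra \<Rightarrow> 'b nalgebra \<Rightarrow> (('a \<Rightarrow> 'b \<Rightarrow> complex) \<Rightarrow> complex) nalgebra" where
  "algebraic_tensor A B =
     \<lparr>carrier = {tensor_sum A B xs | xs. set xs \<subseteq> carrier A \<times> carrier B},
      vadd = (\<lambda>u v \<beta>. u \<beta> + v \<beta>),
      vscale = (\<lambda>c u \<beta>. c * u \<beta>),
      vnorm = projective_norm A B,
      amult = tensor_mult A B\<rparr>"

definition projective_tensor ::
  "'a nalgebra \<Rightarrow> 'b nalgebra \<Rightarrow> (nat \<Rightarrow> ('a \<Rightarrow> 'b \<Rightarrow> complex) \<Rightarrow> complex) set nalgebra"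
  (infixl \<open>\<otimes>\<^sub>\<pi>\<close> 70) where
  "A \<otimes>\<^sub>\<pi> B = banach_completion (algebraic_tensor A B)"


section \<open>Locally compact groups\<close>

text \<open>Groups are types of class \<^class>\<open>topological_group_add\<close>, which does not assume
  commutativity: \<open>x + y\<close> is the product \<open>x y\<close>, \<open>- x\<close> the inverse and \<open>0\<close> the identity.
  Haar measures are Radon measures: finite on compact sets, outer regular on Borel sets and inner
  regular on open sets.\<close>

definition left_haar_measure :: "'g::{topological_group_add, t2_space} measure \<Rightarrow> bool" where
  "left_haar_measure \<mu> \<longleftrightarrow>
     sets \<mu> = sets borel \<and>
     emeasure \<mu> UNIV \<noteq> 0 \<and>
     (\<forall>K. compact K \<longrightarrow> emeasure \<mu> K < \<infinity>) \<and>
     (\<forall>E\<in>sets borel. emeasure \<mu> E = (INF U\<in>{U. open U \<and> E \<subseteq> U}. emeasure \<mu> U)) \<and>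
     (\<forall>U. open U \<longrightarrow> emeasure \<mu> U = (SUP K\<in>{K. compact K \<and> K \<subseteq> U}. emeasure \<mu> K)) \<and>
     (\<forall>g. \<forall>E\<in>sets borel. emeasure \<mu> ((\<lambda>x. g + x) ` E) = emeasure \<mu> E)"

definition IN_group :: "'g::{topological_group_add, t2_space} itself \<Rightarrow> bool" where
  "IN_group _ \<longleftrightarrow>
     (\<exists>K :: 'g set. compact K \<and> 0 \<in> interior K \<and> (\<forall>g. (\<lambda>x. g + x + - g) ` K = K))"

definition locally_AE :: "'g::topological_space measure \<Rightarrow> ('g \<Rightarrow> bool) \<Rightarrow> bool" where
  "locally_AE \<mu> P \<longleftrightarrow> (\<forall>K. compact K \<longrightarrow> (AE x in \<mu>. x \<in> K \<longrightarrow> P x))"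

text \<open>\<open>L\<^sup>\<infinity>(G)\<close> in the sense appropriate to Haar measures that need not be \<open>\<sigma>\<close>-finite: functions that
  are locally Haar measurable and bounded locally almost everywhere.\<close>

definition Linfty :: "'g::topological_space measure \<Rightarrow> ('g \<Rightarrow> complex) set" where
  "Linfty \<mu> =
     {f. (\<forall>K. compact K \<longrightarrow> f \<in> borel_measurable (restrict_space (completion \<mu>) K)) \<and>
         (\<exists>C. locally_AE \<mu> (\<lambda>x. cmod (f x) \<le> C))}"

text \<open>A left invariant mean \<open>m\<close> on \<open>L\<^sup>\<infinity>(G)\<close>, with \<open>\<parallel>m\<parallel> = m(1) = 1\<close>.  The norm bound with \<open>C = 0\<close>
  makes \<open>m\<close> depend only on the class of \<open>f\<close> modulo locally null functions.\<close>

definition left_invariant_mean ::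
  "'g::topological_group_add measure \<Rightarrow> (('g \<Rightarrow> complex) \<Rightarrow> complex) \<Rightarrow> bool" where
  "left_invariant_mean \<mu> m \<longleftrightarrow>
     (\<forall>f\<in>Linfty \<mu>. \<forall>h\<in>Linfty \<mu>. m (\<lambda>x. f x + h x) = m f + m h) \<and>
     (\<forall>c. \<forall>f\<in>Linfty \<mu>. m (\<lambda>x. c * f x) = c * m f) \<and>
     (\<forall>f\<in>Linfty \<mu>. \<forall>C. locally_AE \<mu> (\<lambda>x. cmod (f x) \<le> C) \<longrightarrow> cmod (m f) \<le> C) \<and>
     m (\<lambda>x. 1) = 1 \<and>
     (\<forall>g. \<forall>f\<in>Linfty \<mu>. m (\<lambda>x. f (- g + x)) = m f)"

text \<open>Since Haar measures are unique up to scaling, this does not depend on the choice of \<open>\<mu>\<close>.\<close>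

definition amenable :: "'g::topological_group_add measure \<Rightarrow> bool" where
  "amenable \<mu> \<longleftrightarrow> (\<exists>m. left_invariant_mean \<mu> m)"


section \<open>Beurling algebras\<close>

definition weight :: "('g::topological_group_add \<Rightarrow> real) \<Rightarrow> bool" where
  "weight \<omega> \<longleftrightarrow>
     \<omega> \<in> borel_measurable borel \<and> (\<forall>x. \<omega> x > 0) \<and> (\<forall>x y. \<omega> (x + y) \<le> \<omega> x * \<omega> y)"

text \<open>Haar measurable means measurable for the completion of \<open>\<mu>\<close>.\<close>

definition beurling_functions ::
  "'g::topological_group_add measure \<Rightarrow> ('g \<Rightarrow> real) \<Rightarrow> ('g \<Rightarrow> complex) set" where
  "beurling_functions \<mu> \<omega> =
     {f \<in> borel_measurable (completion \<mu>). integrable (completion \<mu>) (\<lambda>x. cmod (f x) * \<omega> x)}"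

definition convolution ::
  "'g::topological_group_add measure \<Rightarrow> ('g \<Rightarrow> complex) \<Rightarrow> ('g \<Rightarrow> complex) \<Rightarrow> 'g \<Rightarrow> complex" where
  "convolution \<mu> f h = (\<lambda>x. LINT y|completion \<mu>. f y * h (- y + x))"

definition beurling_function_algebra ::
  "'g::topological_group_add measure \<Rightarrow> ('g \<Rightarrow> real) \<Rightarrow> ('g \<Rightarrow> complex) nalgebra" where
  "beurling_function_algebra \<mu> \<omega> =
     \<lparr>carrier = beurling_functions \<mu> \<omega>,
      vadd = (\<lambda>f h x. f x + h x),
      vscale = (\<lambda>c f x. c * f x),
      vnorm = (\<lambda>f. LINT x|completion \<mu>. cmod (f x) * \<omega> x),
      amult = convolution \<mu>\<rparr>"

definition beurling_algebra ::
  "'g::topological_group_add measure \<Rightarrow> ('g \<Rightarrow> real) \<Rightarrow> ('g \<Rightarrow> complex) set nalgebra" where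
  "beurling_algebra \<mu> \<omega> =
     quotient_algebra (beurling_function_algebra \<mu> \<omega>)
       {(f, h). f \<in> beurling_functions \<mu> \<omega> \<and> h \<in> beurling_functions \<mu> \<omega> \<and>
                (AE x in completion \<mu>. f x = h x)}"

definition central_beurling_algebra ::
  "'g::topological_group_add measure \<Rightarrow> ('g \<Rightarrow> real) \<Rightarrow> ('g \<Rightarrow> complex) set nalgebra" where
  "central_beurling_algebra \<mu> \<omega> =
     (beurling_algebra \<mu> \<omega>)
       \<lparr>carrier := {F \<in> carrier (beurling_algebra \<mu> \<omega>).
          \<forall>f\<in>F. \<forall>g. AE x in completion \<mu>. f (- g + x + g) = f x}\<rparr>"

end

theory Submission
  imports Defs
begin

text \<open>Derivations of \<open>A\<close> into its dual are bilinear forms, so that weak amenability of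
  \<open>A \<otimes>\<^sub>\<pi> B\<close> becomes a statement about bounded forms on the algebraic tensor product.  If \<open>A\<close> and
  \<open>B\<close> are commutative and weakly amenable and \<open>D\<close> is such a derivation, then the maps
  \<open>c \<mapsto> D(a c) - a D(c)\<close>, with \<open>a\<close> acting as the multiplier \<open>a \<otimes> 1\<close>, are module maps which depend
  on \<open>a\<close> as a derivation; hence \<open>D\<close> commutes with the actions of \<open>A\<close> and \<open>B\<close>, and comparison with
  the Leibniz rule gives \<open>D = 0\<close>.  Conversely a character \<open>\<phi>\<close> of \<open>B\<close> maps \<open>A \<otimes>\<^sub>\<pi> B\<close> onto \<open>A\<close>, along
  which derivations of \<open>A\<close> pull back.  Averaging \<open>ln \<omega>(y x) - ln \<omega>(x)\<close> over an amenable group produces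
  a continuous homomorphism \<open>G \<rightarrow> (0, \<infinity>)\<close> below the weight \<open>\<omega>\<close>; it defines a character of the central Beurling
  algebra, which does not vanish at the indicator of a compact invariant neighbourhood of the identity.\<close>

section \<open>Weak amenability and derivation forms\<close>

text \<open>Two obstacles shape the argument. No unit is available, so a \<otimes> 1 need not lie in
  the tensor product. Identities are therefore obtained for products of elements and then spread to
  all elements, because a bounded functional on a weakly amenable algebra that vanishes on all
  products is zero. The other obstacle is analytic: Haar measure need not be \<sigma>-finite, and
  addition need not be measurable for the product of the Borel \<sigma>-algebras, so Fubini's
  theorem cannot be applied on the whole group. Finitely many integrable functions, however, vanish
  almost everywhere off one open \<sigma>-compact subgroup, and there each has a version f for which
  f(y + x) is jointly measurable. Commutativity of the central algebra rests on unimodularity, which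
  the invariant neighbourhood of an [IN] group provides. The weight is only Borel measurable; a
  Steinhaus argument bounds it near the identity, which gives the continuity of the homomorphism
  below it and the integrability of the indicator.\<close>

definition derivation_form :: "'a nalgebra \<Rightarrow> ('a \<Rightarrow> 'a \<Rightarrow> complex) \<Rightarrow> bool" where
  "derivation_form A d \<longleftrightarrow>
     bilinear_form A A d \<and>
     (\<exists>C. \<forall>a\<in>carrier A. \<forall>x\<in>carrier A. cmod (d a x) \<le> C * vnorm A a * vnorm A x) \<and>
     (\<forall>a\<in>carrier A. \<forall>b\<in>carrier A. \<forall>x\<in>carrier A.
        d (amult A a b) x = d b (amult A x a) + d a (amult A b x))"

text \<open>Membership in the dual without the normalisation off the carrier, so that a partially
  applied form such as \<open>d a\<close> or \<open>\<lambda>a. d a x\<close> qualifies as it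
  stands.\<close>

definition bounded_functional :: "'a nalgebra \<Rightarrow> ('a \<Rightarrow> complex) \<Rightarrow> bool" where
  "bounded_functional A \<phi> \<longleftrightarrow>
     (\<forall>x\<in>carrier A. \<forall>y\<in>carrier A. \<phi> (vadd A x y) = \<phi> x + \<phi> y) \<and>
     (\<forall>c. \<forall>x\<in>carrier A. \<phi> (vscale A c x) = c * \<phi> x) \<and>
     (\<exists>C. \<forall>x\<in>carrier A. cmod (\<phi> x) \<le> C * vnorm A x)"

lemma bounded_functional_iff:
  "bounded_functional A \<phi> \<longleftrightarrow> bounded_linear_map A complex_space \<phi>"
  by (auto simp: bounded_functional_def bounded_linear_map_def complex_space_def)

text \<open>The norm may be a seminorm and no vector space law is stated. One interface therefore
  serves function algebras, spaces of Cauchy sequences and the quotients of either.\<close>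

locale algebra_base =
  fixes A :: "'a nalgebra"
  assumes carrier_nonempty: "carrier A \<noteq> {}"
    and add_closed: "a \<in> carrier A \<Longrightarrow> b \<in> carrier A \<Longrightarrow> vadd A a b \<in> carrier A"
    and scale_closed: "a \<in> carrier A \<Longrightarrow> vscale A c a \<in> carrier A"
    and mult_closed: "a \<in> carrier A \<Longrightarrow> b \<in> carrier A \<Longrightarrow> amult A a b \<in> carrier A"
    and norm_nonneg: "a \<in> carrier A \<Longrightarrow> 0 \<le> vnorm A a"
    and norm_scale: "a \<in> carrier A \<Longrightarrow> vnorm A (vscale A c a) = cmod c * vnorm A a"
begin

text \<open>Scaling by \<open>0\<close> yields a point of the unit ball. The \<open>Sup\<close> of
  reals in the dual norm needs a nonempty set; \<open>dual_norm_bdd\<close> supplies its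
  boundedness.\<close>

lemma ex_norm_zero: "\<exists>x\<in>carrier A. vnorm A x = 0"
  using carrier_nonempty norm_scale[where c = 0] scale_closed by fastforce

lemma dual_carrier_iff:
  "\<phi> \<in> carrier (dual A) \<longleftrightarrow> bounded_functional A \<phi> \<and> (\<forall>x. x \<notin> carrier A \<longrightarrow> \<phi> x = 0)"
  by (simp add: dual_def bounded_functional_iff)

lemma dual_norm_bdd:
  assumes "bounded_functional A \<phi>"
  shows "bdd_above {cmod (\<phi> x) | x. x \<in> carrier A \<and> vnorm A x \<le> 1}"
proof -
  obtain C where C: "\<And>x. x \<in> carrier A \<Longrightarrow> cmod (\<phi> x) \<le> C * vnorm A x"
    using assms unfolding bounded_functional_def by blast
  have "cmod (\<phi> x) \<le> max C 0" if "x \<in> carrier A" "vnorm A x \<le> 1" for x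
  proof -
    have "C * vnorm A x \<le> max C 0 * 1"
      by (rule mult_mono) (use that norm_nonneg in auto)
    with C[OF that(1)] show ?thesis by simp
  qed
  then show ?thesis by (auto simp: bdd_above_def)
qed

lemma dual_norm_upper:
  assumes \<phi>: "bounded_functional A \<phi>" and x: "x \<in> carrier A"
  shows "cmod (\<phi> x) \<le> vnorm (dual A) \<phi> * vnorm A x"
\<comment> \<open>A seminorm may vanish at \<open>x\<close>; the bound for \<open>\<phi>\<close>
  then forces the value \<open>0\<close>. Otherwise \<open>x\<close> can be normalised into the unit
  ball.\<close>
proof (cases "vnorm A x = 0")
  case True
  then show ?thesis using \<phi> x by (fastforce simp: bounded_functional_def)
next
  case False
  then have pos: "vnorm A x > 0" using norm_nonneg[OF x] by simp
  define y where "y = vscale A (inverse (complex_of_real (vnorm A x))) x"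
  have y: "y \<in> carrier A" "vnorm A y \<le> 1"
    using x pos by (auto simp: y_def scale_closed norm_scale norm_inverse)
  have "cmod (\<phi> y) \<le> vnorm (dual A) \<phi>"
    unfolding dual_def using y dual_norm_bdd[OF \<phi>] by (auto intro!: cSup_upper)
  moreover have "cmod (\<phi> y) = cmod (\<phi> x) / vnorm A x"
    using \<phi> x pos by (simp add: bounded_functional_def y_def norm_mult norm_inverse divide_inverse_commute)
  ultimately show ?thesis using pos by (simp add: field_simps)
qed

lemma dual_norm_least:
  assumes "\<And>x. x \<in> carrier A \<Longrightarrow> cmod (\<phi> x) \<le> C * vnorm A x" and "0 \<le> C"
  shows "vnorm (dual A) \<phi> \<le> C"
proof -
  have "cmod (\<phi> x) \<le> C" if "x \<in> carrier A" "vnorm A x \<le> 1" for x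
    using assms(1)[OF that(1)] mult_left_mono[OF that(2) assms(2)] by simp
  moreover obtain x where "x \<in> carrier A" "vnorm A x = 0" using ex_norm_zero by blast
  then have "{cmod (\<phi> x) | x. x \<in> carrier A \<and> vnorm A x \<le> 1} \<noteq> {}" by force
  ultimately show ?thesis unfolding dual_def by (auto intro!: cSup_least)
qed

text \<open>A map into the dual is a form in two arguments, with \<open>d a x\<close> for
  \<open>D a x\<close>. Unfolding both module actions in the Leibniz rule gives the last clause of
  \<open>derivation_form\<close>. The dual space disappears from everything that follows.\<close>

lemma weakly_amenable_iff:
  "weakly_amenable A \<longleftrightarrow>
     (\<forall>d. derivation_form A d \<longrightarrow> (\<forall>a\<in>carrier A. \<forall>x\<in>carrier A. d a x = 0))"
proof (intro iffI allI impI ballI)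
  fix d a x
  assume wa: "weakly_amenable A" and d: "derivation_form A d"
    and ax: "a \<in> carrier A" "x \<in> carrier A"
  obtain C0 where C0: "\<And>a x. a \<in> carrier A \<Longrightarrow> x \<in> carrier A \<Longrightarrow>
      cmod (d a x) \<le> C0 * vnorm A a * vnorm A x"
    using d unfolding derivation_form_def by blast
  \<comment> \<open>\<open>dual_norm_least\<close> needs a nonnegative constant, while
    \<open>C0\<close> may be negative if all norms vanish.\<close>
  define C where "C = max C0 0"
  have C_nonneg: "0 \<le> C" by (simp add: C_def)
  have C: "cmod (d a x) \<le> C * vnorm A a * vnorm A x" if "a \<in> carrier A" "x \<in> carrier A" for a x
    using C0[OF that] mult_right_mono[of C0 C "vnorm A a * vnorm A x"] norm_nonneg that
    by (simp add: C_def mult.assoc)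
  \<comment> \<open>Elements of the dual must vanish off the carrier, so the form is cut off
    there.\<close>
  define D where "D a x = (if x \<in> carrier A then d a x else 0)" for a x
  have bf: "bounded_functional A (D b)" if "b \<in> carrier A" for b
    using d C[OF that] that add_closed scale_closed
    by (auto simp: bounded_functional_def derivation_form_def bilinear_form_def D_def)
  have "bounded_linear_map A (dual A) D"
    unfolding bounded_linear_map_def
  proof (intro conjI ballI allI)
    fix b assume "b \<in> carrier A"
    then show "D b \<in> carrier (dual A)" using bf by (auto simp: dual_carrier_iff D_def)
  next
    show "\<exists>C. \<forall>b\<in>carrier A. vnorm (dual A) (D b) \<le> C * vnorm A b"
      by (intro exI[of _ C] ballI dual_norm_least) (auto simp: D_def C C_nonneg norm_nonneg)
  qed (use d in \<open>auto simp: dual_def D_def derivation_form_def bilinear_form_def fun_eq_iff\<close>)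
  then have "continuous_derivation A (dual A) (dual_left A) (dual_right A) D"
    using d mult_closed unfolding continuous_derivation_def
    by (auto simp: dual_def D_def dual_left_def dual_right_def derivation_form_def fun_eq_iff)
  then have "D a x = 0" using wa ax by (auto simp: weakly_amenable_def)
  then show "d a x = 0" using ax by (simp add: D_def)
next
  assume *: "\<forall>d. derivation_form A d \<longrightarrow> (\<forall>a\<in>carrier A. \<forall>x\<in>carrier A. d a x = 0)"
  show "weakly_amenable A"
    unfolding weakly_amenable_def
  proof (intro allI impI ballI)
    fix D a
    assume "continuous_derivation A (dual A) (dual_left A) (dual_right A) D" and a: "a \<in> carrier A"
    then have lin: "bounded_linear_map A (dual A) D"
      and der: "\<And>a b. a \<in> carrier A \<Longrightarrow> b \<in> carrier A \<Longrightarrow>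
        D (amult A a b) = vadd (dual A) (dual_left A a (D b)) (dual_right A (D a) b)"
      by (auto simp: continuous_derivation_def)
    have D: "bounded_functional A (D b) \<and> (\<forall>x. x \<notin> carrier A \<longrightarrow> D b x = 0)"
      if "b \<in> carrier A" for b
      using lin that by (auto simp: bounded_linear_map_def simp flip: dual_carrier_iff)
    have "bilinear_form A A D"
      using lin D unfolding bilinear_form_def
      by (auto simp: bounded_linear_map_def dual_def bounded_functional_def)
    moreover obtain C where C: "\<And>b. b \<in> carrier A \<Longrightarrow> vnorm (dual A) (D b) \<le> C * vnorm A b"
      using lin unfolding bounded_linear_map_def by blast
    have "cmod (D b x) \<le> C * vnorm A b * vnorm A x" if "b \<in> carrier A" "x \<in> carrier A" for b x
      using dual_norm_upper[of "D b" x] D that mult_right_mono[OF C[OF that(1)] norm_nonneg[OF that(2)]]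
      by simp
    ultimately have "derivation_form A D"
      using der by (auto simp: derivation_form_def dual_def dual_left_def dual_right_def)
    then have "D a x = 0" for x using * D[OF a] a by blast
    then show "D a = (\<lambda>x. 0)" by blast
  qed
qed

end


lemma (in algebra_base) derivation_form_functional:
  assumes d: "derivation_form A d" and z: "z \<in> carrier A"
  shows "bounded_functional A (d z)" "bounded_functional A (\<lambda>a. d a z)"
proof -
  obtain C where C: "\<And>a x. a \<in> carrier A \<Longrightarrow> x \<in> carrier A \<Longrightarrow>
      cmod (d a x) \<le> C * vnorm A a * vnorm A x"
    using d unfolding derivation_form_def by blast
  have "cmod (d a z) \<le> (C * vnorm A z) * vnorm A a" if "a \<in> carrier A" for a
    using C[OF that z] by (simp add: mult_ac)
  then show "bounded_functional A (d z)" "bounded_functional A (\<lambda>a. d a z)"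
    using d z C[OF z] unfolding bounded_functional_def derivation_form_def bilinear_form_def by blast+
qed


section \<open>Quotient algebras\<close>

locale algebra_congruence = algebra_base A for A :: "'a nalgebra" +
  fixes R :: "('a \<times> 'a) set"
  assumes R_equiv: "equiv (carrier A) R"
    and add_cong: "(a, a') \<in> R \<Longrightarrow> (b, b') \<in> R \<Longrightarrow> (vadd A a b, vadd A a' b') \<in> R"
    and scale_cong: "(a, a') \<in> R \<Longrightarrow> (vscale A c a, vscale A c a') \<in> R"
    and mult_cong: "(a, a') \<in> R \<Longrightarrow> (b, b') \<in> R \<Longrightarrow> (amult A a b, amult A a' b') \<in> R"
    and norm_cong: "(a, a') \<in> R \<Longrightarrow> vnorm A a = vnorm A a'"
begin

abbreviation "Q \<equiv> quotient_algebra A R"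
abbreviation "cls a \<equiv> R `` {a}"

lemma cls_eq: "(a, b) \<in> R \<Longrightarrow> cls a = cls b"
  using R_equiv by (rule equiv_class_eq)

lemma cls_self: "a \<in> carrier A \<Longrightarrow> a \<in> cls a"
  using R_equiv by (rule equiv_class_self)

lemma carrier_Q: "carrier Q = cls ` carrier A"
  by (auto simp: quotient_algebra_def quotient_def)

lemma cls_in_Q: "a \<in> carrier A \<Longrightarrow> cls a \<in> carrier Q"
  by (simp add: carrier_Q)

text \<open>The union in \<open>quotient_algebra\<close> runs over all representatives, and
  compatibility makes all its members the same class. Products and scalar multiples are treated
  likewise.\<close>

lemma add_Q:
  assumes "a \<in> carrier A" "b \<in> carrier A"
  shows "vadd Q (cls a) (cls b) = cls (vadd A a b)"
proof -
  have "cls (vadd A f g) = cls (vadd A a b)" if "f \<in> cls a" "g \<in> cls b" for f g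
    using that by (intro cls_eq[symmetric] add_cong) auto
  then have "(\<Union>f\<in>cls a. \<Union>g\<in>cls b. cls (vadd A f g)) = (\<Union>f\<in>cls a. \<Union>g\<in>cls b. cls (vadd A a b))"
    by (intro SUP_cong refl)
  also have "\<dots> = cls (vadd A a b)" using cls_self[OF assms(1)] cls_self[OF assms(2)] by blast
  finally show ?thesis by (simp add: quotient_algebra_def)
qed

lemma mult_Q:
  assumes "a \<in> carrier A" "b \<in> carrier A"
  shows "amult Q (cls a) (cls b) = cls (amult A a b)"
proof -
  have "cls (amult A f g) = cls (amult A a b)" if "f \<in> cls a" "g \<in> cls b" for f g
    using that by (intro cls_eq[symmetric] mult_cong) auto
  then have "(\<Union>f\<in>cls a. \<Union>g\<in>cls b. cls (amult A f g)) = (\<Union>f\<in>cls a. \<Union>g\<in>cls b. cls (amult A a b))"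
    by (intro SUP_cong refl)
  also have "\<dots> = cls (amult A a b)" using cls_self[OF assms(1)] cls_self[OF assms(2)] by blast
  finally show ?thesis by (simp add: quotient_algebra_def)
qed

lemma scale_Q:
  assumes "a \<in> carrier A"
  shows "vscale Q c (cls a) = cls (vscale A c a)"
proof -
  have "cls (vscale A c f) = cls (vscale A c a)" if "f \<in> cls a" for f
    using that by (intro cls_eq[symmetric] scale_cong) auto
  then have "(\<Union>f\<in>cls a. cls (vscale A c f)) = (\<Union>f\<in>cls a. cls (vscale A c a))"
    by (intro SUP_cong refl)
  also have "\<dots> = cls (vscale A c a)" using cls_self[OF assms] by blast
  finally show ?thesis by (simp add: quotient_algebra_def)
qed

lemma norm_Q:
  assumes "a \<in> carrier A"
  shows "vnorm Q (cls a) = vnorm A a"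
proof -
  have "vnorm A f = vnorm A a" if "f \<in> cls a" for f
    using that norm_cong[of a f] by simp
  then have "vnorm A ` cls a = {vnorm A a}" using cls_self[OF assms] by blast
  then show ?thesis by (simp add: quotient_algebra_def)
qed

lemma algebra_base_Q: "algebra_base Q"
proof
  show "carrier Q \<noteq> {}" using carrier_nonempty by (simp add: carrier_Q)
qed (auto simp: carrier_Q add_Q mult_Q scale_Q norm_Q add_closed mult_closed scale_closed
       norm_nonneg norm_scale)

end


section \<open>Completions of function algebras\<close>

text \<open>Vectors are complex-valued functions with pointwise operations, so the linear laws come
  from arithmetic of complex numbers and only the product and the seminorm need axioms. The instance
  is the algebraic tensor product, whose elements are functions of a bilinear form.\<close>

locale function_algebra = algebra_base T for T :: "('i \<Rightarrow> complex) nalgebra" +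
  assumes add_eq: "vadd T = (\<lambda>u v i. u i + v i)"
    and scale_eq: "vscale T = (\<lambda>c u i. c * u i)"
    and norm_add: "u \<in> carrier T \<Longrightarrow> v \<in> carrier T \<Longrightarrow> vnorm T (\<lambda>i. u i + v i) \<le> vnorm T u + vnorm T v"
    and norm_submult: "u \<in> carrier T \<Longrightarrow> v \<in> carrier T \<Longrightarrow> vnorm T (amult T u v) \<le> vnorm T u * vnorm T v"
    and mult_add_left: "u \<in> carrier T \<Longrightarrow> v \<in> carrier T \<Longrightarrow> w \<in> carrier T \<Longrightarrow>
          amult T (\<lambda>i. u i + v i) w = (\<lambda>i. amult T u w i + amult T v w i)"
    and mult_add_right: "u \<in> carrier T \<Longrightarrow> v \<in> carrier T \<Longrightarrow> w \<in> carrier T \<Longrightarrow>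
          amult T w (\<lambda>i. u i + v i) = (\<lambda>i. amult T w u i + amult T w v i)"
    and mult_scale_left: "u \<in> carrier T \<Longrightarrow> w \<in> carrier T \<Longrightarrow>
          amult T (\<lambda>i. c * u i) w = (\<lambda>i. c * amult T u w i)"
    and mult_scale_right: "u \<in> carrier T \<Longrightarrow> w \<in> carrier T \<Longrightarrow>
          amult T w (\<lambda>i. c * u i) = (\<lambda>i. c * amult T w u i)"
begin

lemma vdiff_eq: "vdiff T u v = (\<lambda>i. u i - v i)"
  by (simp add: vdiff_def add_eq scale_eq)

lemma fun_add_closed: "u \<in> carrier T \<Longrightarrow> v \<in> carrier T \<Longrightarrow> (\<lambda>i. u i + v i) \<in> carrier T"
  using add_closed by (simp add: add_eq)

lemma fun_scale_closed: "u \<in> carrier T \<Longrightarrow> (\<lambda>i. c * u i) \<in> carrier T"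
  using scale_closed by (simp add: scale_eq)

lemma fun_diff_closed: "u \<in> carrier T \<Longrightarrow> v \<in> carrier T \<Longrightarrow> (\<lambda>i. u i - v i) \<in> carrier T"
  using fun_add_closed[OF _ fun_scale_closed[of v "-1"], of u] by simp

lemma fun_norm_scale: "u \<in> carrier T \<Longrightarrow> vnorm T (\<lambda>i. c * u i) = cmod c * vnorm T u"
  using norm_scale by (simp add: scale_eq)

lemma norm_minus_commute:
  assumes "u \<in> carrier T" "v \<in> carrier T"
  shows "vnorm T (\<lambda>i. u i - v i) = vnorm T (\<lambda>i. v i - u i)"
  using fun_norm_scale[OF fun_diff_closed[OF assms], of "-1"] by simp

lemma norm_diff_triangle:
  assumes "u \<in> carrier T" "v \<in> carrier T" "w \<in> carrier T"
  shows "vnorm T (\<lambda>i. u i - w i) \<le> vnorm T (\<lambda>i. u i - v i) + vnorm T (\<lambda>i. v i - w i)"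
  using norm_add[OF fun_diff_closed[OF assms(1,2)] fun_diff_closed[OF assms(2,3)]] by simp

lemma norm_diff_ge:
  assumes "u \<in> carrier T" "v \<in> carrier T"
  shows "\<bar>vnorm T u - vnorm T v\<bar> \<le> vnorm T (\<lambda>i. u i - v i)"
  using norm_add[OF fun_diff_closed[OF assms] assms(2)]
    norm_add[OF fun_diff_closed[OF assms(2,1)] assms(1)] norm_minus_commute[OF assms]
  by simp

text \<open>Telescoping through the mixed product of \<open>u'\<close> and \<open>v\<close>. It
  serves twice: products of Cauchy sequences are Cauchy, and products respect null
  differences.\<close>

lemma mult_diff:
  assumes "u \<in> carrier T" "v \<in> carrier T" "u' \<in> carrier T" "v' \<in> carrier T"
  shows "vnorm T (\<lambda>i. amult T u v i - amult T u' v' i)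
    \<le> vnorm T (\<lambda>i. u i - u' i) * vnorm T v + vnorm T u' * vnorm T (\<lambda>i. v i - v' i)"
proof -
  have 1: "amult T (\<lambda>i. u i - u' i) v = (\<lambda>i. amult T u v i - amult T u' v i)"
    using mult_add_left[OF assms(1) fun_scale_closed[OF assms(3), of "-1"] assms(2)]
      mult_scale_left[OF assms(3,2), of "-1"] by simp
  have 2: "amult T u' (\<lambda>i. v i - v' i) = (\<lambda>i. amult T u' v i - amult T u' v' i)"
    using mult_add_right[OF assms(2) fun_scale_closed[OF assms(4), of "-1"] assms(3)]
      mult_scale_right[OF assms(4,3), of "-1"] by simp
  have "vnorm T (\<lambda>i. amult T u v i - amult T u' v' i)
      \<le> vnorm T (amult T (\<lambda>i. u i - u' i) v) + vnorm T (amult T u' (\<lambda>i. v i - v' i))"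
    unfolding 1 2 using assms by (intro norm_diff_triangle mult_closed)
  also have "\<dots> \<le> vnorm T (\<lambda>i. u i - u' i) * vnorm T v + vnorm T u' * vnorm T (\<lambda>i. v i - v' i)"
    using assms by (intro add_mono norm_submult fun_diff_closed)
  finally show ?thesis .
qed

lemma cauchy_iff:
  "X \<in> cauchy_sequences T \<longleftrightarrow> (\<forall>n. X n \<in> carrier T) \<and>
     (\<forall>e>0. \<exists>N. \<forall>m\<ge>N. \<forall>n\<ge>N. vnorm T (\<lambda>i. X m i - X n i) < e)"
  by (simp add: cauchy_sequences_def vdiff_eq)

lemma cauchy_in: "X \<in> cauchy_sequences T \<Longrightarrow> X n \<in> carrier T"
  by (simp add: cauchy_iff)

lemma cauchyD:
  "X \<in> cauchy_sequences T \<Longrightarrow> 0 < e \<Longrightarrow> \<exists>N. \<forall>m\<ge>N. \<forall>n\<ge>N. vnorm T (\<lambda>i. X m i - X n i) < e"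
  by (simp add: cauchy_iff)

lemma cauchy_const: "u \<in> carrier T \<Longrightarrow> (\<lambda>n. u) \<in> cauchy_sequences T"
  using fun_norm_scale[of u 0] by (simp add: cauchy_iff)

lemma cauchy_norm_Cauchy:
  assumes "X \<in> cauchy_sequences T"
  shows "Cauchy (\<lambda>n. vnorm T (X n))"
proof (rule metric_CauchyI)
  fix e :: real assume "0 < e"
  then obtain N where N: "\<forall>m\<ge>N. \<forall>n\<ge>N. vnorm T (\<lambda>i. X m i - X n i) < e"
    using cauchyD[OF assms] by blast
  show "\<exists>N. \<forall>m\<ge>N. \<forall>n\<ge>N. dist (vnorm T (X m)) (vnorm T (X n)) < e"
    using N norm_diff_ge[OF cauchy_in[OF assms] cauchy_in[OF assms]]
    unfolding dist_real_def by (meson le_less_trans)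
qed

lemma cauchy_norm_tendsto:
  "X \<in> cauchy_sequences T \<Longrightarrow> (\<lambda>n. vnorm T (X n)) \<longlonglongrightarrow> lim (\<lambda>n. vnorm T (X n))"
  using cauchy_norm_Cauchy by (simp add: Cauchy_convergent_iff convergent_LIMSEQ_iff)

lemma cauchy_bounded:
  assumes "X \<in> cauchy_sequences T"
  obtains K where "K > 0" "\<And>n. vnorm T (X n) \<le> K"
proof -
  have "Bseq (\<lambda>n. vnorm T (X n))"
    using cauchy_norm_Cauchy[OF assms] by (rule Cauchy_Bseq)
  then obtain K where "K > 0" "\<forall>n. \<bar>vnorm T (X n)\<bar> \<le> K" by (auto simp: Bseq_def)
  then show ?thesis by (intro that[of K]) (auto simp: abs_le_iff)
qed

text \<open>The function \<open>h\<close> is arbitrary so that sums, multiples, products and bounded bilinear forms of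
  Cauchy sequences are all covered.\<close>

lemma cauchy_transfer:
  fixes h :: "nat \<Rightarrow> nat \<Rightarrow> real"
  assumes X: "X \<in> cauchy_sequences T" and Y: "Y \<in> cauchy_sequences T" and K: "K \<ge> 0"
    and h: "\<And>m n. h m n \<le> K * (vnorm T (\<lambda>i. X m i - X n i) + vnorm T (\<lambda>i. Y m i - Y n i))"
    and e: "0 < e"
  shows "\<exists>N. \<forall>m\<ge>N. \<forall>n\<ge>N. h m n < e"
proof -
  \<comment> \<open>The factor \<open>2\<close> shares \<open>e\<close> between the two sequences,
    and \<open>K + 1\<close> in place of \<open>K\<close> admits \<open>K = 0\<close>.\<close>
  define \<delta> where "\<delta> = e / (2 * (K + 1))"
  have \<delta>: "\<delta> > 0" using e K by (simp add: \<delta>_def)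
  obtain N where N: "\<forall>m\<ge>N. \<forall>n\<ge>N. vnorm T (\<lambda>i. X m i - X n i) < \<delta>" using cauchyD[OF X \<delta>] by blast
  obtain M where M: "\<forall>m\<ge>M. \<forall>n\<ge>M. vnorm T (\<lambda>i. Y m i - Y n i) < \<delta>" using cauchyD[OF Y \<delta>] by blast
  have "h m n < e" if "m \<ge> max N M" "n \<ge> max N M" for m n
  proof -
    have "h m n \<le> K * (\<delta> + \<delta>)"
      using h[of m n] mult_left_mono[OF add_mono[of "vnorm T (\<lambda>i. X m i - X n i)" \<delta>
          "vnorm T (\<lambda>i. Y m i - Y n i)" \<delta>] K] N M that by fastforce
    also have "\<dots> < (K + 1) * (\<delta> + \<delta>)" using \<delta> by simp
    also have "\<dots> = 2 * (K + 1) * \<delta>" by (simp add: algebra_simps)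
    also have "\<dots> = e" using K by (simp add: \<delta>_def)
    finally show ?thesis .
  qed
  then show ?thesis by blast
qed

lemma cauchy_add:
  assumes X: "X \<in> cauchy_sequences T" and Y: "Y \<in> cauchy_sequences T"
  shows "(\<lambda>n i. X n i + Y n i) \<in> cauchy_sequences T"
  unfolding cauchy_iff
proof (intro conjI allI impI)
  fix e :: real assume "0 < e"
  show "\<exists>N. \<forall>m\<ge>N. \<forall>n\<ge>N. vnorm T (\<lambda>i. X m i + Y m i - (X n i + Y n i)) < e"
  proof (rule cauchy_transfer[OF X Y, of 1])
    fix m n
    show "vnorm T (\<lambda>i. X m i + Y m i - (X n i + Y n i))
      \<le> 1 * (vnorm T (\<lambda>i. X m i - X n i) + vnorm T (\<lambda>i. Y m i - Y n i))"
      using norm_add[OF fun_diff_closed[OF cauchy_in[OF X] cauchy_in[OF X]]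
          fun_diff_closed[OF cauchy_in[OF Y] cauchy_in[OF Y]], of m n m n]
      by (simp add: algebra_simps)
  qed (use \<open>0 < e\<close> in auto)
qed (simp add: cauchy_in[OF X] cauchy_in[OF Y] fun_add_closed)

lemma cauchy_scale:
  assumes X: "X \<in> cauchy_sequences T"
  shows "(\<lambda>n i. c * X n i) \<in> cauchy_sequences T"
  unfolding cauchy_iff
proof (intro conjI allI impI)
  fix e :: real assume "0 < e"
  show "\<exists>N. \<forall>m\<ge>N. \<forall>n\<ge>N. vnorm T (\<lambda>i. c * X m i - c * X n i) < e"
  proof (rule cauchy_transfer[OF X X, of "cmod c"])
    fix m n
    show "vnorm T (\<lambda>i. c * X m i - c * X n i)
      \<le> cmod c * (vnorm T (\<lambda>i. X m i - X n i) + vnorm T (\<lambda>i. X m i - X n i))"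
      using fun_norm_scale[OF fun_diff_closed[OF cauchy_in[OF X] cauchy_in[OF X]], of c m n]
        norm_nonneg[OF fun_diff_closed[OF cauchy_in[OF X] cauchy_in[OF X]], of m n]
      by (simp add: right_diff_distrib distrib_left)
  qed (use \<open>0 < e\<close> in auto)
qed (simp add: cauchy_in[OF X] fun_scale_closed)

lemma cauchy_mult:
  assumes X: "X \<in> cauchy_sequences T" and Y: "Y \<in> cauchy_sequences T"
  shows "(\<lambda>n. amult T (X n) (Y n)) \<in> cauchy_sequences T"
  unfolding cauchy_iff
proof (intro conjI allI impI)
  obtain K where K: "K > 0" "\<And>n. vnorm T (X n) \<le> K" using cauchy_bounded[OF X] by blast
  obtain L where L: "L > 0" "\<And>n. vnorm T (Y n) \<le> L" using cauchy_bounded[OF Y] by blast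
  fix e :: real assume "0 < e"
  show "\<exists>N. \<forall>m\<ge>N. \<forall>n\<ge>N. vnorm T (\<lambda>i. amult T (X m) (Y m) i - amult T (X n) (Y n) i) < e"
  proof (rule cauchy_transfer[OF X Y, of "max K L"])
    fix m n
    let ?x = "vnorm T (\<lambda>i. X m i - X n i)" and ?y = "vnorm T (\<lambda>i. Y m i - Y n i)"
    have nn: "0 \<le> ?x" "0 \<le> ?y" using norm_nonneg fun_diff_closed cauchy_in X Y by auto
    have "vnorm T (\<lambda>i. amult T (X m) (Y m) i - amult T (X n) (Y n) i)
        \<le> ?x * vnorm T (Y m) + vnorm T (X n) * ?y"
      by (intro mult_diff cauchy_in X Y)
    also have "\<dots> \<le> ?x * max K L + max K L * ?y"
      using nn K(2)[of n] L(2)[of m] by (intro add_mono mult_left_mono mult_right_mono) auto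
    finally show "vnorm T (\<lambda>i. amult T (X m) (Y m) i - amult T (X n) (Y n) i)
      \<le> max K L * (?x + ?y)" by (simp add: algebra_simps)
  qed (use \<open>0 < e\<close> K in auto)
qed (simp add: cauchy_in[OF X] cauchy_in[OF Y] mult_closed)

definition null_rel :: "((nat \<Rightarrow> 'i \<Rightarrow> complex) \<times> (nat \<Rightarrow> 'i \<Rightarrow> complex)) set" where
  "null_rel = {(X, Y). X \<in> cauchy_sequences T \<and> Y \<in> cauchy_sequences T \<and>
                (\<lambda>n. vnorm T (\<lambda>i. X n i - Y n i)) \<longlonglongrightarrow> 0}"

lemma null_relI:
  assumes "X \<in> cauchy_sequences T" "Y \<in> cauchy_sequences T"
    and "\<And>n. vnorm T (\<lambda>i. X n i - Y n i) \<le> g n" "g \<longlonglongrightarrow> 0"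
  shows "(X, Y) \<in> null_rel"
  unfolding null_rel_def using assms norm_nonneg fun_diff_closed cauchy_in
  by (auto intro!: tendsto_sandwich[OF _ _ tendsto_const assms(4)])

lemma banach_completion_eq: "banach_completion T = quotient_algebra (cauchy_algebra T) null_rel"
  by (simp add: banach_completion_def null_rel_def vdiff_eq)

lemma null_rel_equiv: "equiv (cauchy_sequences T) null_rel"
proof (rule equivI)
  show "null_rel \<subseteq> cauchy_sequences T \<times> cauchy_sequences T" by (auto simp: null_rel_def)
  show "refl_on (cauchy_sequences T) null_rel"
    using fun_norm_scale[of _ 0] cauchy_in by (fastforce simp: refl_on_def null_rel_def)
  show "sym null_rel"
  proof (rule symI)
    fix X Y assume *: "(X, Y) \<in> null_rel"
    then have "vnorm T (\<lambda>i. Y n i - X n i) = vnorm T (\<lambda>i. X n i - Y n i)" for n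
      by (intro norm_minus_commute) (auto simp: null_rel_def cauchy_in)
    then show "(Y, X) \<in> null_rel" using * by (simp add: null_rel_def)
  qed
  show "trans null_rel"
  proof (rule transI)
    fix X Y Z assume *: "(X, Y) \<in> null_rel" "(Y, Z) \<in> null_rel"
    show "(X, Z) \<in> null_rel"
      by (rule null_relI[where g = "\<lambda>n. vnorm T (\<lambda>i. X n i - Y n i) + vnorm T (\<lambda>i. Y n i - Z n i)"])
        (use * in \<open>auto simp: null_rel_def intro!: norm_diff_triangle cauchy_in tendsto_add_zero\<close>)
  qed
qed

lemma cauchy_algebra_congruence: "algebra_congruence (cauchy_algebra T) null_rel"
proof
  show "carrier (cauchy_algebra T) \<noteq> {}"
    using carrier_nonempty cauchy_const by (fastforce simp: cauchy_algebra_def)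
  show "equiv (carrier (cauchy_algebra T)) null_rel"
    using null_rel_equiv by (simp add: cauchy_algebra_def)
next
  fix X c assume X: "X \<in> carrier (cauchy_algebra T)"
  then have X': "X \<in> cauchy_sequences T" by (simp add: cauchy_algebra_def)
  show "0 \<le> vnorm (cauchy_algebra T) X"
    using X' norm_nonneg cauchy_in
    by (auto simp: cauchy_algebra_def intro!: LIMSEQ_le_const[OF cauchy_norm_tendsto])
  show "vscale (cauchy_algebra T) c X \<in> carrier (cauchy_algebra T)"
    using X' cauchy_scale by (simp add: cauchy_algebra_def scale_eq)
  show "vnorm (cauchy_algebra T) (vscale (cauchy_algebra T) c X) = cmod c * vnorm (cauchy_algebra T) X"
    using X' by (auto simp: cauchy_algebra_def scale_eq fun_norm_scale cauchy_in
        intro!: limI tendsto_mult_left cauchy_norm_tendsto)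
next
  fix X Y assume "X \<in> carrier (cauchy_algebra T)" "Y \<in> carrier (cauchy_algebra T)"
  then show "vadd (cauchy_algebra T) X Y \<in> carrier (cauchy_algebra T)"
    "amult (cauchy_algebra T) X Y \<in> carrier (cauchy_algebra T)"
    by (auto simp: cauchy_algebra_def add_eq cauchy_add cauchy_mult)
next
  fix X X' Y Y' assume XY: "(X, X') \<in> null_rel" "(Y, Y') \<in> null_rel"
  then have c: "X \<in> cauchy_sequences T" "X' \<in> cauchy_sequences T"
      "Y \<in> cauchy_sequences T" "Y' \<in> cauchy_sequences T"
    and l: "(\<lambda>n. vnorm T (\<lambda>i. X n i - X' n i)) \<longlonglongrightarrow> 0" "(\<lambda>n. vnorm T (\<lambda>i. Y n i - Y' n i)) \<longlonglongrightarrow> 0"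
    by (auto simp: null_rel_def)
  have "vnorm T (\<lambda>i. X n i + Y n i - (X' n i + Y' n i))
      \<le> vnorm T (\<lambda>i. X n i - X' n i) + vnorm T (\<lambda>i. Y n i - Y' n i)" for n
    using norm_add[OF fun_diff_closed[OF cauchy_in[OF c(1)] cauchy_in[OF c(2)]]
          fun_diff_closed[OF cauchy_in[OF c(3)] cauchy_in[OF c(4)]], of n n n n]
    by (simp add: algebra_simps)
  then show "(vadd (cauchy_algebra T) X Y, vadd (cauchy_algebra T) X' Y') \<in> null_rel"
    using c by (auto simp: cauchy_algebra_def add_eq
        intro!: null_relI[OF _ _ _ tendsto_add_zero[OF l]] cauchy_add)
  \<comment> \<open>In each summand one factor tends to \<open>0\<close> and the other is the norm
    of a Cauchy sequence, which converges.\<close>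
  have "(\<lambda>n. vnorm T (\<lambda>i. X n i - X' n i) * vnorm T (Y n) + vnorm T (X' n) * vnorm T (\<lambda>i. Y n i - Y' n i))
      \<longlonglongrightarrow> 0 * lim (\<lambda>n. vnorm T (Y n)) + lim (\<lambda>n. vnorm T (X' n)) * 0"
    by (intro tendsto_intros l cauchy_norm_tendsto c)
  then show "(amult (cauchy_algebra T) X Y, amult (cauchy_algebra T) X' Y') \<in> null_rel"
    using c by (auto simp: cauchy_algebra_def
        intro!: null_relI[OF _ _ mult_diff] cauchy_mult cauchy_in)
next
  fix X X' c assume XY: "(X, X') \<in> null_rel"
  then have c: "X \<in> cauchy_sequences T" "X' \<in> cauchy_sequences T"
    and l: "(\<lambda>n. vnorm T (\<lambda>i. X n i - X' n i)) \<longlonglongrightarrow> 0"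
    by (auto simp: null_rel_def)
  have "vnorm T (\<lambda>i. c * X n i - c * X' n i) = cmod c * vnorm T (\<lambda>i. X n i - X' n i)" for n
    using fun_norm_scale[OF fun_diff_closed[OF cauchy_in[OF c(1)] cauchy_in[OF c(2)]], of c n n]
    by (simp add: algebra_simps)
  then show "(vscale (cauchy_algebra T) c X, vscale (cauchy_algebra T) c X') \<in> null_rel"
    using c tendsto_mult_right_zero[OF l] by (auto simp: cauchy_algebra_def scale_eq null_rel_def cauchy_scale)
  have "(\<lambda>n. vnorm T (X n) - vnorm T (X' n)) \<longlonglongrightarrow> 0"
  proof (rule tendsto_rabs_zero_cancel, rule tendsto_sandwich[OF _ _ tendsto_const l])
    show "\<forall>\<^sub>F n in sequentially. \<bar>vnorm T (X n) - vnorm T (X' n)\<bar> \<le> vnorm T (\<lambda>i. X n i - X' n i)"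
      using norm_diff_ge cauchy_in c by simp
  qed simp
  then have "lim (\<lambda>n. vnorm T (X n)) - lim (\<lambda>n. vnorm T (X' n)) = 0"
    using tendsto_diff[OF cauchy_norm_tendsto[OF c(1)] cauchy_norm_tendsto[OF c(2)]] LIMSEQ_unique by blast
  then show "vnorm (cauchy_algebra T) X = vnorm (cauchy_algebra T) X'"
    by (simp add: cauchy_algebra_def)
qed

end

context function_algebra
begin

interpretation Cauchy: algebra_congruence "cauchy_algebra T" null_rel
  by (rule cauchy_algebra_congruence)

lemma const_mem: "u \<in> carrier T \<Longrightarrow> (\<lambda>n. u) \<in> carrier (cauchy_algebra T)"
  by (simp add: cauchy_algebra_def cauchy_const)

text \<open>Classes of constant sequences are dense: the class of \<open>X\<close> differs from that
  of the constant \<open>X N\<close> by the class of \<open>\<lambda>n. X n - X N\<close>, whose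
  norm is a limit of small numbers.\<close>

lemma completion_functional_zero:
  assumes \<phi>: "bounded_functional (banach_completion T) \<phi>"
    and zero: "\<And>u. u \<in> carrier T \<Longrightarrow> \<phi> (Cauchy.cls (\<lambda>n. u)) = 0"
    and F: "F \<in> carrier (banach_completion T)"
  shows "\<phi> F = 0"
proof -
  obtain C where C: "\<And>F. F \<in> carrier (banach_completion T) \<Longrightarrow>
      cmod (\<phi> F) \<le> C * vnorm (banach_completion T) F"
    using \<phi> unfolding bounded_functional_def by blast
  obtain X where X: "X \<in> cauchy_sequences T" "F = Cauchy.cls X"
    using F unfolding banach_completion_eq Cauchy.carrier_Q by (auto simp: cauchy_algebra_def)
  have "cmod (\<phi> F) \<le> e" if "0 < e" for e
  proof -
    \<comment> \<open>The constant \<open>C\<close> may be zero or negative;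
      \<open>\<bar>C\<bar> + 1\<close> is positive and still dominates it.\<close>
    have "0 < e / (\<bar>C\<bar> + 1)" using \<open>0 < e\<close> by simp
    then obtain N where N: "\<forall>m\<ge>N. \<forall>n\<ge>N. vnorm T (\<lambda>i. X m i - X n i) < e / (\<bar>C\<bar> + 1)"
      using cauchyD[OF X(1)] by blast
    define Z where "Z = (\<lambda>n i. X n i + (-1) * X N i)"
    have Z: "Z \<in> cauchy_sequences T"
      unfolding Z_def using X(1) by (intro cauchy_add cauchy_const fun_scale_closed cauchy_in)
    have cZ: "Z \<in> carrier (cauchy_algebra T)" using Z by (simp add: cauchy_algebra_def)
    have cN: "(\<lambda>n. X N) \<in> carrier (cauchy_algebra T)" using const_mem cauchy_in X by blast
    have "F = vadd (banach_completion T) (Cauchy.cls Z) (Cauchy.cls (\<lambda>n. X N))"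
      unfolding banach_completion_eq X Cauchy.add_Q[OF cZ cN] by (simp add: cauchy_algebra_def Z_def add_eq)
    then have "\<phi> F = \<phi> (Cauchy.cls Z)"
      using \<phi> zero[OF cauchy_in[OF X(1)]] Cauchy.cls_in_Q[OF cZ] Cauchy.cls_in_Q[OF cN]
      by (simp add: bounded_functional_def banach_completion_eq)
    moreover have "vnorm (banach_completion T) (Cauchy.cls Z) = lim (\<lambda>n. vnorm T (Z n))"
      unfolding banach_completion_eq Cauchy.norm_Q[OF cZ] by (simp add: cauchy_algebra_def)
    ultimately have *: "cmod (\<phi> F) \<le> C * lim (\<lambda>n. vnorm T (Z n))"
      using C[of "Cauchy.cls Z"] Cauchy.cls_in_Q[OF cZ] by (simp add: banach_completion_eq)
    have "lim (\<lambda>n. vnorm T (Z n)) \<le> e / (\<bar>C\<bar> + 1)"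
      using N by (intro LIMSEQ_le_const2[OF cauchy_norm_tendsto[OF Z]] exI[of _ N])
        (auto simp: Z_def intro: less_imp_le)
    moreover have "0 \<le> lim (\<lambda>n. vnorm T (Z n))"
      using norm_nonneg[OF cauchy_in[OF Z]] by (intro LIMSEQ_le_const[OF cauchy_norm_tendsto[OF Z]]) auto
    ultimately have "C * lim (\<lambda>n. vnorm T (Z n)) \<le> (\<bar>C\<bar> + 1) * (e / (\<bar>C\<bar> + 1))"
      by (intro mult_mono) auto
    also have "\<dots> = e" by simp
    finally show ?thesis using * by simp
  qed
  then show ?thesis using field_le_epsilon[of "cmod (\<phi> F)" 0] by simp
qed

context
  fixes d K
  assumes d: "derivation_form T d"
    and K: "0 \<le> K"
      "\<And>u v. u \<in> carrier T \<Longrightarrow> v \<in> carrier T \<Longrightarrow> cmod (d u v) \<le> K * vnorm T u * vnorm T v"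
begin

lemma d_diff:
  assumes "u \<in> carrier T" "v \<in> carrier T" "u' \<in> carrier T" "v' \<in> carrier T"
  shows "cmod (d u v - d u' v') \<le>
    K * vnorm T (\<lambda>i. u i - u' i) * vnorm T v + K * vnorm T u' * vnorm T (\<lambda>i. v i - v' i)"
proof -
  have bil: "bilinear_form T T d" using d by (simp add: derivation_form_def)
  have "d (\<lambda>i. u i + c * u' i) v = d u v + c * d u' v" for c
    using bil assms fun_scale_closed[of u' c] by (simp add: bilinear_form_def add_eq scale_eq)
  from this[of "-1"] have 1: "d (\<lambda>i. u i - u' i) v = d u v - d u' v" by simp
  have "d u' (\<lambda>i. v i + c * v' i) = d u' v + c * d u' v'" for c
    using bil assms fun_scale_closed[of v' c] by (simp add: bilinear_form_def add_eq scale_eq)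
  from this[of "-1"] have 2: "d u' (\<lambda>i. v i - v' i) = d u' v - d u' v'" by simp
  have "d u v - d u' v' = d (\<lambda>i. u i - u' i) v + d u' (\<lambda>i. v i - v' i)" by (simp add: 1 2)
  also have "cmod \<dots> \<le> cmod (d (\<lambda>i. u i - u' i) v) + cmod (d u' (\<lambda>i. v i - v' i))"
    by (rule norm_triangle_ineq)
  also have "\<dots> \<le> K * vnorm T (\<lambda>i. u i - u' i) * vnorm T v + K * vnorm T u' * vnorm T (\<lambda>i. v i - v' i)"
    using assms by (intro add_mono K fun_diff_closed)
  finally show ?thesis .
qed

lemma d_tendsto:
  assumes X: "X \<in> cauchy_sequences T" and Y: "Y \<in> cauchy_sequences T"
  shows "(\<lambda>n. d (X n) (Y n)) \<longlonglongrightarrow> lim (\<lambda>n. d (X n) (Y n))"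
proof -
  obtain L where L: "L > 0" "\<And>n. vnorm T (X n) \<le> L" using cauchy_bounded[OF X] by blast
  obtain M where M: "M > 0" "\<And>n. vnorm T (Y n) \<le> M" using cauchy_bounded[OF Y] by blast
  have "Cauchy (\<lambda>n. d (X n) (Y n))"
  proof (rule metric_CauchyI)
    fix e :: real assume "0 < e"
    show "\<exists>N. \<forall>m\<ge>N. \<forall>n\<ge>N. dist (d (X m) (Y m)) (d (X n) (Y n)) < e"
    proof (rule cauchy_transfer[OF X Y, of "K * max L M"])
      fix m n
      let ?x = "vnorm T (\<lambda>i. X m i - X n i)" and ?y = "vnorm T (\<lambda>i. Y m i - Y n i)"
      have nn: "0 \<le> ?x" "0 \<le> ?y" using norm_nonneg fun_diff_closed cauchy_in X Y by auto
      have "dist (d (X m) (Y m)) (d (X n) (Y n)) \<le> K * ?x * vnorm T (Y m) + K * vnorm T (X n) * ?y"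
        unfolding dist_norm by (intro d_diff cauchy_in X Y)
      also have "\<dots> \<le> K * ?x * max L M + K * max L M * ?y"
        using nn K L(2)[of n] M(2)[of m] by (intro add_mono mult_left_mono mult_right_mono) auto
      finally show "dist (d (X m) (Y m)) (d (X n) (Y n)) \<le> K * max L M * (?x + ?y)"
        by (simp add: algebra_simps)
    qed (use \<open>0 < e\<close> K L in auto)
  qed
  then show ?thesis by (simp add: Cauchy_convergent_iff convergent_LIMSEQ_iff)
qed

lemma d_lim_cong:
  assumes "(X, X') \<in> null_rel" "(Y, Y') \<in> null_rel"
  shows "lim (\<lambda>n. d (X n) (Y n)) = lim (\<lambda>n. d (X' n) (Y' n))"
proof -
  have c: "X \<in> cauchy_sequences T" "X' \<in> cauchy_sequences T"
      "Y \<in> cauchy_sequences T" "Y' \<in> cauchy_sequences T"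
    and l: "(\<lambda>n. vnorm T (\<lambda>i. X n i - X' n i)) \<longlonglongrightarrow> 0" "(\<lambda>n. vnorm T (\<lambda>i. Y n i - Y' n i)) \<longlonglongrightarrow> 0"
    using assms by (auto simp: null_rel_def)
  let ?g = "\<lambda>n. K * vnorm T (\<lambda>i. X n i - X' n i) * vnorm T (Y n) +
      K * vnorm T (X' n) * vnorm T (\<lambda>i. Y n i - Y' n i)"
  have g: "?g \<longlonglongrightarrow> K * 0 * lim (\<lambda>n. vnorm T (Y n)) + K * lim (\<lambda>n. vnorm T (X' n)) * 0"
    by (intro tendsto_intros l cauchy_norm_tendsto c)
  have "(\<lambda>n. d (X n) (Y n) - d (X' n) (Y' n)) \<longlonglongrightarrow> 0"
    by (rule Lim_null_comparison[of _ ?g]) (use g d_diff c cauchy_in in auto)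
  then have "lim (\<lambda>n. d (X n) (Y n)) - lim (\<lambda>n. d (X' n) (Y' n)) = 0"
    using tendsto_diff[OF d_tendsto[OF c(1,3)] d_tendsto[OF c(2,4)]] LIMSEQ_unique by blast
  then show ?thesis by simp
qed

text \<open>Extension by continuity. The representatives are chosen arbitrarily;
  \<open>d_lim_cong\<close> shows that the limit does not depend on the choice.\<close>

definition completed_form where
  "completed_form F G = lim (\<lambda>n. d ((SOME X. X \<in> F) n) ((SOME Y. Y \<in> G) n))"

lemma completed_form_cls:
  assumes "X \<in> carrier (cauchy_algebra T)" "Y \<in> carrier (cauchy_algebra T)"
  shows "completed_form (Cauchy.cls X) (Cauchy.cls Y) = lim (\<lambda>n. d (X n) (Y n))"
proof -
  have "(SOME Z. Z \<in> Cauchy.cls X) \<in> Cauchy.cls X" "(SOME Z. Z \<in> Cauchy.cls Y) \<in> Cauchy.cls Y"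
    by (fact someI[of "\<lambda>Z. Z \<in> Cauchy.cls _", OF Cauchy.cls_self, OF assms(1)]
        someI[of "\<lambda>Z. Z \<in> Cauchy.cls _", OF Cauchy.cls_self, OF assms(2)])+
  then show ?thesis
    unfolding completed_form_def by (intro d_lim_cong[symmetric]) auto
qed

text \<open>Every clause is the corresponding clause for \<open>d\<close>, read termwise along
  Cauchy sequences and carried to the limit by \<open>d_tendsto\<close>.\<close>

lemma derivation_form_completed: "derivation_form (banach_completion T) completed_form"
  unfolding derivation_form_def bilinear_form_def banach_completion_eq Cauchy.carrier_Q
proof (intro conjI allI ballI; (elim imageE; hypsubst)?)
  fix X X' Y
  assume "X \<in> carrier (cauchy_algebra T)" "X' \<in> carrier (cauchy_algebra T)"
    "Y \<in> carrier (cauchy_algebra T)"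
  note c = this
  then have c': "X \<in> cauchy_sequences T" "X' \<in> cauchy_sequences T" "Y \<in> cauchy_sequences T"
    by (auto simp: cauchy_algebra_def)
  have "lim (\<lambda>n. d (\<lambda>i. X n i + X' n i) (Y n)) = lim (\<lambda>n. d (X n) (Y n)) + lim (\<lambda>n. d (X' n) (Y n))"
    using d c' cauchy_in
    by (auto simp: derivation_form_def bilinear_form_def add_eq intro!: limI tendsto_add d_tendsto)
  then show "completed_form (vadd Cauchy.Q (Cauchy.cls X) (Cauchy.cls X')) (Cauchy.cls Y) =
      completed_form (Cauchy.cls X) (Cauchy.cls Y) + completed_form (Cauchy.cls X') (Cauchy.cls Y)"
    using c Cauchy.add_closed[OF c(1,2)]
    by (simp add: Cauchy.add_Q completed_form_cls) (simp add: cauchy_algebra_def add_eq)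
  have "lim (\<lambda>n. d (Y n) (\<lambda>i. X n i + X' n i)) = lim (\<lambda>n. d (Y n) (X n)) + lim (\<lambda>n. d (Y n) (X' n))"
    using d c' cauchy_in
    by (auto simp: derivation_form_def bilinear_form_def add_eq intro!: limI tendsto_add d_tendsto)
  then show "completed_form (Cauchy.cls Y) (vadd Cauchy.Q (Cauchy.cls X) (Cauchy.cls X')) =
      completed_form (Cauchy.cls Y) (Cauchy.cls X) + completed_form (Cauchy.cls Y) (Cauchy.cls X')"
    using c Cauchy.add_closed[OF c(1,2)]
    by (simp add: Cauchy.add_Q completed_form_cls) (simp add: cauchy_algebra_def add_eq)
  have "(\<lambda>n. d (X' n) (amult T (Y n) (X n)) + d (X n) (amult T (X' n) (Y n)))
      \<longlonglongrightarrow> lim (\<lambda>n. d (X' n) (amult T (Y n) (X n))) + lim (\<lambda>n. d (X n) (amult T (X' n) (Y n)))"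
    by (intro tendsto_add d_tendsto cauchy_mult c')
  then have "lim (\<lambda>n. d (amult T (X n) (X' n)) (Y n)) =
      lim (\<lambda>n. d (X' n) (amult T (Y n) (X n))) + lim (\<lambda>n. d (X n) (amult T (X' n) (Y n)))"
    using d c' cauchy_in by (auto simp: derivation_form_def intro!: limI)
  then show "completed_form (amult Cauchy.Q (Cauchy.cls X) (Cauchy.cls X')) (Cauchy.cls Y) =
      completed_form (Cauchy.cls X') (amult Cauchy.Q (Cauchy.cls Y) (Cauchy.cls X)) +
      completed_form (Cauchy.cls X) (amult Cauchy.Q (Cauchy.cls X') (Cauchy.cls Y))"
    using c Cauchy.mult_closed
    by (simp add: Cauchy.mult_Q completed_form_cls) (simp add: cauchy_algebra_def)
next
  fix z X Y
  assume "X \<in> carrier (cauchy_algebra T)" "Y \<in> carrier (cauchy_algebra T)"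
  note c = this
  then have c': "X \<in> cauchy_sequences T" "Y \<in> cauchy_sequences T"
    by (auto simp: cauchy_algebra_def)
  have "lim (\<lambda>n. d (\<lambda>i. z * X n i) (Y n)) = z * lim (\<lambda>n. d (X n) (Y n))"
      "lim (\<lambda>n. d (X n) (\<lambda>i. z * Y n i)) = z * lim (\<lambda>n. d (X n) (Y n))"
    using d c' cauchy_in
    by (auto simp: derivation_form_def bilinear_form_def scale_eq intro!: limI tendsto_mult_left d_tendsto)
  then show "completed_form (vscale Cauchy.Q z (Cauchy.cls X)) (Cauchy.cls Y) =
      z * completed_form (Cauchy.cls X) (Cauchy.cls Y)"
    "completed_form (Cauchy.cls X) (vscale Cauchy.Q z (Cauchy.cls Y)) =
      z * completed_form (Cauchy.cls X) (Cauchy.cls Y)"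
    using c Cauchy.scale_closed
    by (simp_all add: Cauchy.scale_Q completed_form_cls) (simp_all add: cauchy_algebra_def scale_eq)
next
  have "cmod (completed_form F G) \<le> K * vnorm Cauchy.Q F * vnorm Cauchy.Q G"
    if "F \<in> Cauchy.cls ` carrier (cauchy_algebra T)" "G \<in> Cauchy.cls ` carrier (cauchy_algebra T)" for F G
  proof -
    obtain X Y where XY: "X \<in> carrier (cauchy_algebra T)" "Y \<in> carrier (cauchy_algebra T)"
      and FG: "F = Cauchy.cls X" "G = Cauchy.cls Y" using \<open>F \<in> _\<close> \<open>G \<in> _\<close> by blast
    then have c': "X \<in> cauchy_sequences T" "Y \<in> cauchy_sequences T"
      by (auto simp: cauchy_algebra_def)
    have "cmod (lim (\<lambda>n. d (X n) (Y n))) \<le> K * lim (\<lambda>n. vnorm T (X n)) * lim (\<lambda>n. vnorm T (Y n))"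
    proof (rule LIMSEQ_le)
      show "(\<lambda>n. cmod (d (X n) (Y n))) \<longlonglongrightarrow> cmod (lim (\<lambda>n. d (X n) (Y n)))"
        by (intro tendsto_norm d_tendsto c')
      show "(\<lambda>n. K * vnorm T (X n) * vnorm T (Y n)) \<longlonglongrightarrow> K * lim (\<lambda>n. vnorm T (X n)) * lim (\<lambda>n. vnorm T (Y n))"
        by (intro tendsto_intros cauchy_norm_tendsto c')
    qed (use K c' cauchy_in in auto)
    then show ?thesis
      unfolding FG completed_form_cls[OF XY] XY[THEN Cauchy.norm_Q] by (simp add: cauchy_algebra_def)
  qed
  then show "\<exists>C. \<forall>F\<in>Cauchy.cls ` carrier (cauchy_algebra T). \<forall>G\<in>Cauchy.cls ` carrier (cauchy_algebra T).
      cmod (completed_form F G) \<le> C * vnorm Cauchy.Q F * vnorm Cauchy.Q G" by blast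
qed

end

text \<open>Forms extend from \<open>T\<close> to the completion by limits and restrict back along
  constant sequences. Hence only forms on the uncompleted algebra have to be examined from here
  on.\<close>

theorem weakly_amenable_completion:
  "weakly_amenable (banach_completion T) \<longleftrightarrow>
     (\<forall>d. derivation_form T d \<longrightarrow> (\<forall>u\<in>carrier T. \<forall>v\<in>carrier T. d u v = 0))"
proof -
  interpret C: algebra_base "banach_completion T"
    unfolding banach_completion_eq by (rule Cauchy.algebra_base_Q)
  show ?thesis
    unfolding C.weakly_amenable_iff
  proof (intro iffI allI impI ballI)
    fix d u v
    assume wa: "\<forall>d. derivation_form (banach_completion T) d \<longrightarrow>
        (\<forall>a\<in>carrier (banach_completion T). \<forall>x\<in>carrier (banach_completion T). d a x = 0)"
      and d: "derivation_form T d" and uv: "u \<in> carrier T" "v \<in> carrier T"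
    obtain K0 where K0: "\<And>u v. u \<in> carrier T \<Longrightarrow> v \<in> carrier T \<Longrightarrow>
        cmod (d u v) \<le> K0 * vnorm T u * vnorm T v"
      using d unfolding derivation_form_def by blast
    have K: "cmod (d u v) \<le> max K0 0 * vnorm T u * vnorm T v" if "u \<in> carrier T" "v \<in> carrier T" for u v
      using K0[OF that] mult_right_mono[of K0 "max K0 0" "vnorm T u * vnorm T v"] norm_nonneg that
      by (simp add: mult.assoc)
    have "completed_form d (Cauchy.cls (\<lambda>n. u)) (Cauchy.cls (\<lambda>n. v)) = 0"
      using wa derivation_form_completed[OF d _ K] Cauchy.cls_in_Q const_mem uv
      unfolding banach_completion_eq by simp
    then show "d u v = 0"
      using completed_form_cls[OF d _ K const_mem[OF uv(1)] const_mem[OF uv(2)]] by simp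
  next
    fix D F G
    assume *: "\<forall>d. derivation_form T d \<longrightarrow> (\<forall>u\<in>carrier T. \<forall>v\<in>carrier T. d u v = 0)"
      and D: "derivation_form (banach_completion T) D"
      and FG: "F \<in> carrier (banach_completion T)" "G \<in> carrier (banach_completion T)"
    let ?c = "\<lambda>u. Cauchy.cls (\<lambda>n. u)"
    have mem: "?c u \<in> carrier (banach_completion T)" if "u \<in> carrier T" for u
      using that by (simp add: banach_completion_eq Cauchy.cls_in_Q const_mem)
    have c1: "?c (vadd T u v) = vadd (banach_completion T) (?c u) (?c v)"
      "?c (amult T u v) = amult (banach_completion T) (?c u) (?c v)"
      if "u \<in> carrier T" "v \<in> carrier T" for u v
      unfolding banach_completion_eq Cauchy.add_Q[OF const_mem[OF that(1)] const_mem[OF that(2)]]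
        Cauchy.mult_Q[OF const_mem[OF that(1)] const_mem[OF that(2)]]
      by (simp_all add: cauchy_algebra_def)
    have c2: "?c (vscale T z u) = vscale (banach_completion T) z (?c u)"
      "vnorm (banach_completion T) (?c u) = vnorm T u" if "u \<in> carrier T" for u z
      unfolding banach_completion_eq Cauchy.scale_Q[OF const_mem[OF that]]
        Cauchy.norm_Q[OF const_mem[OF that]]
      by (simp_all add: cauchy_algebra_def)
    obtain K where "\<And>F G. F \<in> carrier (banach_completion T) \<Longrightarrow> G \<in> carrier (banach_completion T) \<Longrightarrow>
        cmod (D F G) \<le> K * vnorm (banach_completion T) F * vnorm (banach_completion T) G"
      using D unfolding derivation_form_def by blast
    then have "\<exists>K. \<forall>u\<in>carrier T. \<forall>v\<in>carrier T. cmod (D (?c u) (?c v)) \<le> K * vnorm T u * vnorm T v"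
      using mem c2(2) by (intro exI[of _ K]) fastforce
    then have "derivation_form T (\<lambda>u v. D (?c u) (?c v))"
      using D mem mult_closed c1 c2 unfolding derivation_form_def bilinear_form_def by simp
    then have "D (?c u) (?c v) = 0" if "u \<in> carrier T" "v \<in> carrier T" for u v
      using * that by blast
    \<comment> \<open>Density is used in one argument at a time, because
      \<open>completion_functional_zero\<close> concerns functionals of a single variable.\<close>
    then have "D F (?c v) = 0" if "v \<in> carrier T" for v
      using completion_functional_zero[OF C.derivation_form_functional(2)[OF D mem[OF that]]] FG that by blast
    then show "D F G = 0"
      using completion_functional_zero[OF C.derivation_form_functional(1)[OF D FG(1)]] FG by blast
  qed
qed

end

section \<open>Commutative seminormed algebras and their tensor products\<close>

locale comm_algebra = algebra_base A for A :: "'a nalgebra" +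
  assumes mult_assoc: "a \<in> carrier A \<Longrightarrow> b \<in> carrier A \<Longrightarrow> c \<in> carrier A \<Longrightarrow>
        amult A (amult A a b) c = amult A a (amult A b c)"
    and mult_comm: "a \<in> carrier A \<Longrightarrow> b \<in> carrier A \<Longrightarrow> amult A a b = amult A b a"
    and mult_add: "a \<in> carrier A \<Longrightarrow> b \<in> carrier A \<Longrightarrow> c \<in> carrier A \<Longrightarrow>
        amult A a (vadd A b c) = vadd A (amult A a b) (amult A a c)"
    and mult_scale: "a \<in> carrier A \<Longrightarrow> b \<in> carrier A \<Longrightarrow>
        amult A a (vscale A z b) = vscale A z (amult A a b)"
    and norm_submult: "a \<in> carrier A \<Longrightarrow> b \<in> carrier A \<Longrightarrow>
        vnorm A (amult A a b) \<le> vnorm A a * vnorm A b"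
begin

lemma add_mult: "a \<in> carrier A \<Longrightarrow> b \<in> carrier A \<Longrightarrow> c \<in> carrier A \<Longrightarrow>
    amult A (vadd A b c) a = vadd A (amult A b a) (amult A c a)"
  by (metis mult_add mult_comm add_closed)

lemma scale_mult: "a \<in> carrier A \<Longrightarrow> b \<in> carrier A \<Longrightarrow>
    amult A (vscale A z b) a = vscale A z (amult A b a)"
  by (metis mult_scale mult_comm scale_closed)

lemma mult_left_comm: "a \<in> carrier A \<Longrightarrow> b \<in> carrier A \<Longrightarrow> c \<in> carrier A \<Longrightarrow>
    amult A b (amult A a c) = amult A a (amult A b c)"
  by (metis mult_assoc mult_comm)

lemma functional_diff:
  assumes "bounded_functional A \<phi>" "bounded_functional A \<psi>"
  shows "bounded_functional A (\<lambda>x. \<phi> x - \<psi> x)"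
proof -
  obtain C where C: "\<And>x. x \<in> carrier A \<Longrightarrow> cmod (\<phi> x) \<le> C * vnorm A x"
    using assms unfolding bounded_functional_def by blast
  obtain C' where C': "\<And>x. x \<in> carrier A \<Longrightarrow> cmod (\<psi> x) \<le> C' * vnorm A x"
    using assms unfolding bounded_functional_def by blast
  have "cmod (\<phi> x - \<psi> x) \<le> (C + C') * vnorm A x" if "x \<in> carrier A" for x
    using C[OF that] C'[OF that] norm_triangle_ineq4[of "\<phi> x" "\<psi> x"] by (simp add: distrib_right)
  then have "\<exists>C. \<forall>x\<in>carrier A. cmod (\<phi> x - \<psi> x) \<le> C * vnorm A x" by blast
  then show ?thesis
    using assms unfolding bounded_functional_def by (simp add: algebra_simps)
qed

lemma functional_mult:
  assumes "bounded_functional A \<phi>" "a \<in> carrier A"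
  shows "bounded_functional A (\<lambda>x. \<phi> (amult A a x))"
proof -
  obtain C where C: "\<And>x. x \<in> carrier A \<Longrightarrow> cmod (\<phi> x) \<le> C * vnorm A x"
    using assms unfolding bounded_functional_def by blast
  have "cmod (\<phi> (amult A a x)) \<le> (\<bar>C\<bar> * vnorm A a) * vnorm A x" if x: "x \<in> carrier A" for x
  proof -
    have "cmod (\<phi> (amult A a x)) \<le> C * vnorm A (amult A a x)" using C mult_closed assms x by blast
    also have "\<dots> \<le> \<bar>C\<bar> * (vnorm A a * vnorm A x)"
      using x assms by (intro mult_mono norm_submult norm_nonneg mult_closed) auto
    finally show ?thesis by (simp add: mult.assoc)
  qed
  then have "\<exists>C. \<forall>x\<in>carrier A. cmod (\<phi> (amult A a x)) \<le> C * vnorm A x" by blast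
  then show ?thesis
    using assms mult_closed unfolding bounded_functional_def by (simp add: mult_add mult_scale)
qed

text \<open>Otherwise \<open>a \<mapsto> \<phi>(a) \<phi>\<close> would be a nonzero derivation.\<close>

lemma weakly_amenable_functional_zero:
  assumes wa: "weakly_amenable A" and \<phi>: "bounded_functional A \<phi>"
    and zero: "\<And>a b. a \<in> carrier A \<Longrightarrow> b \<in> carrier A \<Longrightarrow> \<phi> (amult A a b) = 0"
    and x: "x \<in> carrier A"
  shows "\<phi> x = 0"
proof -
  obtain C where C: "\<And>x. x \<in> carrier A \<Longrightarrow> cmod (\<phi> x) \<le> C * vnorm A x"
    using \<phi> unfolding bounded_functional_def by blast
  have "cmod (\<phi> a * \<phi> b) \<le> (C * C) * vnorm A a * vnorm A b" if "a \<in> carrier A" "b \<in> carrier A" for a b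
  proof -
    have "cmod (\<phi> a * \<phi> b) \<le> (C * vnorm A a) * (C * vnorm A b)"
      unfolding norm_mult using order_trans[OF norm_ge_zero C[OF that(1)]]
      by (intro mult_mono C that norm_ge_zero)
    then show ?thesis by (simp add: mult_ac)
  qed
  then have "\<exists>C. \<forall>a\<in>carrier A. \<forall>b\<in>carrier A. cmod (\<phi> a * \<phi> b) \<le> C * vnorm A a * vnorm A b"
    by blast
  \<comment> \<open>Each term of the Leibniz rule contains the value of \<open>\<phi>\<close> at a
    product, so the rule reads \<open>0 = 0 + 0\<close>.\<close>
  then have "derivation_form A (\<lambda>a b. \<phi> a * \<phi> b)"
    using \<phi> zero unfolding derivation_form_def bilinear_form_def bounded_functional_def
    by (auto simp: algebra_simps)
  then have "\<phi> x * \<phi> x = 0" using wa x unfolding weakly_amenable_iff by blast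
  then show ?thesis by simp
qed

end

text \<open>A derivation of \<open>A \<otimes> B\<close> seen through elementary tensors:
  \<open>q a b x y\<close> stands for \<open>D(a \<otimes> b)(x \<otimes> y)\<close>.\<close>

definition derivation_quad :: "'a nalgebra \<Rightarrow> 'b nalgebra \<Rightarrow> ('a \<Rightarrow> 'b \<Rightarrow> 'a \<Rightarrow> 'b \<Rightarrow> complex) \<Rightarrow> bool" where
  "derivation_quad A B q \<longleftrightarrow>
     (\<forall>b\<in>carrier B. \<forall>x\<in>carrier A. \<forall>y\<in>carrier B. bounded_functional A (\<lambda>a. q a b x y)) \<and>
     (\<forall>a\<in>carrier A. \<forall>x\<in>carrier A. \<forall>y\<in>carrier B. bounded_functional B (\<lambda>b. q a b x y)) \<and>
     (\<forall>a\<in>carrier A. \<forall>b\<in>carrier B. \<forall>y\<in>carrier B. bounded_functional A (\<lambda>x. q a b x y)) \<and>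
     (\<forall>a\<in>carrier A. \<forall>b\<in>carrier B. \<forall>x\<in>carrier A. bounded_functional B (q a b x)) \<and>
     (\<exists>K\<ge>0. \<forall>a\<in>carrier A. \<forall>b\<in>carrier B. \<forall>x\<in>carrier A. \<forall>y\<in>carrier B.
        cmod (q a b x y) \<le> K * vnorm A a * vnorm B b * vnorm A x * vnorm B y) \<and>
     (\<forall>a\<in>carrier A. \<forall>a'\<in>carrier A. \<forall>b\<in>carrier B. \<forall>b'\<in>carrier B. \<forall>x\<in>carrier A. \<forall>y\<in>carrier B.
        q (amult A a a') (amult B b b') x y =
          q a' b' (amult A a x) (amult B b y) + q a b (amult A a' x) (amult B b' y))"

lemma derivation_quadD:
  assumes "derivation_quad A B q"
    and "a \<in> carrier A" "b \<in> carrier B" "x \<in> carrier A" "y \<in> carrier B"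
  shows "bounded_functional A (\<lambda>a. q a b x y)" "bounded_functional B (\<lambda>b. q a b x y)"
    "bounded_functional A (\<lambda>x. q a b x y)" "bounded_functional B (q a b x)"
    "a' \<in> carrier A \<Longrightarrow> b' \<in> carrier B \<Longrightarrow> q (amult A a a') (amult B b b') x y =
          q a' b' (amult A a x) (amult B b y) + q a b (amult A a' x) (amult B b' y)"
  using assms by (simp_all add: derivation_quad_def)

lemma derivation_quad_bound:
  assumes "derivation_quad A B q"
  obtains K where "K \<ge> 0" "\<And>a b x y. a \<in> carrier A \<Longrightarrow> b \<in> carrier B \<Longrightarrow> x \<in> carrier A \<Longrightarrow>
      y \<in> carrier B \<Longrightarrow> cmod (q a b x y) \<le> K * vnorm A a * vnorm B b * vnorm A x * vnorm B y"
proof -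
  obtain K where "K \<ge> 0" "\<forall>a\<in>carrier A. \<forall>b\<in>carrier B. \<forall>x\<in>carrier A. \<forall>y\<in>carrier B.
        cmod (q a b x y) \<le> K * vnorm A a * vnorm B b * vnorm A x * vnorm B y"
    using assms by (auto simp: derivation_quad_def)
  then show ?thesis by (intro that[of K]) auto
qed

text \<open>Allows statements about multipliers from the first factor to be reused for the
  second.\<close>

lemma derivation_quad_swap:
  assumes "derivation_quad A B q"
  shows "derivation_quad B A (\<lambda>b a y x. q a b x y)"
proof -
  obtain K where "K \<ge> 0" and K: "\<And>a b x y. a \<in> carrier A \<Longrightarrow> b \<in> carrier B \<Longrightarrow> x \<in> carrier A \<Longrightarrow>
      y \<in> carrier B \<Longrightarrow> cmod (q a b x y) \<le> K * vnorm A a * vnorm B b * vnorm A x * vnorm B y"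
    using derivation_quad_bound[OF assms] by blast
  have "cmod (q a b x y) \<le> K * vnorm B b * vnorm A a * vnorm B y * vnorm A x"
    if "a \<in> carrier A" "b \<in> carrier B" "x \<in> carrier A" "y \<in> carrier B" for a b x y
    using K[OF that] by (simp add: mult_ac)
  then have "\<exists>K\<ge>0. \<forall>b\<in>carrier B. \<forall>a\<in>carrier A. \<forall>y\<in>carrier B. \<forall>x\<in>carrier A.
        cmod (q a b x y) \<le> K * vnorm B b * vnorm A a * vnorm B y * vnorm A x"
    using \<open>K \<ge> 0\<close> by blast
  then show ?thesis
    using assms by (simp add: derivation_quad_def add_ac)
qed

locale comm_algebra_pair = A: comm_algebra A + B: comm_algebra B
  for A :: "'a nalgebra" and B :: "'b nalgebra"
begin

text \<open>With \<open>q a b x y\<close> read as D(a \<otimes> b)(x \<otimes> y), D commutes with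
  multiplication by a \<otimes> 1. The defect \<open>t a\<close> is first seen to be linear over
  elements of the tensor product (\<open>t_mult\<close>) and then over elements of \<open>A\<close>
  alone (\<open>t_comm\<close>). The second property turns the cocycle identity of \<open>t\<close>
  in \<open>a\<close> into a Leibniz rule.\<close>

lemma derivation_quad_module:
  assumes q: "derivation_quad A B q"
    and waA: "weakly_amenable A" and waB: "weakly_amenable B"
    and acx: "a \<in> carrier A" "c \<in> carrier A" "x \<in> carrier A" and bby: "b \<in> carrier B" "y \<in> carrier B"
  shows "q (amult A a c) b x y = q c b (amult A a x) y"
proof -
  note closed = A.mult_closed B.mult_closed
  note Aac = A.mult_assoc A.mult_comm A.mult_left_comm
  note Bac = B.mult_assoc B.mult_comm B.mult_left_comm
  have q1: "bounded_functional A (\<lambda>a. q a b x y)"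
    if "b \<in> carrier B" "x \<in> carrier A" "y \<in> carrier B" for b x y
    using q that by (simp add: derivation_quad_def)
  have q2: "bounded_functional B (\<lambda>b. q a b x y)"
    if "a \<in> carrier A" "x \<in> carrier A" "y \<in> carrier B" for a x y
    using q that by (simp add: derivation_quad_def)
  have q3: "bounded_functional A (\<lambda>x. q a b x y)"
    if "a \<in> carrier A" "b \<in> carrier B" "y \<in> carrier B" for a b y
    using q that by (simp add: derivation_quad_def)
  obtain K where "K \<ge> 0" and K: "\<And>a b x y. a \<in> carrier A \<Longrightarrow> b \<in> carrier B \<Longrightarrow> x \<in> carrier A \<Longrightarrow>
      y \<in> carrier B \<Longrightarrow> cmod (q a b x y) \<le> K * vnorm A a * vnorm B b * vnorm A x * vnorm B y"
    using derivation_quad_bound[OF q] by blast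
  have der: "q (amult A a a') (amult B b b') x y =
          q a' b' (amult A a x) (amult B b y) + q a b (amult A a' x) (amult B b' y)"
    if "a \<in> carrier A" "a' \<in> carrier A" "b \<in> carrier B" "b' \<in> carrier B" "x \<in> carrier A" "y \<in> carrier B"
    for a a' b b' x y
    using q that by (simp add: derivation_quad_def)
  define t where "t a c b x y = q (amult A a c) b x y - q c b (amult A a x) y" for a c b x y
  have t_mult: "t a (amult A c c') (amult B b b') x y = t a c' b' (amult A c x) (amult B b y)"
    if "a \<in> carrier A" "c \<in> carrier A" "c' \<in> carrier A" "b \<in> carrier B" "b' \<in> carrier B"
      "x \<in> carrier A" "y \<in> carrier B" for a c c' b b' x y
  proof -
    have 1: "amult A a (amult A c c') = amult A (amult A a c') c" using that by (simp add: Aac closed)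
    have 2: "amult B b b' = amult B b' b" using that by (simp add: B.mult_comm)
    have 3: "amult A c c' = amult A c' c" using that by (simp add: A.mult_comm)
    have "t a (amult A c c') (amult B b b') x y =
        q (amult A (amult A a c') c) (amult B b' b) x y - q (amult A c' c) (amult B b' b) (amult A a x) y"
      by (simp only: t_def 1 2[symmetric] 3[symmetric])
    \<comment> \<open>Both Leibniz expansions contain the value of \<open>q c b\<close> at a c' x
      and b' y, and these two terms cancel.\<close>
    also have "\<dots> = q (amult A a c') b' (amult A c x) (amult B b y) - q c' b' (amult A c (amult A a x)) (amult B b y)"
      using that der[of "amult A a c'" c b' b x y] der[of c' c b' b "amult A a x" y]
      by (simp add: closed A.mult_assoc A.mult_left_comm[of a c' x])
    finally show ?thesis using that by (simp add: t_def A.mult_left_comm)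
  qed
  have t_comm: "t a (amult A a' c) b x y = t a c b (amult A a' x) y"
    if "a \<in> carrier A" "a' \<in> carrier A" "c \<in> carrier A" "b \<in> carrier B" "x \<in> carrier A" "y \<in> carrier B"
    for a a' c b x y
  proof -
    \<comment> \<open>For c = c1 c2 and b = b1 b2 the tensor a' c1 \<otimes> b1 is a genuine
      element, so \<open>t_mult\<close> moves it across. Moving c1 \<otimes> b1 back leaves a'
      behind on the other side. Vanishing on such products is then enough, first in \<open>b\<close>
      and afterwards in \<open>c\<close>.\<close>
    have b0: "t a (amult A a' (amult A c1 c2)) b x y - t a (amult A c1 c2) b (amult A a' x) y = 0"
      if c: "c1 \<in> carrier A" "c2 \<in> carrier A" for c1 c2
    proof (rule B.weakly_amenable_functional_zero[OF waB _ _ \<open>b \<in> carrier B\<close>])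
      show "bounded_functional B (\<lambda>b. t a (amult A a' (amult A c1 c2)) b x y - t a (amult A c1 c2) b (amult A a' x) y)"
        unfolding t_def using c that \<open>a \<in> carrier A\<close> \<open>a' \<in> carrier A\<close> \<open>x \<in> carrier A\<close> \<open>y \<in> carrier B\<close>
        by (intro B.functional_diff q2 closed)
      fix b1 b2 assume b: "b1 \<in> carrier B" "b2 \<in> carrier B"
      have "amult A a' (amult A c1 c2) = amult A (amult A a' c1) c2"
        using c \<open>a' \<in> carrier A\<close> by (simp add: A.mult_assoc)
      then have "t a (amult A a' (amult A c1 c2)) (amult B b1 b2) x y =
          t a c2 b2 (amult A (amult A a' c1) x) (amult B b1 y)"
        using c b \<open>a \<in> carrier A\<close> \<open>a' \<in> carrier A\<close> \<open>x \<in> carrier A\<close> \<open>y \<in> carrier B\<close>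
        by (simp add: t_mult closed)
      also have "amult A (amult A a' c1) x = amult A c1 (amult A a' x)"
        using c \<open>a' \<in> carrier A\<close> \<open>x \<in> carrier A\<close> by (simp add: Aac closed)
      also have "t a c2 b2 \<dots> (amult B b1 y) = t a (amult A c1 c2) (amult B b1 b2) (amult A a' x) y"
        using c b \<open>a \<in> carrier A\<close> \<open>a' \<in> carrier A\<close> \<open>x \<in> carrier A\<close> \<open>y \<in> carrier B\<close>
        by (simp add: t_mult closed)
      finally show "t a (amult A a' (amult A c1 c2)) (amult B b1 b2) x y -
          t a (amult A c1 c2) (amult B b1 b2) (amult A a' x) y = 0" by simp
    qed
    have "t a (amult A a' c) b x y - t a c b (amult A a' x) y = 0"
    proof (rule A.weakly_amenable_functional_zero[OF waA _ _ that(3),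
          where \<phi> = "\<lambda>c. t a (amult A a' c) b x y - t a c b (amult A a' x) y"])
      have f: "bounded_functional A (\<lambda>c. t a c b x y)" if "x \<in> carrier A" for x
        unfolding t_def using \<open>a \<in> carrier A\<close> \<open>b \<in> carrier B\<close> \<open>y \<in> carrier B\<close> that
        by (intro A.functional_diff q1 A.functional_mult[of "\<lambda>c. q c b x y"] closed)
      show "bounded_functional A (\<lambda>c. t a (amult A a' c) b x y - t a c b (amult A a' x) y)"
        using that by (intro A.functional_diff A.functional_mult[of "\<lambda>c. t a c b x y"] f closed)
    qed (rule b0)
    then show ?thesis by simp
  qed
  \<comment> \<open>It suffices to let the variable run through products \<open>amult A x e\<close>.
    For fixed \<open>e\<close> the value is a derivation form in \<open>a\<close> and
    \<open>x\<close>, which weak amenability of \<open>A\<close> annihilates.\<close>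
  have "t a c b x y = 0"
  proof (rule A.weakly_amenable_functional_zero[OF waA _ _ acx(3)])
    show "bounded_functional A (\<lambda>x. t a c b x y)"
      unfolding t_def using acx bby
      by (intro A.functional_diff q3 A.functional_mult[of "\<lambda>x. q c b x y"] closed)
    fix x e assume xe: "x \<in> carrier A" "e \<in> carrier A"
    have lin: "bounded_functional A (\<lambda>a. t a c b (amult A x e) y)"
      "bounded_functional A (\<lambda>x. t a c b (amult A x e) y)"
      if "a \<in> carrier A" "x \<in> carrier A" for a x
    proof -
      have "bounded_functional A (\<lambda>a. q (amult A c a) b (amult A x e) y - q c b (amult A (amult A x e) a) y)"
        using that xe acx bby
        by (intro A.functional_diff A.functional_mult[of "\<lambda>c. q c b (amult A x e) y"]
            A.functional_mult[of "\<lambda>x. q c b x y"] q1 q3 closed)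
      moreover have "q (amult A c a) b (amult A x e) y - q c b (amult A (amult A x e) a) y = t a c b (amult A x e) y"
        if "a \<in> carrier A" for a
        using that \<open>x \<in> carrier A\<close> xe acx bby by (simp add: t_def Aac closed)
      ultimately show "bounded_functional A (\<lambda>a. t a c b (amult A x e) y)"
        unfolding bounded_functional_def by (simp add: A.add_closed A.scale_closed)
      have "bounded_functional A (\<lambda>x. q (amult A a c) b (amult A e x) y - q c b (amult A (amult A a e) x) y)"
        using that xe acx bby
        by (intro A.functional_diff A.functional_mult[of "\<lambda>x. q (amult A a c) b x y"]
            A.functional_mult[of "\<lambda>x. q c b x y"] q1 q3 closed)
      moreover have "q (amult A a c) b (amult A e x) y - q c b (amult A (amult A a e) x) y = t a c b (amult A x e) y"
        if "x \<in> carrier A" for x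
        using that \<open>a \<in> carrier A\<close> xe acx bby by (simp add: t_def Aac closed)
      ultimately show "bounded_functional A (\<lambda>x. t a c b (amult A x e) y)"
        unfolding bounded_functional_def by (simp add: A.add_closed A.scale_closed)
    qed
    define M where "M = 2 * K * vnorm A c * vnorm B b * vnorm A e * vnorm B y"
    have bd: "cmod (t a c b (amult A x e) y) \<le> M * vnorm A a * vnorm A x"
      if ax: "a \<in> carrier A" "x \<in> carrier A" for a x
    proof -
      have nn: "0 \<le> vnorm A a" "0 \<le> vnorm A x" "0 \<le> vnorm A c" "0 \<le> vnorm A e" "0 \<le> vnorm B b" "0 \<le> vnorm B y"
        using ax acx bby xe A.norm_nonneg B.norm_nonneg by auto
      have "cmod (q (amult A a c) b (amult A x e) y) \<le>
          K * vnorm A (amult A a c) * vnorm B b * vnorm A (amult A x e) * vnorm B y"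
        using ax acx bby xe by (intro K closed)
      also have "\<dots> \<le> K * (vnorm A a * vnorm A c) * vnorm B b * (vnorm A x * vnorm A e) * vnorm B y"
        using ax acx bby xe nn \<open>K \<ge> 0\<close>
        by (intro mult_mono A.norm_submult order_refl mult_nonneg_nonneg A.norm_nonneg closed)
      finally have 1: "cmod (q (amult A a c) b (amult A x e) y) \<le>
          K * (vnorm A a * vnorm A c) * vnorm B b * (vnorm A x * vnorm A e) * vnorm B y" .
      have "cmod (q c b (amult A a (amult A x e)) y) \<le>
          K * vnorm A c * vnorm B b * vnorm A (amult A a (amult A x e)) * vnorm B y"
        using ax acx bby xe by (intro K closed)
      also have "\<dots> \<le> K * vnorm A c * vnorm B b * (vnorm A a * (vnorm A x * vnorm A e)) * vnorm B y"
        using ax acx bby xe nn \<open>K \<ge> 0\<close>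
        by (intro mult_mono order_trans[OF A.norm_submult mult_left_mono[OF A.norm_submult]]
            order_refl mult_nonneg_nonneg A.norm_nonneg closed)
      finally have 2: "cmod (q c b (amult A a (amult A x e)) y) \<le>
          K * vnorm A c * vnorm B b * (vnorm A a * (vnorm A x * vnorm A e)) * vnorm B y" .
      have "cmod (t a c b (amult A x e) y) \<le>
          cmod (q (amult A a c) b (amult A x e) y) + cmod (q c b (amult A a (amult A x e)) y)"
        unfolding t_def by (rule norm_triangle_ineq4)
      also have "\<dots> \<le> M * vnorm A a * vnorm A x"
        using 1 2 by (simp add: M_def algebra_simps)
      finally show ?thesis .
    qed
    have "derivation_form A (\<lambda>a x. t a c b (amult A x e) y)"
      unfolding derivation_form_def
    proof (intro conjI ballI)
      show "bilinear_form A A (\<lambda>a x. t a c b (amult A x e) y)"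
        using lin unfolding bilinear_form_def bounded_functional_def by blast
      show "\<exists>C. \<forall>a\<in>carrier A. \<forall>x\<in>carrier A. cmod (t a c b (amult A x e) y) \<le> C * vnorm A a * vnorm A x"
        using bd by blast
      fix a a' x assume a: "a \<in> carrier A" "a' \<in> carrier A" "x \<in> carrier A"
      \<comment> \<open>The cocycle identity: add and subtract \<open>q (amult A a' c) b\<close> at
        a x e and y. \<open>t_comm\<close> then carries a' from the argument c to the argument x
        e.\<close>
      have "t (amult A a a') c b (amult A x e) y =
          t a (amult A a' c) b (amult A x e) y + t a' c b (amult A a (amult A x e)) y"
        using a xe acx bby by (simp add: t_def Aac closed)
      also have "t a (amult A a' c) b (amult A x e) y = t a c b (amult A (amult A a' x) e) y"
        using a xe acx bby by (simp add: t_comm closed A.mult_assoc)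
      also have "amult A a (amult A x e) = amult A (amult A x a) e"
        using a xe by (simp add: Aac closed)
      finally show "t (amult A a a') c b (amult A x e) y =
          t a' c b (amult A (amult A x a) e) y + t a c b (amult A (amult A a' x) e) y" by simp
    qed
    then show "t a c b (amult A x e) y = 0"
      using waA acx xe unfolding A.weakly_amenable_iff by blast
  qed
  then show ?thesis by (simp add: t_def)
qed

text \<open>The module laws of both factors together say D(u v) = u D(v) for elementary tensors. The
  Leibniz rule contains this term and one more, which must vanish; it is the value of
  \<open>q a b\<close> at a product in each of the last two arguments. The two product conditions
  are removed in turn.\<close>

lemma derivation_quad_zero:
  assumes q: "derivation_quad A B q"
    and waA: "weakly_amenable A" and waB: "weakly_amenable B"
    and abxy: "a \<in> carrier A" "b \<in> carrier B" "x \<in> carrier A" "y \<in> carrier B"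
  shows "q a b x y = 0"
proof -
  interpret BA: comm_algebra_pair B A ..
  have modB: "q a (amult B b c) x y = q a c x (amult B b y)"
    if "a \<in> carrier A" "x \<in> carrier A" "b \<in> carrier B" "c \<in> carrier B" "y \<in> carrier B" for a b c x y
    using BA.derivation_quad_module[OF derivation_quad_swap[OF q] waB waA, of b c y a x] that by simp
  have q3: "bounded_functional A (\<lambda>x. q a b x y)" if "y \<in> carrier B" for y
    using q abxy that by (simp add: derivation_quad_def)
  have q4: "bounded_functional B (q a b x)" if "x \<in> carrier A" for x
    using q abxy that by (simp add: derivation_quad_def)
  have zero: "q a b (amult A a' x) (amult B b' y) = 0"
    if "a' \<in> carrier A" "x \<in> carrier A" "b' \<in> carrier B" "y \<in> carrier B" for a' x b' y
  proof -
    have "q (amult A a a') (amult B b b') x y = q a' b' (amult A a x) (amult B b y)"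
      using that abxy
      by (simp add: derivation_quad_module[OF q waA waB] modB A.mult_closed B.mult_closed)
    moreover have "q (amult A a a') (amult B b b') x y =
        q a' b' (amult A a x) (amult B b y) + q a b (amult A a' x) (amult B b' y)"
      using q that abxy by (simp add: derivation_quadD(5))
    ultimately show ?thesis by simp
  qed
  have "q a b (amult A a' x) y = 0" if "a' \<in> carrier A" "x \<in> carrier A" for a' x
    using B.weakly_amenable_functional_zero[OF waB q4 zero abxy(4)] that A.mult_closed by blast
  then show ?thesis
    using A.weakly_amenable_functional_zero[OF waA q3[OF abxy(4)] _ abxy(3)] by blast
qed

end

section \<open>The algebraic tensor product and its projective norm\<close>

context comm_algebra_pair
begin

abbreviation "T \<equiv> algebraic_tensor A B"
abbreviation "e \<equiv> elem_tensor A B"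
abbreviation "ts \<equiv> tensor_sum A B"

abbreviation rep_norm :: "('a \<times> 'b) list \<Rightarrow> real" where
  "rep_norm xs \<equiv> (\<Sum>(a, b)\<leftarrow>xs. vnorm A a * vnorm B b)"

abbreviation valid :: "('a \<times> 'b) list \<Rightarrow> bool" where
  "valid xs \<equiv> set xs \<subseteq> carrier A \<times> carrier B"

definition rep_mult :: "('a \<times> 'b) list \<Rightarrow> ('a \<times> 'b) list \<Rightarrow> ('a \<times> 'b) list" where
  "rep_mult xs ys = concat (map (\<lambda>(a, b). map (\<lambda>(c, d). (amult A a c, amult B b d)) ys) xs)"

lemma tensor_sum_simps [simp]:
  "ts [] = (\<lambda>\<beta>. 0)"
  "ts ((a, b) # xs) = (\<lambda>\<beta>. e a b \<beta> + ts xs \<beta>)"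
  "ts (xs @ ys) = (\<lambda>\<beta>. ts xs \<beta> + ts ys \<beta>)"
  by (simp_all add: tensor_sum_def fun_eq_iff)

lemma tensor_sum_eval:
  "bilinear_form A B \<beta> \<Longrightarrow> ts xs \<beta> = (\<Sum>(a, b)\<leftarrow>xs. \<beta> a b)"
  "\<not> bilinear_form A B \<beta> \<Longrightarrow> ts xs \<beta> = 0"
  by (induction xs) (auto simp: elem_tensor_def)

lemma bilinear_form_mult:
  assumes "bilinear_form A B \<beta>" "a \<in> carrier A" "b \<in> carrier B"
  shows "bilinear_form A B (\<lambda>c d. \<beta> (amult A a c) (amult B b d))"
  using assms unfolding bilinear_form_def
  by (simp add: A.mult_closed B.mult_closed A.mult_add B.mult_add A.mult_scale B.mult_scale)

lemma bilinear_form_add: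
  assumes "bilinear_form A B \<beta>" "bilinear_form A B \<gamma>"
  shows "bilinear_form A B (\<lambda>c d. \<beta> c d + \<gamma> c d)"
  using assms unfolding bilinear_form_def by (simp add: algebra_simps)

text \<open>\<open>tensor_mult\<close> evaluates its first factor at this function, and an
  elementary tensor returns \<open>0\<close> at anything that is not bilinear. Bilinearity is thus
  what makes products computable.\<close>

lemma bilinear_form_mult_sum:
  assumes \<beta>: "bilinear_form A B \<beta>" and ys: "valid ys"
  shows "bilinear_form A B (\<lambda>a b. ts ys (\<lambda>c d. \<beta> (amult A a c) (amult B b d)))"
proof -
  have *: "ts ys (\<lambda>c d. \<beta> (amult A a c) (amult B b d)) = (\<Sum>(c, d)\<leftarrow>ys. \<beta> (amult A a c) (amult B b d))"
    if "a \<in> carrier A" "b \<in> carrier B" for a b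
    using bilinear_form_mult[OF \<beta> that] by (simp add: tensor_sum_eval)
  have "bilinear_form A B (\<lambda>a b. (\<Sum>(c, d)\<leftarrow>ys. \<beta> (amult A a c) (amult B b d)))"
    using ys
  proof (induction ys)
    case Nil
    then show ?case by (simp add: bilinear_form_def)
  next
    case (Cons cd ys)
    obtain c d where cd: "cd = (c, d)" "c \<in> carrier A" "d \<in> carrier B" using Cons.prems by auto
    have "bilinear_form A B (\<lambda>a b. \<beta> (amult A a c) (amult B b d))"
      using \<beta> cd(2,3) unfolding bilinear_form_def
      by (simp add: A.mult_closed B.mult_closed A.add_mult B.add_mult A.scale_mult B.scale_mult)
    from bilinear_form_add[OF this Cons.IH] Cons.prems show ?case by (simp add: cd)
  qed
  then show ?thesis
    unfolding bilinear_form_def by (simp add: * A.add_closed B.add_closed A.scale_closed B.scale_closed)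
qed

text \<open>The product is defined without representations, so it is automatically independent of
  them. Here it is matched with termwise multiplication, which norm estimates and closure
  require.\<close>

lemma tensor_mult_sum:
  assumes xs: "valid xs" and ys: "valid ys"
  shows "tensor_mult A B (ts xs) (ts ys) = ts (rep_mult xs ys)"
proof
  fix \<beta>
  show "tensor_mult A B (ts xs) (ts ys) \<beta> = ts (rep_mult xs ys) \<beta>"
  proof (cases "bilinear_form A B \<beta>")
    case True
    have "ts xs (\<lambda>a b. ts ys (\<lambda>c d. \<beta> (amult A a c) (amult B b d))) =
        (\<Sum>(a, b)\<leftarrow>xs. ts ys (\<lambda>c d. \<beta> (amult A a c) (amult B b d)))"
      using bilinear_form_mult_sum[OF True ys] by (simp add: tensor_sum_eval)
    also have "\<dots> = (\<Sum>(a, b)\<leftarrow>xs. \<Sum>(c, d)\<leftarrow>ys. \<beta> (amult A a c) (amult B b d))"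
      using xs bilinear_form_mult[OF True]
      by (intro arg_cong[where f = sum_list] map_cong) (auto simp: tensor_sum_eval)
    also have "\<dots> = (\<Sum>(a, b)\<leftarrow>rep_mult xs ys. \<beta> a b)"
      by (induction xs) (auto simp: rep_mult_def o_def case_prod_unfold)
    finally show ?thesis using True by (simp add: tensor_mult_def tensor_sum_eval)
  qed (simp add: tensor_mult_def tensor_sum_eval)
qed

lemma valid_rep_mult: "valid xs \<Longrightarrow> valid ys \<Longrightarrow> valid (rep_mult xs ys)"
  by (fastforce simp: rep_mult_def intro: A.mult_closed B.mult_closed)

lemma rep_norm_nonneg: "valid xs \<Longrightarrow> 0 \<le> rep_norm xs"
  by (induction xs) (auto simp: A.norm_nonneg B.norm_nonneg)

lemma rep_norm_mult: "valid xs \<Longrightarrow> valid ys \<Longrightarrow> rep_norm (rep_mult xs ys) \<le> rep_norm xs * rep_norm ys"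
proof (induction xs)
  case (Cons ab xs)
  obtain a b where ab: "ab = (a, b)" "a \<in> carrier A" "b \<in> carrier B" using Cons.prems by auto
  have "(\<Sum>(c, d)\<leftarrow>ys. vnorm A (amult A a c) * vnorm B (amult B b d)) \<le> vnorm A a * vnorm B b * rep_norm ys"
    using Cons.prems(2)
  proof (induction ys)
    case (Cons cd ys)
    obtain c d where cd: "cd = (c, d)" "c \<in> carrier A" "d \<in> carrier B" using Cons.prems by auto
    have "vnorm A (amult A a c) * vnorm B (amult B b d) \<le> (vnorm A a * vnorm A c) * (vnorm B b * vnorm B d)"
      using ab cd by (intro mult_mono A.norm_submult B.norm_submult mult_nonneg_nonneg
          A.norm_nonneg B.norm_nonneg B.mult_closed)
    with Cons show ?case by (simp add: cd algebra_simps)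
  qed simp
  with Cons show ?case
    by (simp add: ab rep_mult_def o_def case_prod_unfold distrib_right mult.assoc)
qed (simp add: rep_mult_def)

lemma carrier_T: "carrier T = {ts xs | xs. valid xs}"
  by (simp add: algebraic_tensor_def)

lemma rep_norm_bdd: "bdd_below {rep_norm xs | xs. valid xs \<and> u = ts xs}"
  using rep_norm_nonneg by (intro bdd_belowI[of _ 0]) blast

lemma projective_norm_le: "valid xs \<Longrightarrow> projective_norm A B (ts xs) \<le> rep_norm xs"
  unfolding projective_norm_def by (rule cInf_lower[OF _ rep_norm_bdd]) auto

lemma projective_norm_ge:
  assumes "u \<in> carrier T" "\<And>xs. valid xs \<Longrightarrow> u = ts xs \<Longrightarrow> c \<le> rep_norm xs"
  shows "c \<le> projective_norm A B u"
  unfolding projective_norm_def by (rule cInf_greatest) (use assms carrier_T in auto)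

lemma projective_norm_approx:
  assumes "u \<in> carrier T" "0 < \<epsilon>"
  obtains xs where "valid xs" "u = ts xs" "rep_norm xs < projective_norm A B u + \<epsilon>"
proof -
  have "\<not> projective_norm A B u + \<epsilon> \<le> projective_norm A B u" using assms by simp
  then show ?thesis using projective_norm_ge[OF assms(1)] that by (meson not_le)
qed

lemma projective_norm_nonneg: "u \<in> carrier T \<Longrightarrow> 0 \<le> projective_norm A B u"
  by (intro projective_norm_ge rep_norm_nonneg)

lemma tensor_sum_scale:
  assumes "valid xs"
  shows "valid (map (\<lambda>(a, b). (vscale A c a, b)) xs)"
    "ts (map (\<lambda>(a, b). (vscale A c a, b)) xs) = (\<lambda>\<beta>. c * ts xs \<beta>)"
    "rep_norm (map (\<lambda>(a, b). (vscale A c a, b)) xs) = cmod c * rep_norm xs"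
proof -
  let ?ys = "map (\<lambda>(a, b). (vscale A c a, b)) xs"
  have "valid ?ys \<and> ts ?ys = (\<lambda>\<beta>. c * ts xs \<beta>) \<and> rep_norm ?ys = cmod c * rep_norm xs"
    using assms
  proof (induction xs)
    case (Cons ab xs)
    obtain a b where ab: "ab = (a, b)" "a \<in> carrier A" "b \<in> carrier B" using Cons.prems by auto
    have "e (vscale A c a) b \<beta> = c * e a b \<beta>" for \<beta>
      using ab by (simp add: elem_tensor_def bilinear_form_def)
    with Cons ab show ?case by (simp add: A.scale_closed A.norm_scale distrib_left)
  qed simp
  then show "valid ?ys" "ts ?ys = (\<lambda>\<beta>. c * ts xs \<beta>)" "rep_norm ?ys = cmod c * rep_norm xs" by blast+
qed

text \<open>Every representation of \<open>u\<close> is rescaled in its first entries. Applied to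
  \<open>c * u\<close> with the scalar \<open>inverse c\<close>, the inequality yields its own
  converse.\<close>

lemma projective_norm_scale_le:
  assumes u: "u \<in> carrier T"
  shows "projective_norm A B (\<lambda>\<beta>. c * u \<beta>) \<le> cmod c * projective_norm A B u"
proof (cases "c = 0")
  case True
  then show ?thesis using projective_norm_le[of "[]"] by simp
next
  case False
  have "projective_norm A B (\<lambda>\<beta>. c * u \<beta>) / cmod c \<le> projective_norm A B u"
  proof (rule projective_norm_ge[OF u])
    fix xs assume xs: "valid xs" "u = ts xs"
    then show "projective_norm A B (\<lambda>\<beta>. c * u \<beta>) / cmod c \<le> rep_norm xs"
      using projective_norm_le[OF tensor_sum_scale(1)[OF xs(1)], of c] tensor_sum_scale(2,3)[OF xs(1), of c] False
      by (simp add: field_simps)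
  qed
  then show ?thesis using False by (simp add: field_simps)
qed

lemma function_algebra_T: "function_algebra T"
proof
  note [simp] = algebraic_tensor_def
  show "carrier T \<noteq> {}" by (auto intro!: exI[of _ "[]"])
  show "vadd T = (\<lambda>u v i. u i + v i)" "vscale T = (\<lambda>c u i. c * u i)" by auto
next
  fix u v assume "u \<in> carrier T" "v \<in> carrier T"
  then obtain xs ys where xs: "valid xs" "u = ts xs" and ys: "valid ys" "v = ts ys"
    unfolding carrier_T by blast
  show "vadd T u v \<in> carrier T"
    using xs ys by (auto simp: algebraic_tensor_def intro!: exI[of _ "xs @ ys"])
  show "amult T u v \<in> carrier T"
    using tensor_mult_sum[OF xs(1) ys(1)] valid_rep_mult[OF xs(1) ys(1)] xs(2) ys(2)
    by (auto simp: algebraic_tensor_def)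
  have "projective_norm A B (\<lambda>i. u i + v i) \<le> projective_norm A B u + projective_norm A B v + \<epsilon>" if "0 < \<epsilon>" for \<epsilon>
  proof -
    obtain xs where xs: "valid xs" "u = ts xs" "rep_norm xs < projective_norm A B u + \<epsilon> / 2"
      using projective_norm_approx[OF \<open>u \<in> carrier T\<close> half_gt_zero[OF \<open>0 < \<epsilon>\<close>]] .
    obtain ys where ys: "valid ys" "v = ts ys" "rep_norm ys < projective_norm A B v + \<epsilon> / 2"
      using projective_norm_approx[OF \<open>v \<in> carrier T\<close> half_gt_zero[OF \<open>0 < \<epsilon>\<close>]] .
    show ?thesis
      using projective_norm_le[of "xs @ ys"] xs ys by simp
  qed
  then show "vnorm T (\<lambda>i. u i + v i) \<le> vnorm T u + vnorm T v"
    by (simp add: algebraic_tensor_def field_le_epsilon)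
  have pos: "0 < 1 / real (Suc n)" for n by simp
  \<comment> \<open>Nearly optimal representations of \<open>u\<close> and \<open>v\<close> multiply
    to a representation of the product; the errors \<open>1 / real (Suc n)\<close> vanish in the
    limit.\<close>
  have "(\<lambda>n. (projective_norm A B u + 1 / real (Suc n)) * (projective_norm A B v + 1 / real (Suc n)))
      \<longlonglongrightarrow> (projective_norm A B u + 0) * (projective_norm A B v + 0)"
    by (intro tendsto_intros LIMSEQ_Suc[OF lim_1_over_n])
  moreover have "projective_norm A B (tensor_mult A B u v) \<le>
      (projective_norm A B u + 1 / real (Suc n)) * (projective_norm A B v + 1 / real (Suc n))" for n
  proof -
    obtain xs where xs: "valid xs" "u = ts xs" "rep_norm xs < projective_norm A B u + 1 / real (Suc n)"
      using projective_norm_approx[OF \<open>u \<in> carrier T\<close> pos[of n]] .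
    obtain ys where ys: "valid ys" "v = ts ys" "rep_norm ys < projective_norm A B v + 1 / real (Suc n)"
      using projective_norm_approx[OF \<open>v \<in> carrier T\<close> pos[of n]] .
    have "projective_norm A B (tensor_mult A B u v) \<le> rep_norm (rep_mult xs ys)"
      unfolding xs(2) ys(2) tensor_mult_sum[OF xs(1) ys(1)]
      by (intro projective_norm_le valid_rep_mult xs ys)
    also have "\<dots> \<le> rep_norm xs * rep_norm ys" by (intro rep_norm_mult xs ys)
    also have "\<dots> \<le> (projective_norm A B u + 1 / real (Suc n)) * (projective_norm A B v + 1 / real (Suc n))"
      using xs ys rep_norm_nonneg by (intro mult_mono) (auto intro: order_trans[OF rep_norm_nonneg less_imp_le])
    finally show ?thesis .
  qed
  ultimately show "vnorm T (amult T u v) \<le> vnorm T u * vnorm T v"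
    by (auto simp: algebraic_tensor_def intro: LIMSEQ_le_const)
  fix w assume "w \<in> carrier T"
  then obtain zs where zs: "valid zs" "w = ts zs" unfolding carrier_T by blast
  have 1: "tensor_mult A B (ts (xs @ ys)) (ts zs) = (\<lambda>i. tensor_mult A B (ts xs) (ts zs) i + tensor_mult A B (ts ys) (ts zs) i)"
    using xs ys zs by (simp add: tensor_mult_def fun_eq_iff)
  then show "amult T (\<lambda>i. u i + v i) w = (\<lambda>i. amult T u w i + amult T v w i)"
    unfolding xs ys zs by (simp add: algebraic_tensor_def)
  show "amult T w (\<lambda>i. u i + v i) = (\<lambda>i. amult T w u i + amult T w v i)"
  proof -
    have "tensor_mult A B (ts zs) (ts (xs @ ys)) \<beta> = tensor_mult A B (ts zs) (ts xs) \<beta> + tensor_mult A B (ts zs) (ts ys) \<beta>" for \<beta>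
    proof (cases "bilinear_form A B \<beta>")
      case True
      note b = bilinear_form_mult_sum[OF True xs(1)] bilinear_form_mult_sum[OF True ys(1)]
      show ?thesis
        using True b bilinear_form_add[OF b]
        by (simp add: tensor_mult_def tensor_sum_eval sum_list_addf[symmetric] case_prod_unfold)
    qed (simp add: tensor_mult_def)
    then show ?thesis unfolding xs ys zs by (simp add: algebraic_tensor_def fun_eq_iff)
  qed
next
  fix u c assume u: "u \<in> carrier T"
  then obtain xs where xs: "valid xs" "u = ts xs" unfolding carrier_T by blast
  show "0 \<le> vnorm T u" using projective_norm_nonneg[OF u] by (simp add: algebraic_tensor_def)
  show cu: "vscale T c u \<in> carrier T"
  proof -
    have "vscale T c u = ts (map (\<lambda>(a, b). (vscale A c a, b)) xs)"
      using tensor_sum_scale(2)[OF xs(1)] xs(2) by (simp add: algebraic_tensor_def)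
    then show ?thesis using tensor_sum_scale(1)[OF xs(1)] unfolding carrier_T by blast
  qed
  show "vnorm T (vscale T c u) = cmod c * vnorm T u"
  proof (cases "c = 0")
    case True
    then show ?thesis
      using projective_norm_scale_le[OF u, of c] projective_norm_nonneg[OF cu]
      by (simp add: algebraic_tensor_def)
  next
    case False
    have "projective_norm A B u \<le> cmod (inverse c) * projective_norm A B (\<lambda>\<beta>. c * u \<beta>)"
      using projective_norm_scale_le[OF cu, of "inverse c"] False
      by (simp add: algebraic_tensor_def mult.assoc[symmetric])
    then show ?thesis
      using projective_norm_scale_le[OF u, of c] False
      by (simp add: algebraic_tensor_def norm_inverse norm_divide field_simps)
  qed
  fix w assume "w \<in> carrier T"
  then obtain zs where zs: "valid zs" "w = ts zs" unfolding carrier_T by blast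
  show "amult T (\<lambda>i. c * u i) w = (\<lambda>i. c * amult T u w i)"
    by (simp add: algebraic_tensor_def tensor_mult_def fun_eq_iff)
  have "tensor_mult A B (ts zs) (\<lambda>i. c * ts xs i) \<beta> = c * tensor_mult A B (ts zs) (ts xs) \<beta>" for \<beta>
  proof (cases "bilinear_form A B \<beta>")
    case True
    note b = bilinear_form_mult_sum[OF True xs(1)]
    have "bilinear_form A B (\<lambda>a b. c * ts xs (\<lambda>x y. \<beta> (amult A a x) (amult B b y)))"
      using b unfolding bilinear_form_def by (simp add: algebra_simps)
    then show ?thesis
      using True b by (simp add: tensor_mult_def tensor_sum_eval sum_list_const_mult[symmetric] case_prod_unfold)
  qed (simp add: tensor_mult_def)
  then show "amult T w (\<lambda>i. c * u i) = (\<lambda>i. c * amult T w u i)"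
    unfolding xs zs by (simp add: algebraic_tensor_def fun_eq_iff)
qed

sublocale T: function_algebra T
  by (rule function_algebra_T)

lemma elem_tensor_eq: "e a b = ts [(a, b)]"
  by (simp add: fun_eq_iff)

lemma elem_tensor_closed: "a \<in> carrier A \<Longrightarrow> b \<in> carrier B \<Longrightarrow> e a b \<in> carrier T"
  unfolding carrier_T elem_tensor_eq by (intro CollectI exI[of _ "[(a, b)]"]) simp

lemma elem_tensor_mult:
  "a \<in> carrier A \<Longrightarrow> b \<in> carrier B \<Longrightarrow> c \<in> carrier A \<Longrightarrow> d \<in> carrier B \<Longrightarrow>
    amult T (e a b) (e c d) = e (amult A a c) (amult B b d)"
  unfolding elem_tensor_eq by (simp add: algebraic_tensor_def tensor_mult_sum rep_mult_def del: tensor_sum_simps)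

lemma elem_tensor_norm:
  "a \<in> carrier A \<Longrightarrow> b \<in> carrier B \<Longrightarrow> vnorm T (e a b) \<le> vnorm A a * vnorm B b"
  unfolding elem_tensor_eq using projective_norm_le[of "[(a, b)]"]
  by (simp add: algebraic_tensor_def del: tensor_sum_simps)

lemma elem_tensor_cong:
  assumes "\<And>\<beta>. bilinear_form A B \<beta> \<Longrightarrow> \<beta> a b = w \<beta>" "\<And>\<beta>. \<not> bilinear_form A B \<beta> \<Longrightarrow> w \<beta> = 0"
  shows "e a b = w"
  using assms by (auto simp: elem_tensor_def)

lemma elem_tensor_add:
  "a \<in> carrier A \<Longrightarrow> a' \<in> carrier A \<Longrightarrow> b \<in> carrier B \<Longrightarrow> e (vadd A a a') b = vadd T (e a b) (e a' b)"
  "a \<in> carrier A \<Longrightarrow> b \<in> carrier B \<Longrightarrow> b' \<in> carrier B \<Longrightarrow> e a (vadd B b b') = vadd T (e a b) (e a b')"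
  unfolding T.add_eq
  by (rule elem_tensor_cong; simp add: elem_tensor_def; simp add: bilinear_form_def)+

lemma elem_tensor_scale:
  "a \<in> carrier A \<Longrightarrow> b \<in> carrier B \<Longrightarrow> e (vscale A c a) b = vscale T c (e a b)"
  "a \<in> carrier A \<Longrightarrow> b \<in> carrier B \<Longrightarrow> e a (vscale B c b) = vscale T c (e a b)"
  unfolding T.scale_eq
  by (rule elem_tensor_cong; simp add: elem_tensor_def; simp add: bilinear_form_def)+

text \<open>Elements are plain sums of elementary tensors, the scalars being absorbed by the
  entries, so additivity suffices. The empty sum is handled by \<phi>(0) = \<phi>(0) +
  \<phi>(0).\<close>

lemma tensor_additive_zero:
  assumes add: "\<And>u v. u \<in> carrier T \<Longrightarrow> v \<in> carrier T \<Longrightarrow> \<phi> (\<lambda>\<beta>. u \<beta> + v \<beta>) = \<phi> u + \<phi> v"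
    and u: "u \<in> carrier T"
    and zero: "\<And>a b. a \<in> carrier A \<Longrightarrow> b \<in> carrier B \<Longrightarrow> \<phi> (e a b) = 0"
  shows "\<phi> u = (0::complex)"
proof -
  have "\<phi> (ts xs) = 0" if "valid xs" for xs
    using that
  proof (induction xs)
    case Nil
    have "(\<lambda>\<beta>. 0) \<in> carrier T" unfolding carrier_T by (auto intro!: exI[of _ "[]"])
    from add[OF this this] have "\<phi> (\<lambda>\<beta>. 0 + 0) = \<phi> (\<lambda>\<beta>. 0) + \<phi> (\<lambda>\<beta>. 0)" .
    then show ?case by simp
  next
    case (Cons ab xs)
    obtain a b where ab: "ab = (a, b)" "a \<in> carrier A" "b \<in> carrier B" using Cons.prems by auto
    have "ts xs \<in> carrier T" using Cons.prems unfolding carrier_T by auto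
    then have "\<phi> (\<lambda>\<beta>. e a b \<beta> + ts xs \<beta>) = \<phi> (e a b) + \<phi> (ts xs)"
      using elem_tensor_closed ab by (intro add) auto
    then show ?case using Cons zero ab by simp
  qed
  then show ?thesis using u carrier_T by auto
qed

text \<open>A form on the algebraic tensor product restricts to a \<open>derivation_quad\<close>,
  which is zero. Additivity in each argument carries this from elementary tensors to all
  elements.\<close>

theorem weakly_amenable_tensor:
  assumes waA: "weakly_amenable A" and waB: "weakly_amenable B"
  shows "weakly_amenable (A \<otimes>\<^sub>\<pi> B)"
  unfolding projective_tensor_def T.weakly_amenable_completion
proof (intro allI impI)
  fix d assume d: "derivation_form T d"
  define q where "q a b x y = d (e a b) (e x y)" for a b x y
  obtain K0 where K0: "\<And>u v. u \<in> carrier T \<Longrightarrow> v \<in> carrier T \<Longrightarrow>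
      cmod (d u v) \<le> K0 * vnorm T u * vnorm T v"
    using d unfolding derivation_form_def by blast
  have bound: "cmod (q a b x y) \<le> \<bar>K0\<bar> * vnorm A a * vnorm B b * vnorm A x * vnorm B y"
    if "a \<in> carrier A" "b \<in> carrier B" "x \<in> carrier A" "y \<in> carrier B" for a b x y
  proof -
    note ec = elem_tensor_closed[OF that(1,2)] elem_tensor_closed[OF that(3,4)]
    have "cmod (q a b x y) \<le> K0 * vnorm T (e a b) * vnorm T (e x y)"
      unfolding q_def by (intro K0 ec)
    also have "\<dots> \<le> \<bar>K0\<bar> * (vnorm A a * vnorm B b) * (vnorm A x * vnorm B y)"
      using that by (intro mult_mono elem_tensor_norm T.norm_nonneg ec mult_nonneg_nonneg
          A.norm_nonneg B.norm_nonneg) auto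
    finally show ?thesis by (simp add: mult_ac)
  qed
  have d_add: "d (\<lambda>\<beta>. u \<beta> + u' \<beta>) w = d u w + d u' w" "d w (\<lambda>\<beta>. u \<beta> + u' \<beta>) = d w u + d w u'"
    if "u \<in> carrier T" "u' \<in> carrier T" "w \<in> carrier T" for u u' w
    using d that by (auto simp: derivation_form_def bilinear_form_def T.add_eq)
  have quad: "derivation_quad A B q"
    unfolding derivation_quad_def
  proof (intro conjI ballI)
    fix a b x y assume m: "a \<in> carrier A" "b \<in> carrier B" "x \<in> carrier A" "y \<in> carrier B"
    note ec = elem_tensor_closed
    have lin: "d (vadd T u u') w = d u w + d u' w" "d w (vadd T u u') = d w u + d w u'"
      if "u \<in> carrier T" "u' \<in> carrier T" "w \<in> carrier T" for u u' w
      using d that by (auto simp: derivation_form_def bilinear_form_def)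
    have lin': "d (vscale T c u) w = c * d u w" "d w (vscale T c u) = c * d w u"
      if "u \<in> carrier T" "w \<in> carrier T" for u w c
      using d that by (auto simp: derivation_form_def bilinear_form_def)
    have "cmod (q a b x y) \<le> (\<bar>K0\<bar> * vnorm B b * vnorm A x * vnorm B y) * vnorm A a" if "a \<in> carrier A" for a
      using bound[OF that m(2,3,4)] by (simp add: mult_ac)
    then have C1: "\<exists>C. \<forall>a\<in>carrier A. cmod (q a b x y) \<le> C * vnorm A a" by blast
    have "cmod (q a b x y) \<le> (\<bar>K0\<bar> * vnorm A a * vnorm A x * vnorm B y) * vnorm B b" if "b \<in> carrier B" for b
      using bound[OF m(1) that m(3,4)] by (simp add: mult_ac)
    then have C2: "\<exists>C. \<forall>b\<in>carrier B. cmod (q a b x y) \<le> C * vnorm B b" by blast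
    have "cmod (q a b x y) \<le> (\<bar>K0\<bar> * vnorm A a * vnorm B b * vnorm B y) * vnorm A x" if "x \<in> carrier A" for x
      using bound[OF m(1,2) that m(4)] by (simp add: mult_ac)
    then have C3: "\<exists>C. \<forall>x\<in>carrier A. cmod (q a b x y) \<le> C * vnorm A x" by blast
    have "cmod (q a b x y) \<le> (\<bar>K0\<bar> * vnorm A a * vnorm B b * vnorm A x) * vnorm B y" if "y \<in> carrier B" for y
      using bound[OF m(1,2,3) that] by (simp add: mult_ac)
    then have C4: "\<exists>C. \<forall>y\<in>carrier B. cmod (q a b x y) \<le> C * vnorm B y" by blast
    show "bounded_functional A (\<lambda>a. q a b x y)" "bounded_functional B (\<lambda>b. q a b x y)"
      "bounded_functional A (\<lambda>x. q a b x y)" "bounded_functional B (q a b x)"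
      unfolding bounded_functional_def
      by (intro conjI C1 C2 C3 C4; use m in \<open>simp add: q_def elem_tensor_add elem_tensor_scale lin lin' ec\<close>)+
  next
    show "\<exists>K\<ge>0. \<forall>a\<in>carrier A. \<forall>b\<in>carrier B. \<forall>x\<in>carrier A. \<forall>y\<in>carrier B.
        cmod (q a b x y) \<le> K * vnorm A a * vnorm B b * vnorm A x * vnorm B y"
      using bound by (intro exI[of _ "\<bar>K0\<bar>"]) auto
  next
    fix a a' b b' x y
    assume m: "a \<in> carrier A" "a' \<in> carrier A" "b \<in> carrier B" "b' \<in> carrier B" "x \<in> carrier A" "y \<in> carrier B"
    have "d (amult T (e a b) (e a' b')) (e x y) =
        d (e a' b') (amult T (e x y) (e a b)) + d (e a b) (amult T (e a' b') (e x y))"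
      using d m elem_tensor_closed by (simp add: derivation_form_def)
    then show "q (amult A a a') (amult B b b') x y =
          q a' b' (amult A a x) (amult B b y) + q a b (amult A a' x) (amult B b' y)"
      using m by (simp add: q_def elem_tensor_mult A.mult_comm[of x a] B.mult_comm[of y b])
  qed
  have zero: "d (e a b) (e x y) = 0"
    if "a \<in> carrier A" "b \<in> carrier B" "x \<in> carrier A" "y \<in> carrier B" for a b x y
    using derivation_quad_zero[OF quad waA waB that] by (simp add: q_def)
  show "\<forall>u\<in>carrier T. \<forall>v\<in>carrier T. d u v = 0"
  proof (intro ballI)
    fix u v assume uv: "u \<in> carrier T" "v \<in> carrier T"
    have zero': "d u (e x y) = 0" if "x \<in> carrier A" "y \<in> carrier B" for x y
      by (rule tensor_additive_zero[of "\<lambda>u. d u (e x y)"])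
        (simp_all add: d_add uv zero that elem_tensor_closed)
    show "d u v = 0"
      by (rule tensor_additive_zero[of "d u"]) (simp_all add: d_add uv zero')
  qed
qed

text \<open>A character \<open>\<phi>\<close> of \<open>B\<close> makes \<open>id \<otimes> \<phi>\<close> a homomorphism of \<open>A \<otimes> B\<close> onto \<open>A\<close>,
  along which derivations pull back.\<close>

theorem weakly_amenable_tensor_left:
  assumes wa: "weakly_amenable (A \<otimes>\<^sub>\<pi> B)"
    and \<phi>: "bounded_functional B \<phi>"
    and mult: "\<And>b b'. b \<in> carrier B \<Longrightarrow> b' \<in> carrier B \<Longrightarrow> \<phi> (amult B b b') = \<phi> b * \<phi> b'"
    and b0: "b0 \<in> carrier B" "\<phi> b0 \<noteq> 0"
  shows "weakly_amenable A"
  unfolding A.weakly_amenable_iff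
proof (intro allI impI ballI)
  fix d a x assume d: "derivation_form A d" and ax: "a \<in> carrier A" "x \<in> carrier A"
  have wa': "\<And>D u v. derivation_form T D \<Longrightarrow> u \<in> carrier T \<Longrightarrow> v \<in> carrier T \<Longrightarrow> D u v = 0"
    using wa unfolding projective_tensor_def T.weakly_amenable_completion by blast
  \<comment> \<open>This is \<open>d\<close> pulled back along id \<otimes> \<phi> in both
    arguments. Since tensors are functionals on bilinear forms, it can be written as an evaluation,
    without constructing id \<otimes> \<phi> itself.\<close>
  define D where "D u v = u (\<lambda>a b. v (\<lambda>x y. \<phi> b * \<phi> y * d a x))" for u v :: "('a \<Rightarrow> 'b \<Rightarrow> complex) \<Rightarrow> complex"
  have \<phi>_lin: "\<phi> (vadd B b b') = \<phi> b + \<phi> b'" if "b \<in> carrier B" "b' \<in> carrier B" for b b'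
    using \<phi> that by (auto simp: bounded_functional_def)
  have \<phi>_scale: "\<phi> (vscale B c b) = c * \<phi> b" if "b \<in> carrier B" for b c
    using \<phi> that by (auto simp: bounded_functional_def)
  have d_lin: "d (vadd A a a') x = d a x + d a' x" "d x (vadd A a a') = d x a + d x a'"
    if "a \<in> carrier A" "a' \<in> carrier A" "x \<in> carrier A" for a a' x
    using d that by (auto simp: derivation_form_def bilinear_form_def)
  have d_scale: "d (vscale A c a) x = c * d a x" "d x (vscale A c a) = c * d x a"
    if "a \<in> carrier A" "x \<in> carrier A" for a x c
    using d that by (auto simp: derivation_form_def bilinear_form_def)
  obtain K0 where K0: "\<And>a x. a \<in> carrier A \<Longrightarrow> x \<in> carrier A \<Longrightarrow>
      cmod (d a x) \<le> K0 * vnorm A a * vnorm A x"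
    using d unfolding derivation_form_def by blast
  obtain C where C: "\<And>b. b \<in> carrier B \<Longrightarrow> cmod (\<phi> b) \<le> C * vnorm B b"
    using \<phi> unfolding bounded_functional_def by blast
  have bil1: "bilinear_form A B (\<lambda>x y. \<phi> b * \<phi> y * d a x)" if "a \<in> carrier A" for a b
    using that unfolding bilinear_form_def by (simp add: \<phi>_lin \<phi>_scale d_lin d_scale algebra_simps)
  have ev1: "ts ys (\<lambda>x y. \<phi> b * \<phi> y * d a x) = \<phi> b * (\<Sum>(x, y)\<leftarrow>ys. \<phi> y * d a x)" if "a \<in> carrier A" for a b ys
    using bil1[OF that] by (simp add: tensor_sum_eval sum_list_const_mult[symmetric] case_prod_unfold mult.assoc)
  have lin2: "(\<Sum>(x, y)\<leftarrow>ys. \<phi> y * d (vadd A a a') x) = (\<Sum>(x, y)\<leftarrow>ys. \<phi> y * d a x) + (\<Sum>(x, y)\<leftarrow>ys. \<phi> y * d a' x)"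
    "(\<Sum>(x, y)\<leftarrow>ys. \<phi> y * d (vscale A c a) x) = c * (\<Sum>(x, y)\<leftarrow>ys. \<phi> y * d a x)"
    if "valid ys" "a \<in> carrier A" "a' \<in> carrier A" for a a' c ys
    using that(1) by (induction ys) (auto simp: that d_lin d_scale algebra_simps)
  have bil2: "bilinear_form A B (\<lambda>a b. ts ys (\<lambda>x y. \<phi> b * \<phi> y * d a x))" if "valid ys" for ys
    using that unfolding bilinear_form_def
    by (simp add: ev1 A.add_closed A.scale_closed) (simp add: lin2 \<phi>_lin \<phi>_scale algebra_simps)
  have ev: "D (ts xs) (ts ys) = (\<Sum>(a, b)\<leftarrow>xs. \<Sum>(x, y)\<leftarrow>ys. \<phi> b * \<phi> y * d a x)" if "valid xs" "valid ys" for xs ys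
  proof -
    have "D (ts xs) (ts ys) = (\<Sum>(a, b)\<leftarrow>xs. ts ys (\<lambda>x y. \<phi> b * \<phi> y * d a x))"
      using bil2[OF that(2)] by (simp add: D_def tensor_sum_eval)
    also have "\<dots> = (\<Sum>(a, b)\<leftarrow>xs. \<Sum>(x, y)\<leftarrow>ys. \<phi> b * \<phi> y * d a x)"
      using that bil1 by (intro arg_cong[where f = sum_list] map_cong) (auto simp: tensor_sum_eval)
    finally show ?thesis .
  qed
  \<comment> \<open>One factor \<open>\<bar>C\<bar>\<close> for each of the two values of
    \<open>\<phi>\<close>, and \<open>\<bar>K0\<bar>\<close> for \<open>d\<close>; absolute values
    keep products of the bounds monotone.\<close>
  define M where "M = \<bar>C\<bar> * \<bar>C\<bar> * \<bar>K0\<bar>"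
  have term_bound: "cmod (\<phi> b * \<phi> y * d a x) \<le> M * (vnorm A a * vnorm B b) * (vnorm A x * vnorm B y)"
    if m: "a \<in> carrier A" "b \<in> carrier B" "x \<in> carrier A" "y \<in> carrier B" for a b x y
  proof -
    have 1: "cmod (\<phi> b) \<le> \<bar>C\<bar> * vnorm B b" if "b \<in> carrier B" for b
      using C[OF that] mult_right_mono[OF abs_ge_self[of C] B.norm_nonneg[OF that]] by linarith
    have 2: "cmod (d a x) \<le> \<bar>K0\<bar> * vnorm A a * vnorm A x"
      using K0[OF m(1,3)] mult_right_mono[OF abs_ge_self[of K0] mult_nonneg_nonneg[OF A.norm_nonneg[OF m(1)] A.norm_nonneg[OF m(3)]]]
      by (simp add: mult.assoc)
    have "cmod (\<phi> b * \<phi> y * d a x) \<le> (\<bar>C\<bar> * vnorm B b) * (\<bar>C\<bar> * vnorm B y) * (\<bar>K0\<bar> * vnorm A a * vnorm A x)"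
      unfolding norm_mult using m 1 2 A.norm_nonneg B.norm_nonneg by (intro mult_mono) auto
    then show ?thesis by (simp add: M_def mult_ac)
  qed
  \<comment> \<open>The estimate holds for every pair of representations, so passing to nearly
    optimal ones later replaces \<open>rep_norm\<close> by the projective norm.\<close>
  have bound: "cmod (D (ts xs) (ts ys)) \<le> M * rep_norm xs * rep_norm ys" if "valid xs" "valid ys" for xs ys
  proof -
    have 1: "cmod (\<Sum>(x, y)\<leftarrow>ys. \<phi> b * \<phi> y * d a x) \<le> M * (vnorm A a * vnorm B b) * rep_norm ys"
      if "a \<in> carrier A" "b \<in> carrier B" for a b
      using \<open>valid ys\<close>
    proof (induction ys)
      case (Cons xy ys)
      obtain x y where xy: "xy = (x, y)" "x \<in> carrier A" "y \<in> carrier B" using Cons.prems by auto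
      have "cmod (\<Sum>(x, y)\<leftarrow>ys. \<phi> b * \<phi> y * d a x) \<le> M * (vnorm A a * vnorm B b) * rep_norm ys"
        using Cons by simp
      from order_trans[OF norm_triangle_ineq add_mono[OF term_bound[OF that xy(2,3)] this]]
      show ?case by (simp add: xy distrib_left)
    qed simp
    have "cmod (\<Sum>(a, b)\<leftarrow>xs. \<Sum>(x, y)\<leftarrow>ys. \<phi> b * \<phi> y * d a x) \<le> M * rep_norm xs * rep_norm ys"
      using \<open>valid xs\<close>
    proof (induction xs)
      case (Cons ab xs)
      obtain a b where ab: "ab = (a, b)" "a \<in> carrier A" "b \<in> carrier B" using Cons.prems by auto
      have "cmod (\<Sum>(a, b)\<leftarrow>xs. \<Sum>(x, y)\<leftarrow>ys. \<phi> b * \<phi> y * d a x) \<le> M * rep_norm xs * rep_norm ys"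
        using Cons by simp
      from order_trans[OF norm_triangle_ineq add_mono[OF 1[OF ab(2,3)] this]]
      show ?case by (simp add: ab distrib_left distrib_right)
    qed simp
    then show ?thesis by (simp add: ev that)
  qed
  have add: "D (\<lambda>\<beta>. u \<beta> + u' \<beta>) w = D u w + D u' w" for u u' w
    by (simp add: D_def)
  have add': "D w (\<lambda>\<beta>. u \<beta> + u' \<beta>) = D w u + D w u'"
    if uw: "u \<in> carrier T" "u' \<in> carrier T" "w \<in> carrier T" for u u' w
  proof -
    obtain xs ys zs where xs: "valid xs" "u = ts xs" and ys: "valid ys" "u' = ts ys" and zs: "valid zs" "w = ts zs"
      using uw unfolding carrier_T by blast
    have "D (ts zs) (ts (xs @ ys)) = D (ts zs) (ts xs) + D (ts zs) (ts ys)"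
      using zs(1) xs(1) ys(1) by (simp add: ev del: tensor_sum_simps) (induction zs, auto simp: algebra_simps)
    then show ?thesis by (simp add: xs ys zs)
  qed
  have scale': "D w (\<lambda>\<beta>. c * u \<beta>) = c * D w u" if uw: "u \<in> carrier T" "w \<in> carrier T" for u w c
  proof -
    obtain xs zs where xs: "valid xs" "u = ts xs" and zs: "valid zs" "w = ts zs"
      using uw unfolding carrier_T by blast
    have 1: "(\<Sum>(x, y)\<leftarrow>map (\<lambda>(a, b). (vscale A c a, b)) xs. \<phi> b * \<phi> y * d a x) = c * (\<Sum>(x, y)\<leftarrow>xs. \<phi> b * \<phi> y * d a x)"
      if "a \<in> carrier A" for a b
      using xs(1) that by (induction xs) (auto simp: d_lin d_scale algebra_simps)
    have "D (ts zs) (ts (map (\<lambda>(a, b). (vscale A c a, b)) xs)) = c * D (ts zs) (ts xs)"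
      unfolding ev[OF zs(1) tensor_sum_scale(1)[OF xs(1)]] ev[OF zs(1) xs(1)]
      using zs(1) by (induction zs) (auto simp: 1 distrib_left simp del: map_map)
    then show ?thesis by (simp add: xs zs tensor_sum_scale(2))
  qed
  have "derivation_form T D"
    unfolding derivation_form_def
  proof (intro conjI ballI)
    show "bilinear_form T T D"
      unfolding bilinear_form_def by (simp add: T.add_eq T.scale_eq add add' scale') (simp add: D_def)
    have "cmod (D u v) \<le> M * vnorm T u * vnorm T v" if uv: "u \<in> carrier T" "v \<in> carrier T" for u v
    proof -
      have pos: "0 < 1 / real (Suc n)" for n by simp
      have "(\<lambda>n. M * (vnorm T u + 1 / real (Suc n)) * (vnorm T v + 1 / real (Suc n)))
          \<longlonglongrightarrow> M * (vnorm T u + 0) * (vnorm T v + 0)"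
        by (intro tendsto_intros LIMSEQ_Suc[OF lim_1_over_n])
      moreover have "cmod (D u v) \<le> M * (vnorm T u + 1 / real (Suc n)) * (vnorm T v + 1 / real (Suc n))" for n
      proof -
        obtain xs where xs: "valid xs" "u = ts xs" "rep_norm xs < projective_norm A B u + 1 / real (Suc n)"
          using projective_norm_approx[OF uv(1) pos[of n]] .
        obtain ys where ys: "valid ys" "v = ts ys" "rep_norm ys < projective_norm A B v + 1 / real (Suc n)"
          using projective_norm_approx[OF uv(2) pos[of n]] .
        have "cmod (D u v) \<le> M * rep_norm xs * rep_norm ys" unfolding xs ys by (rule bound[OF xs(1) ys(1)])
        also have "\<dots> \<le> M * (projective_norm A B u + 1 / real (Suc n)) * (projective_norm A B v + 1 / real (Suc n))"
          using xs ys rep_norm_nonneg[OF xs(1)] rep_norm_nonneg[OF ys(1)]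
          by (intro mult_mono mult_nonneg_nonneg) (simp_all add: M_def)
        finally show ?thesis by (simp add: algebraic_tensor_def)
      qed
      ultimately show ?thesis by (auto intro: LIMSEQ_le_const)
    qed
    then show "\<exists>C. \<forall>u\<in>carrier T. \<forall>v\<in>carrier T. cmod (D u v) \<le> C * vnorm T u * vnorm T v" by blast
  next
    \<comment> \<open>The failure of the Leibniz rule. It is additive in each argument and vanishes
      on elementary tensors by multiplicativity of \<open>\<phi>\<close>, so it can be eliminated
      one argument at a time.\<close>
    define E where "E u v w = D (amult T u v) w - (D v (amult T w u) + D u (amult T v w))" for u v w
    have E0: "E (e a b) (e a' b') (e x y) = 0"
      if "a \<in> carrier A" "b \<in> carrier B" "a' \<in> carrier A" "b' \<in> carrier B" "x \<in> carrier A" "y \<in> carrier B"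
      for a b a' b' x y
    proof -
      have De: "D (e a b) (e x y) = \<phi> b * \<phi> y * d a x"
        if "a \<in> carrier A" "b \<in> carrier B" "x \<in> carrier A" "y \<in> carrier B" for a b x y
        using ev[of "[(a, b)]" "[(x, y)]"] that by (simp add: elem_tensor_eq del: tensor_sum_simps)
      have "d (amult A a a') x = d a' (amult A x a) + d a (amult A a' x)"
        using d that by (simp add: derivation_form_def)
      then show ?thesis
        using that by (simp add: E_def elem_tensor_mult De A.mult_closed B.mult_closed mult algebra_simps)
    qed
    fix u v w assume uvw: "u \<in> carrier T" "v \<in> carrier T" "w \<in> carrier T"
    note Eadd = E_def T.mult_add_left T.mult_add_right add add' T.mult_closed
    have E1: "E (e a b) (e a' b') w = 0"
      if "a \<in> carrier A" "b \<in> carrier B" "a' \<in> carrier A" "b' \<in> carrier B" for a b a' b'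
      by (rule tensor_additive_zero[of "E (e a b) (e a' b')"])
        (use that uvw in \<open>auto simp: E0 elem_tensor_closed\<close>, simp add: Eadd elem_tensor_closed)
    have E2: "E (e a b) v w = 0" if "a \<in> carrier A" "b \<in> carrier B" for a b
      by (rule tensor_additive_zero[of "\<lambda>v. E (e a b) v w"])
        (use that uvw in \<open>auto simp: E1 elem_tensor_closed\<close>, simp add: Eadd elem_tensor_closed)
    have "E u v w = 0"
      by (rule tensor_additive_zero[of "\<lambda>u. E u v w"]) (use uvw in \<open>auto simp: E2\<close>, simp add: Eadd)
    then show "D (amult T u v) w = D v (amult T w u) + D u (amult T v w)" by (simp add: E_def)
  qed
  \<comment> \<open>At these tensors \<open>D\<close> equals the square of \<phi>(b0) times
    \<open>d a x\<close>, and the square is nonzero.\<close>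
  then have "D (e a b0) (e x b0) = 0" using wa' elem_tensor_closed ax b0 by blast
  then have "\<phi> b0 * \<phi> b0 * d a x = 0"
    using ev[of "[(a, b0)]" "[(x, b0)]"] ax b0 by (simp add: elem_tensor_eq del: tensor_sum_simps)
  then show "d a x = 0" using b0 by simp
qed

text \<open>The flip \<open>\<sigma>\<close> of a \<otimes> b to b \<otimes> a is precomposition
  with transposing a form. A derivation form is pulled back along it: \<open>\<sigma>\<close> is
  multiplicative and contractive, and surjectivity returns the vanishing to all of
  \<open>BA.T\<close>.\<close>

theorem weakly_amenable_tensor_swap:
  assumes wa: "weakly_amenable (A \<otimes>\<^sub>\<pi> B)"
  shows "weakly_amenable (B \<otimes>\<^sub>\<pi> A)"
proof -
  interpret BA: comm_algebra_pair B A ..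
  define \<sigma> where "\<sigma> u = (\<lambda>\<beta>. u (\<lambda>a b. \<beta> b a))" for u :: "('a \<Rightarrow> 'b \<Rightarrow> complex) \<Rightarrow> complex"
    and \<beta> :: "'b \<Rightarrow> 'a \<Rightarrow> complex"
  have bil: "bilinear_form B A \<beta> \<longleftrightarrow> bilinear_form A B (\<lambda>a b. \<beta> b a)" for \<beta>
    unfolding bilinear_form_def by blast
  have \<sigma>_ts: "\<sigma> (ts xs) = BA.ts (map prod.swap xs)" for xs
    by (induction xs) (auto simp: \<sigma>_def fun_eq_iff elem_tensor_def bil)
  have valid_swap: "BA.valid (map prod.swap xs) \<longleftrightarrow> valid xs" for xs
    by auto
  have \<sigma>_carrier: "\<sigma> u \<in> carrier BA.T" if "u \<in> carrier T" for u
    using that valid_swap \<sigma>_ts unfolding carrier_T BA.carrier_T by blast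
  have \<sigma>_norm: "vnorm BA.T (\<sigma> u) \<le> vnorm T u" if "u \<in> carrier T" for u
  proof -
    have "projective_norm B A (\<sigma> u) \<le> projective_norm A B u"
    proof (rule projective_norm_ge[OF that])
      fix xs assume xs: "valid xs" "u = ts xs"
      have "BA.rep_norm (map prod.swap xs) = rep_norm xs" by (induction xs) auto
      then show "projective_norm B A (\<sigma> u) \<le> rep_norm xs"
        using BA.projective_norm_le[of "map prod.swap xs"] xs(1) by (simp add: xs(2) \<sigma>_ts valid_swap del: set_map)
    qed
    then show ?thesis by (simp add: algebraic_tensor_def)
  qed
  have \<sigma>_mult: "\<sigma> (amult T u v) = amult BA.T (\<sigma> u) (\<sigma> v)" if uv: "u \<in> carrier T" "v \<in> carrier T" for u v
  proof -
    obtain xs ys where xs: "valid xs" "u = ts xs" and ys: "valid ys" "v = ts ys"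
      using uv unfolding carrier_T by blast
    have "map prod.swap (rep_mult xs ys) = BA.rep_mult (map prod.swap xs) (map prod.swap ys)"
      by (induction xs) (auto simp: rep_mult_def BA.rep_mult_def o_def case_prod_unfold)
    then show ?thesis
      using BA.tensor_mult_sum[of "map prod.swap xs" "map prod.swap ys"] xs(1) ys(1)
      by (simp add: xs(2) ys(2) algebraic_tensor_def tensor_mult_sum \<sigma>_ts valid_swap del: set_map)
  qed
  show ?thesis
    unfolding projective_tensor_def BA.T.weakly_amenable_completion
  proof (intro allI impI)
    fix d assume d: "derivation_form BA.T d"
    have d_add: "d (\<lambda>\<beta>. u \<beta> + u' \<beta>) w = d u w + d u' w" "d w (\<lambda>\<beta>. u \<beta> + u' \<beta>) = d w u + d w u'"
      if "u \<in> carrier BA.T" "u' \<in> carrier BA.T" "w \<in> carrier BA.T" for u u' w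
      using d that by (auto simp: derivation_form_def bilinear_form_def BA.T.add_eq)
    have d_scale: "d (\<lambda>\<beta>. c * u \<beta>) w = c * d u w" "d w (\<lambda>\<beta>. c * u \<beta>) = c * d w u"
      if "u \<in> carrier BA.T" "w \<in> carrier BA.T" for u w c
      using d that by (auto simp: derivation_form_def bilinear_form_def BA.T.scale_eq)
    obtain K where K: "\<And>u v. u \<in> carrier BA.T \<Longrightarrow> v \<in> carrier BA.T \<Longrightarrow>
        cmod (d u v) \<le> K * vnorm BA.T u * vnorm BA.T v"
      using d unfolding derivation_form_def by blast
    have bd: "cmod (d (\<sigma> u) (\<sigma> v)) \<le> \<bar>K\<bar> * vnorm T u * vnorm T v" if uv: "u \<in> carrier T" "v \<in> carrier T" for u v
    proof -
      have "cmod (d (\<sigma> u) (\<sigma> v)) \<le> K * vnorm BA.T (\<sigma> u) * vnorm BA.T (\<sigma> v)"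
        by (intro K \<sigma>_carrier uv)
      also have "\<dots> \<le> \<bar>K\<bar> * vnorm T u * vnorm T v"
        by (intro mult_mono \<sigma>_norm uv mult_nonneg_nonneg BA.T.norm_nonneg T.norm_nonneg \<sigma>_carrier) auto
      finally show ?thesis .
    qed
    have der: "d (amult BA.T u v) w = d v (amult BA.T w u) + d u (amult BA.T v w)"
      if "u \<in> carrier BA.T" "v \<in> carrier BA.T" "w \<in> carrier BA.T" for u v w
      using d that by (simp add: derivation_form_def)
    have "bilinear_form T T (\<lambda>u v. d (\<sigma> u) (\<sigma> v))"
      unfolding bilinear_form_def T.add_eq T.scale_eq
      using d_add d_scale \<sigma>_carrier by (simp add: \<sigma>_def)
    moreover have "\<exists>C. \<forall>a\<in>carrier T. \<forall>x\<in>carrier T. cmod (d (\<sigma> a) (\<sigma> x)) \<le> C * vnorm T a * vnorm T x"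
      using bd by blast
    ultimately have "derivation_form T (\<lambda>u v. d (\<sigma> u) (\<sigma> v))"
      unfolding derivation_form_def by (simp add: \<sigma>_mult der \<sigma>_carrier)
    then have zero: "d (\<sigma> u) (\<sigma> v) = 0" if "u \<in> carrier T" "v \<in> carrier T" for u v
      using wa that unfolding projective_tensor_def T.weakly_amenable_completion by blast
    have surj: "\<exists>v\<in>carrier T. u = \<sigma> v" if u: "u \<in> carrier BA.T" for u
    proof -
      obtain xs where xs: "BA.valid xs" "u = BA.ts xs" using u unfolding BA.carrier_T by blast
      have "u = \<sigma> (ts (map prod.swap xs))" by (simp add: \<sigma>_ts xs(2))
      moreover have "valid (map prod.swap xs)" using xs(1) by auto
      ultimately show ?thesis unfolding carrier_T by blast
    qed
    show "\<forall>u\<in>carrier BA.T. \<forall>v\<in>carrier BA.T. d u v = 0"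
      using surj zero by metis
  qed
qed

end

section \<open>Topological groups\<close>

lemma continuous_left_translation: "continuous_on A (\<lambda>x. g + x :: 'g::topological_group_add)"
  and continuous_right_translation: "continuous_on A (\<lambda>x. x + g :: 'g::topological_group_add)"
  and continuous_uminus: "continuous_on A (\<lambda>x. - x :: 'g::topological_group_add)"
  and continuous_conj: "continuous_on A (\<lambda>x. - g + x + g :: 'g::topological_group_add)"
  by (auto simp: continuous_on_def intro!: tendsto_intros)

lemma open_left_translate: "open U \<Longrightarrow> open ((+) g ` U)" for g :: "'g::topological_group_add"
proof -
  assume U: "open U"
  have "(+) g ` U = (\<lambda>x. - g + x) -` U"
    by (auto simp: image_iff add.assoc[symmetric] intro!: bexI[of _ "- g + _"])
  then show ?thesis using open_vimage[OF U continuous_left_translation[of UNIV "- g"]] by simp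
qed

lemma ex_symmetric_nbhd:
  fixes U :: "'g::topological_group_add set"
  assumes "open U" "0 \<in> U"
  shows "\<exists>V. open V \<and> 0 \<in> V \<and> (\<forall>v\<in>V. - v \<in> V) \<and> (\<forall>v\<in>V. \<forall>w\<in>V. v + w \<in> U)"
proof -
  have "continuous_on UNIV (\<lambda>p::'g \<times> 'g. fst p + snd p)"
    by (intro continuous_intros)
  then have "open ((\<lambda>p::'g \<times> 'g. fst p + snd p) -` U)" by (rule open_vimage[OF assms(1)])
  moreover have "(0, 0) \<in> (\<lambda>p::'g \<times> 'g. fst p + snd p) -` U" using assms by simp
  ultimately obtain A B where AB: "open A" "open B" "0 \<in> A" "0 \<in> B"
      "A \<times> B \<subseteq> (\<lambda>p. fst p + snd p) -` U"
    by (auto elim!: open_prod_elim)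
  define V where "V = (A \<inter> B) \<inter> uminus -` (A \<inter> B)"
  have "open V" unfolding V_def
    by (intro open_Int AB open_vimage[OF _ continuous_uminus])
  then show ?thesis
    using AB by (intro exI[of _ V]) (auto simp: V_def)
qed

text \<open>The tube lemma around {0} \<times> K. It gives one neighbourhood that works uniformly
  for all points of \<open>K\<close>.\<close>

lemma compact_nbhd_left:
  fixes K U :: "'g::topological_group_add set"
  assumes "compact K" "open U" "K \<subseteq> U"
  shows "\<exists>V. open V \<and> 0 \<in> V \<and> (\<forall>v\<in>V. \<forall>k\<in>K. v + k \<in> U)"
proof -
  have "continuous_on UNIV (\<lambda>p::'g \<times> 'g. fst p + snd p)"
    by (intro continuous_intros)
  then have a: "open ((\<lambda>p::'g \<times> 'g. fst p + snd p) -` U)" by (rule open_vimage[OF assms(2)])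
  have b: "{0} \<times> K \<subseteq> (\<lambda>p::'g \<times> 'g. fst p + snd p) -` U" using assms by auto
  obtain V where V: "0 \<in> V" "open V" "V \<times> K \<subseteq> (\<lambda>p. fst p + snd p) -` U"
    using Elementary_Topology.tube_lemma[OF assms(1) a b] by blast
  have "v + k \<in> U" if "v \<in> V" "k \<in> K" for v k
    using subsetD[OF V(3), of "(v, k)"] that by simp
  then show ?thesis using V by blast
qed

lemma compact_nbhd_right:
  fixes K U :: "'g::topological_group_add set"
  assumes "compact K" "open U" "K \<subseteq> U"
  shows "\<exists>V. open V \<and> 0 \<in> V \<and> (\<forall>v\<in>V. \<forall>k\<in>K. k + v \<in> U)"
proof -
  have "continuous_on UNIV (\<lambda>p::'g \<times> 'g. snd p + fst p)"
    by (intro continuous_intros)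
  then have a: "open ((\<lambda>p::'g \<times> 'g. snd p + fst p) -` U)" by (rule open_vimage[OF assms(2)])
  have b: "{0} \<times> K \<subseteq> (\<lambda>p::'g \<times> 'g. snd p + fst p) -` U" using assms by auto
  obtain V where V: "0 \<in> V" "open V" "V \<times> K \<subseteq> (\<lambda>p. snd p + fst p) -` U"
    using Elementary_Topology.tube_lemma[OF assms(1) a b] by blast
  have "k + v \<in> U" if "v \<in> V" "k \<in> K" for v k
    using subsetD[OF V(3), of "(v, k)"] that by simp
  then show ?thesis using V by blast
qed

lemma compact_finite_translates:
  fixes K W :: "'g::topological_group_add set"
  assumes K: "compact K" and W: "open W" "0 \<in> W"
  shows "\<exists>Y. finite Y \<and> Y \<subseteq> K \<and> (\<forall>x\<in>K. \<exists>y\<in>Y. x - y \<in> W)"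
proof -
  have op: "\<forall>B\<in>(\<lambda>y. (\<lambda>x. x + - y) -` W) ` K. open B"
    using open_vimage[OF W(1) continuous_right_translation] by blast
  have "K \<subseteq> (\<Union>y\<in>K. (\<lambda>x. x + - y) -` W)" using W by auto
  then obtain Z where Z: "Z \<subseteq> K" "finite Z" "K \<subseteq> (\<Union>y\<in>Z. (\<lambda>x. x + - y) -` W)"
    using compactE_image[OF K, of K "\<lambda>y. (\<lambda>x. x + - y) -` W"] op by auto
  then show ?thesis by (intro exI[of _ Z]) auto
qed

text \<open>On such a subgroup Haar measure is \<sigma>-finite, and being open it has Haar measure
  by mere restriction. Integrals involving finitely many integrable functions will be computed
  there.\<close>

definition open_sigma_subgroup :: "'g::topological_group_add set \<Rightarrow> bool" where
  "open_sigma_subgroup H \<longleftrightarrow> open H \<and> 0 \<in> H \<and> (\<forall>x\<in>H. \<forall>y\<in>H. x - y \<in> H) \<and>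
     (\<exists>C :: nat \<Rightarrow> 'g set. (\<forall>n. compact (C n)) \<and> H = (\<Union>n. C n))"

text \<open>Each stage \<open>P (Suc n)\<close> adjoins \<open>C n\<close> and takes differences
  once. The stages are compact and increasing, so their union is \<sigma>-compact and closed under
  differences.\<close>

lemma ex_open_sigma_subgroup:
  fixes W :: "'g::topological_group_add set" and C :: "nat \<Rightarrow> 'g set"
  assumes W: "compact W" "0 \<in> interior W" and C: "\<And>n. compact (C n)"
  shows "\<exists>H. open_sigma_subgroup H \<and> (\<Union>n. C n) \<subseteq> H"
proof -
  define P where "P = rec_nat W (\<lambda>n A. (\<lambda>p. fst p - snd p) ` ((A \<union> C n) \<times> (A \<union> C n)))"
  have P_simps: "P 0 = W" "P (Suc n) = (\<lambda>p. fst p - snd p) ` ((P n \<union> C n) \<times> (P n \<union> C n))" for n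
    by (simp_all add: P_def)
  have diffI: "x - y \<in> P (Suc n)" if "x \<in> P n \<union> C n" "y \<in> P n \<union> C n" for x y n
    using that unfolding P_simps by force
  have zero: "0 \<in> P n" for n
  proof (induction n)
    case 0 then show ?case using W interior_subset by (auto simp: P_simps)
  next
    case (Suc n) then show ?case using diffI[of 0 n 0] by simp
  qed
  have step: "P n \<union> C n \<subseteq> P (Suc n)" for n
    using diffI[of _ n 0] zero[of n] by auto
  have mono: "P m \<subseteq> P n" if "m \<le> n" for m n
    using that step lift_Suc_mono_le[of P] by blast
  have compact: "compact (P n)" for n
  proof (induction n)
    case 0 then show ?case using W by (simp add: P_simps)
  next
    case (Suc n)
    have "continuous_on ((P n \<union> C n) \<times> (P n \<union> C n)) (\<lambda>p::'g \<times> 'g. fst p - snd p)"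
      unfolding diff_conv_add_uminus
      by (intro continuous_on_add continuous_on_compose2[OF continuous_uminus[of UNIV]] continuous_intros) auto
    then show ?case unfolding P_simps
      by (intro compact_continuous_image compact_Times compact_Un Suc C)
  qed
  define H where "H = (\<Union>n. P n)"
  have diff: "x - y \<in> H" if xy: "x \<in> H" "y \<in> H" for x y
  proof -
    obtain m n where "x \<in> P m" "y \<in> P n" using xy by (auto simp: H_def)
    then have "x \<in> P (max m n)" "y \<in> P (max m n)" using mono[of m "max m n"] mono[of n "max m n"] by auto
    then show ?thesis using diffI[of x "max m n" y] unfolding H_def by blast
  qed
  have 0: "0 \<in> H" using zero by (auto simp: H_def)
  have add: "x + y \<in> H" if "x \<in> H" "y \<in> H" for x y
    using diff[OF that(1) diff[OF 0 that(2)]] by simp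
  \<comment> \<open>A subgroup that contains a neighbourhood of \<open>0\<close> is a union of open
    translates of it; here the neighbourhood is the interior of stage \<open>0\<close>.\<close>
  have "H = (\<Union>x\<in>H. (+) x ` interior W)"
  proof (intro equalityI subsetI)
    fix x assume "x \<in> H"
    moreover have "x \<in> (+) x ` interior W" using W by (force intro: image_eqI[of _ _ 0])
    ultimately show "x \<in> (\<Union>x\<in>H. (+) x ` interior W)" by blast
  next
    fix z assume "z \<in> (\<Union>x\<in>H. (+) x ` interior W)"
    moreover have "interior W \<subseteq> H" using interior_subset[of W] P_simps(1) by (auto simp: H_def)
    ultimately show "z \<in> H" using add by blast
  qed
  then have "open H" using open_left_translate[OF open_interior] by (metis (no_types, lifting) open_UN)
  moreover have "(\<Union>n. C n) \<subseteq> H" using step by (auto simp: H_def)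
  moreover have "\<exists>C. (\<forall>n::nat. compact (C n)) \<and> H = (\<Union>n. C n)"
    by (rule exI[of _ P]) (simp add: compact H_def)
  ultimately show ?thesis
    using 0 diff by (intro exI[of _ H]) (simp add: open_sigma_subgroup_def)
qed


section \<open>Haar measures\<close>

locale haar =
  fixes \<mu> :: "'g::{topological_group_add, t2_space} measure"
  assumes haar: "left_haar_measure \<mu>"
begin

lemma sets_mu [simp, measurable_cong]: "sets \<mu> = sets borel"
  using haar by (simp add: left_haar_measure_def)

lemma space_mu [simp]: "space \<mu> = UNIV"
  using sets_eq_imp_space_eq[OF sets_mu] by simp

lemma borel_left_translation [measurable]: "(\<lambda>x. g + x :: 'g) \<in> borel_measurable borel"
  by (intro borel_measurable_continuous_onI continuous_left_translation)

lemma borel_right_translation [measurable]: "(\<lambda>x. x + g :: 'g) \<in> borel_measurable borel"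
  by (intro borel_measurable_continuous_onI continuous_right_translation)

lemma borel_uminus [measurable]: "(\<lambda>x. - x :: 'g) \<in> borel_measurable borel"
  by (intro borel_measurable_continuous_onI continuous_uminus)

lemma emeasure_translate:
  assumes "E \<in> sets borel"
  shows "emeasure \<mu> ((\<lambda>x. g + x) -` E) = emeasure \<mu> E"
proof -
  have "(\<lambda>x. g + x) -` E = (\<lambda>x. - g + x) ` E"
    by (auto simp: image_iff add.assoc[symmetric] intro!: bexI[of _ "g + _"])
  then show ?thesis using haar assms by (simp add: left_haar_measure_def)
qed

lemma distr_translate: "distr \<mu> borel (\<lambda>x. g + x) = \<mu>"
  by (rule measure_eqI) (auto simp: emeasure_distr emeasure_translate)

lemma emeasure_compact_finite: "compact K \<Longrightarrow> emeasure \<mu> K < \<infinity>"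
  using haar by (simp add: left_haar_measure_def)

lemma outer_regular:
  assumes "E \<in> sets borel"
  shows "emeasure \<mu> E = (INF U\<in>{U. open U \<and> E \<subseteq> U}. emeasure \<mu> U)"
  using haar assms unfolding left_haar_measure_def by blast

lemma inner_regular:
  assumes "open U"
  shows "emeasure \<mu> U = (SUP K\<in>{K. compact K \<and> K \<subseteq> U}. emeasure \<mu> K)"
  using haar assms unfolding left_haar_measure_def by blast

lemma outer_approx:
  assumes "E \<in> sets borel" "emeasure \<mu> E < c"
  obtains U where "open U" "E \<subseteq> U" "emeasure \<mu> U < c"
  using assms(2) that unfolding outer_regular[OF assms(1)] INF_less_iff by blast

lemma inner_approx:
  assumes "open U" "c < emeasure \<mu> U"
  obtains K where "compact K" "K \<subseteq> U" "c < emeasure \<mu> K"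
  using assms(2) that unfolding inner_regular[OF assms(1)] less_SUP_iff by blast

text \<open>A supremum in \<open>ennreal\<close> is attained along a sequence, so countably many
  compact subsets exhaust a set of finite measure up to a null set.\<close>

lemma open_inner_seq:
  assumes U: "open U" "emeasure \<mu> U < \<infinity>"
  shows "\<exists>K :: nat \<Rightarrow> 'g set. (\<forall>n. compact (K n) \<and> K n \<subseteq> U) \<and> U - (\<Union>n. K n) \<in> null_sets \<mu>"
proof -
  have "{K. compact K \<and> K \<subseteq> U} \<noteq> {}" by auto
  from ennreal_SUP_countable_SUP[OF this, of "emeasure \<mu>"] obtain f :: "nat \<Rightarrow> ennreal"
    where f: "range f \<subseteq> emeasure \<mu> ` {K. compact K \<and> K \<subseteq> U}" "emeasure \<mu> U = (SUP n. f n)"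
    unfolding inner_regular[OF U(1)] by auto
  then have "\<forall>n. \<exists>K. compact K \<and> K \<subseteq> U \<and> f n = emeasure \<mu> K" by auto
  then obtain K where K: "\<And>n. compact (K n) \<and> K n \<subseteq> U \<and> f n = emeasure \<mu> (K n)" by metis
  have b: "(\<Union>n. K n) \<in> sets borel" using K by (intro sets.countable_UN) (auto intro!: borel_closed compact_imp_closed)
  have sub: "(\<Union>n. K n) \<subseteq> U" using K by blast
  have "emeasure \<mu> U \<le> emeasure \<mu> (\<Union>n. K n)"
    unfolding f(2)
  proof (rule SUP_least)
    fix n
    have "K n \<subseteq> (\<Union>n. K n)" by blast
    then show "f n \<le> emeasure \<mu> (\<Union>n. K n)" using K[of n] b by (simp add: emeasure_mono)
  qed
  moreover have "emeasure \<mu> (\<Union>n. K n) \<le> emeasure \<mu> U" using sub U by (intro emeasure_mono) auto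
  ultimately have "emeasure \<mu> (U - (\<Union>n. K n)) = 0"
    using emeasure_Diff[of \<mu> "\<Union>n. K n" U] U sub b
      antisym[of "emeasure \<mu> U" "emeasure \<mu> (\<Union>n. K n)"] by (simp add: ennreal_diff_self)
  then have "U - (\<Union>n. K n) \<in> null_sets \<mu>" using b U by (auto simp: null_sets_def)
  then show ?thesis using K by blast
qed

text \<open>Finitely many translates of \<open>U\<close> cover any compact set. If \<open>U\<close>
  were null, all compact sets would be null, and by inner regularity so would the whole
  group.\<close>

lemma emeasure_open_pos:
  assumes "open U" "U \<noteq> {}"
  shows "emeasure \<mu> U > 0"
proof (rule ccontr)
  assume "\<not> emeasure \<mu> U > 0"
  then have U0: "emeasure \<mu> U = 0" by simp
  obtain u where "u \<in> U" using assms by blast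
  have "0 < emeasure \<mu> UNIV" using haar unfolding left_haar_measure_def zero_less_iff_neq_zero by blast
  then obtain K where K: "compact K" "0 < emeasure \<mu> K" using inner_approx[OF open_UNIV] by metis
  have op: "open ((\<lambda>x. g + x) -` U)" for g
    by (rule open_vimage[OF assms(1) continuous_left_translation])
  have "K \<subseteq> (\<Union>k\<in>K. (\<lambda>x. (u - k) + x) -` U)" using \<open>u \<in> U\<close> by auto
  then obtain Z where Z: "Z \<subseteq> K" "finite Z" "K \<subseteq> (\<Union>k\<in>Z. (\<lambda>x. (u - k) + x) -` U)"
    using compactE_image[OF K(1), of K "\<lambda>k. (\<lambda>x. (u - k) + x) -` U"] op by blast
  have "emeasure \<mu> K \<le> emeasure \<mu> (\<Union>k\<in>Z. (\<lambda>x. (u - k) + x) -` U)"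
    using Z op by (intro emeasure_mono) auto
  also have "\<dots> \<le> (\<Sum>k\<in>Z. emeasure \<mu> ((\<lambda>x. (u - k) + x) -` U))"
    using Z op by (intro emeasure_subadditive_finite) auto
  also have "\<dots> = 0" using U0 assms by (simp add: emeasure_translate)
  finally show False using K by simp
qed

end

section \<open>Haar measure on an open \<sigma>-compact subgroup and the measurability of
  addition\<close>

locale haar_subgroup = haar \<mu> for \<mu> :: "'g::{topological_group_add, t2_space} measure" +
  fixes H :: "'g set"
  assumes H: "open_sigma_subgroup H"
begin

lemma open_H: "open H" and zero_H: "0 \<in> H" and diff_H: "x \<in> H \<Longrightarrow> y \<in> H \<Longrightarrow> x - y \<in> H"
  using H by (auto simp: open_sigma_subgroup_def)

lemma uminus_H: "x \<in> H \<Longrightarrow> - x \<in> H"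
  using diff_H[OF zero_H] by simp

lemma add_H: "x \<in> H \<Longrightarrow> y \<in> H \<Longrightarrow> x + y \<in> H"
  using diff_H[OF _ uminus_H] by fastforce

lemma H_borel [measurable, simp]: "H \<in> sets borel"
  using open_H by simp

definition N :: "'g measure" where "N = restrict_space \<mu> H"

lemma space_N [simp]: "space N = H"
  by (simp add: N_def space_restrict_space)

lemma sets_N: "sets N = sets (restrict_space borel H)"
  unfolding N_def by (rule sets_restrict_space_cong[OF sets_mu])

lemma sets_N_iff: "A \<in> sets N \<longleftrightarrow> A \<in> sets borel \<and> A \<subseteq> H"
  by (auto simp: N_def sets_restrict_space_iff)

lemma measurable_N: "f \<in> measurable borel M \<Longrightarrow> f \<in> measurable N M"
  unfolding N_def by (intro measurable_restrict_space1) simp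

lemma measurable_into_N:
  "f \<in> measurable M borel \<Longrightarrow> (\<And>x. x \<in> space M \<Longrightarrow> f x \<in> H) \<Longrightarrow> f \<in> measurable M N"
  by (subst measurable_cong_sets[OF refl sets_N]) (auto intro!: measurable_restrict_space2)

text \<open>When the topology of \<open>H\<close> has no countable base, the Borel sets of \<open>H \<times> H\<close> need not lie in the
  product \<open>\<sigma>\<close>-algebra.  Convolution is therefore studied on the \<open>\<sigma>\<close>-algebra of those sets whose
  preimage under addition does; up to null sets it contains all Borel sets.\<close>

definition product_sets :: "'g set set" where
  "product_sets = {E\<in>sets borel. {p\<in>H \<times> H. fst p + snd p \<in> E} \<in> sets (N \<Otimes>\<^sub>M N)}"

text \<open>Only its measurable sets are of interest: measurability of \<open>f\<close> for
  \<open>PB\<close> makes f(y + x) jointly measurable on the square of the subgroup.\<close>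

definition PB :: "'g measure" where "PB = sigma UNIV product_sets"

lemma sigma_algebra_product_sets: "sigma_algebra UNIV product_sets"
  unfolding sigma_algebra_iff2
proof (intro conjI ballI allI impI)
  have HH: "H \<times> H \<in> sets (N \<Otimes>\<^sub>M N)" using sets.top[of "N \<Otimes>\<^sub>M N"] by (simp add: space_pair_measure)
  show "{} \<in> product_sets" by (simp add: product_sets_def)
  fix E assume E: "E \<in> product_sets"
  have "{p\<in>H \<times> H. fst p + snd p \<in> UNIV - E} = H \<times> H - {p\<in>H \<times> H. fst p + snd p \<in> E}" by auto
  moreover have "E \<in> sets borel" using E by (simp add: product_sets_def)
  then have "UNIV - E \<in> sets borel" using sets.compl_sets[of E borel] by (simp only: space_borel)
  ultimately show "UNIV - E \<in> product_sets"
    using E sets.Diff[OF HH, of "{p\<in>H \<times> H. fst p + snd p \<in> E}"] by (simp add: product_sets_def)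
next
  fix A :: "nat \<Rightarrow> 'g set" assume A: "range A \<subseteq> product_sets"
  have "{p\<in>H \<times> H. fst p + snd p \<in> (\<Union>i. A i)} = (\<Union>i. {p\<in>H \<times> H. fst p + snd p \<in> A i})" by auto
  also have "\<dots> \<in> sets (N \<Otimes>\<^sub>M N)"
    using A by (intro sets.countable_UN) (auto simp: product_sets_def)
  finally show "(\<Union>i. A i) \<in> product_sets" using A by (auto simp: product_sets_def)
qed simp

lemma space_PB [simp]: "space PB = UNIV"
  by (simp add: PB_def)

lemma sets_PB: "sets PB = product_sets"
  unfolding PB_def using sigma_algebra.sigma_sets_eq[OF sigma_algebra_product_sets] by simp

lemma PB_borel: "f \<in> measurable PB M \<Longrightarrow> f \<in> measurable borel M"
  by (auto simp: measurable_def sets_PB product_sets_def)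

lemma measurable_add_PB [measurable]: "(\<lambda>p. fst p + snd p) \<in> measurable (N \<Otimes>\<^sub>M N) PB"
proof (rule measurableI)
  fix E assume "E \<in> sets PB"
  moreover have "(\<lambda>p. fst p + snd p) -` E \<inter> space (N \<Otimes>\<^sub>M N) = {p\<in>H \<times> H. fst p + snd p \<in> E}"
    by (auto simp: space_pair_measure)
  ultimately show "(\<lambda>p. fst p + snd p) -` E \<inter> space (N \<Otimes>\<^sub>M N) \<in> sets (N \<Otimes>\<^sub>M N)"
    by (simp add: sets_PB product_sets_def)
qed simp

lemma measurable_uminus_N [measurable]: "uminus \<in> measurable N N"
  by (rule measurable_into_N) (auto intro: measurable_N uminus_H)

lemma measurable_add_PB' [measurable]:
  assumes [measurable]: "f \<in> measurable M N" "g \<in> measurable M N"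
  shows "(\<lambda>x. f x + g x) \<in> measurable M PB"
  using measurable_compose[OF measurable_Pair[OF assms] measurable_add_PB] by simp

lemma measurable_diff_PB [measurable]:
  assumes [measurable]: "f \<in> measurable M N" "g \<in> measurable M N"
  shows "(\<lambda>x. f x - g x) \<in> measurable M PB"
proof -
  have "(\<lambda>x. - g x) \<in> measurable M N" by measurable
  from measurable_add_PB'[OF assms(1) this] show ?thesis by simp
qed

lemma H_countable_translates:
  assumes "open W" "0 \<in> W"
  shows "\<exists>Y. countable Y \<and> (\<forall>x\<in>H. \<exists>y\<in>Y. x - y \<in> W)"
proof -
  obtain C :: "nat \<Rightarrow> 'g set" where C: "\<And>n. compact (C n)" "H = (\<Union>n. C n)"
    using H by (auto simp: open_sigma_subgroup_def)
  obtain Y where Y: "\<And>n. finite (Y n)" "\<And>n x. x \<in> C n \<Longrightarrow> \<exists>y\<in>Y n. x - y \<in> W"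
    using compact_finite_translates[OF C(1) assms] by metis
  have "countable (\<Union>n. Y n)" using Y(1) by (intro countable_UN) (auto intro: countable_finite)
  then show ?thesis using Y(2) C(2) by (intro exI[of _ "\<Union>n. Y n"]) blast
qed

text \<open>The set is \<open>\<Inter>n. W n + K\<close> for shrinking neighbourhoods \<open>W n\<close> of \<open>0\<close>: replacing the left
  summand of \<open>h + x\<close> by a nearby element of a countable set only moves between consecutive stages.\<close>

lemma product_set_between:
  assumes K: "compact K" and U: "open U" and KU: "K \<subseteq> U"
  shows "\<exists>E\<in>product_sets. K \<subseteq> E \<and> E \<subseteq> U"
proof -
  obtain V where V: "open V" "0 \<in> V" "\<And>v k. v \<in> V \<Longrightarrow> k \<in> K \<Longrightarrow> v + k \<in> U"
    using compact_nbhd_left[OF assms] by blast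
  let ?sym = "\<lambda>W::'g set. open W \<and> 0 \<in> W \<and> (\<forall>w\<in>W. - w \<in> W)"
  \<comment> \<open>A shrinking chain of symmetric neighbourhoods inside \<open>V\<close> in which
    the sum of two elements of one member lies in the member before it.\<close>
  have "\<exists>W. \<forall>n. (?sym (W n) \<and> (n = (0::nat) \<longrightarrow> W n \<subseteq> V)) \<and> (\<forall>v\<in>W (Suc n). \<forall>w\<in>W (Suc n). v + w \<in> W n)"
    proof (rule dependent_nat_choice)
      obtain W where "?sym W" "\<forall>v\<in>W. \<forall>w\<in>W. v + w \<in> V" using ex_symmetric_nbhd[OF V(1,2)] by blast
      then show "\<exists>W. ?sym W \<and> ((0::nat) = 0 \<longrightarrow> W \<subseteq> V)" by (intro exI[of _ W]) force
    next
      fix W and n :: nat assume "?sym W \<and> (n = 0 \<longrightarrow> W \<subseteq> V)"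
      then show "\<exists>W'. (?sym W' \<and> (Suc n = 0 \<longrightarrow> W' \<subseteq> V)) \<and> (\<forall>v\<in>W'. \<forall>w\<in>W'. v + w \<in> W)"
        using ex_symmetric_nbhd[of W] by auto
    qed
  then obtain W where Wall:
      "\<forall>n. (?sym (W n) \<and> (n = (0::nat) \<longrightarrow> W n \<subseteq> V)) \<and> (\<forall>v\<in>W (Suc n). \<forall>w\<in>W (Suc n). v + w \<in> W n)"
    by (elim exE)
  have W: "?sym (W n) \<and> (n = 0 \<longrightarrow> W n \<subseteq> V)" "\<forall>v\<in>W (Suc n). \<forall>w\<in>W (Suc n). v + w \<in> W n" for n
    using Wall by simp_all
  have W_zero: "0 \<in> W n" and W_open: "open (W n)" and W_sym: "w \<in> W n \<Longrightarrow> - w \<in> W n" for n w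
    using W(1) by auto
  have W_mono: "W (Suc n) \<subseteq> W n" for n
    using W(2)[of n] W_zero[of "Suc n"] by force
  define A where "A n = {w + k | w k. w \<in> W n \<and> k \<in> K}" for n
  have A_open: "open (A n)" for n
  proof -
    have "A n = (\<Union>k\<in>K. (\<lambda>x. x + - k) -` W n)"
    proof (intro equalityI subsetI)
      fix x assume "x \<in> (\<Union>k\<in>K. (\<lambda>x. x + - k) -` W n)"
      then obtain k where k: "k \<in> K" "x - k \<in> W n" by auto
      then have "x = (x - k) + k" by simp
      with k show "x \<in> A n" unfolding A_def by blast
    next
      fix x assume "x \<in> A n"
      then obtain w k where "w \<in> W n" "k \<in> K" "x = w + k" unfolding A_def by blast
      then show "x \<in> (\<Union>k\<in>K. (\<lambda>x. x + - k) -` W n)"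
        by (intro UN_I[of k]) (simp_all add: add.assoc del: add_uminus_conv_diff)
    qed
    then show ?thesis
      using open_vimage[OF W_open continuous_right_translation] by (simp only:) (intro open_UN ballI)
  qed
  have KA: "K \<subseteq> A n" for n using W_zero[of n] by (force simp: A_def)
  have AU: "A 0 \<subseteq> U" using V(3) W(1)[of 0] by (auto simp: A_def)
  define E where "E = (\<Inter>n. A n)"
  have E_borel: "E \<in> sets borel" unfolding E_def using A_open by (intro sets.countable_INT) auto
  have "\<exists>Y. countable Y \<and> (\<forall>x\<in>H. \<exists>y\<in>Y. x - y \<in> W (Suc n))" for n
    by (rule H_countable_translates[OF W_open W_zero])
  then obtain Y where Y: "\<And>n. countable (Y n)" "\<And>n x. x \<in> H \<Longrightarrow> \<exists>y\<in>Y n. x - y \<in> W (Suc n)"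
    by metis
  \<comment> \<open>Membership of h + x becomes a countable combination of rectangles:
    \<open>h\<close> is within \<open>W (Suc n)\<close> of some \<open>y\<close> in a countable set,
    and y + x is tested in place of h + x.\<close>
  have "{p\<in>H \<times> H. fst p + snd p \<in> E} = (\<Inter>n. \<Union>y\<in>Y n. {h\<in>H. h + - y \<in> W (Suc n)} \<times> {x\<in>H. y + x \<in> A n})"
  proof (intro equalityI subsetI)
    fix p assume p: "p \<in> {p\<in>H \<times> H. fst p + snd p \<in> E}"
    obtain h x where hx: "p = (h, x)" "h \<in> H" "x \<in> H" "h + x \<in> E" using p by auto
    have "\<exists>y\<in>Y n. h + - y \<in> W (Suc n) \<and> y + x \<in> A n" for n
    proof -
      obtain y where y: "y \<in> Y n" "h - y \<in> W (Suc n)" using Y(2) hx by blast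
      obtain w k where wk: "w \<in> W (Suc n)" "k \<in> K" "h + x = w + k"
        using hx(4) unfolding E_def A_def by blast
      have "y + x = - (h - y) + (h + x)" by (simp add: add.assoc[symmetric])
      also have "\<dots> = (- (h - y) + w) + k" by (simp only: wk(3) add.assoc)
      finally have "y + x = (- (h - y) + w) + k" .
      moreover have "- (h - y) + w \<in> W n" using W(2) W_sym y(2) wk(1) by blast
      ultimately show ?thesis using y wk(2) unfolding A_def by auto
    qed
    then show "p \<in> (\<Inter>n. \<Union>y\<in>Y n. {h\<in>H. h + - y \<in> W (Suc n)} \<times> {x\<in>H. y + x \<in> A n})"
      using hx by auto
  next
    fix p assume p: "p \<in> (\<Inter>n. \<Union>y\<in>Y n. {h\<in>H. h + - y \<in> W (Suc n)} \<times> {x\<in>H. y + x \<in> A n})"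
    obtain h x where hx: "p = (h, x)" by force
    have "h + x \<in> A n" for n
    proof -
      \<comment> \<open>The condition is read at index n + 1, because returning from y + x to h + x
        costs one stage.\<close>
      obtain y where y: "h + - y \<in> W (Suc (Suc n))" "y + x \<in> A (Suc n)" using p hx by auto
      then obtain w k where wk: "w \<in> W (Suc n)" "k \<in> K" "y + x = w + k" unfolding A_def by blast
      have "h + x = (h + - y) + (y + x)" by (simp only: add.assoc minus_add_cancel)
      also have "\<dots> = ((h + - y) + w) + k" by (simp only: wk(3) add.assoc)
      finally have "h + x = ((h + - y) + w) + k" .
      moreover have "(h + - y) + w \<in> W n" using W(2) W_mono y(1) wk(1) by blast
      ultimately show ?thesis using wk(2) unfolding A_def by blast
    qed
    moreover have "h \<in> H" "x \<in> H" using p hx by auto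
    ultimately show "p \<in> {p\<in>H \<times> H. fst p + snd p \<in> E}" using hx by (auto simp: E_def)
  qed
  also have "\<dots> \<in> sets (N \<Otimes>\<^sub>M N)"
  proof -
    have 1: "{h\<in>H. h + - y \<in> W (Suc n)} \<in> sets N" for n y
    proof -
      have "{h\<in>H. h + - y \<in> W (Suc n)} = H \<inter> (\<lambda>x. x + - y) -` W (Suc n)" by auto
      moreover have "open ((\<lambda>x. x + - y) -` W (Suc n))"
        by (rule open_vimage[OF W_open continuous_right_translation])
      ultimately show ?thesis by (auto simp: sets_N_iff)
    qed
    have 2: "{x\<in>H. y + x \<in> A n} \<in> sets N" for n y
    proof -
      have "{x\<in>H. y + x \<in> A n} = H \<inter> (\<lambda>x. y + x) -` A n" by auto
      moreover have "open ((\<lambda>x. y + x) -` A n)" by (rule open_vimage[OF A_open continuous_left_translation])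
      ultimately show ?thesis by (auto simp: sets_N_iff)
    qed
    have "(\<Union>y\<in>Y n. {h\<in>H. h + - y \<in> W (Suc n)} \<times> {x\<in>H. y + x \<in> A n}) \<in> sets (N \<Otimes>\<^sub>M N)" for n
      using 1 2 by (intro sets.countable_UN' Y(1) image_subsetI pair_measureI)
    then show ?thesis by (intro sets.countable_INT) auto
  qed
  finally have "E \<in> product_sets" using E_borel by (simp add: product_sets_def)
  moreover have "K \<subseteq> E" "E \<subseteq> U" using KA AU by (auto simp: E_def)
  ultimately show ?thesis by blast
qed

text \<open>Exhaust \<open>U\<close> by compact sets up to a null set and put a product set between
  each of them and \<open>U\<close>; the union lies between the exhaustion and
  \<open>U\<close>.\<close>

lemma product_set_open:
  assumes U: "open U" "emeasure \<mu> U < \<infinity>"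
  shows "\<exists>E\<in>product_sets. E \<subseteq> U \<and> U - E \<in> null_sets \<mu>"
proof -
  interpret P: sigma_algebra UNIV product_sets by (rule sigma_algebra_product_sets)
  obtain K :: "nat \<Rightarrow> 'g set" where K: "\<And>n. compact (K n)" "\<And>n. K n \<subseteq> U" "U - (\<Union>n. K n) \<in> null_sets \<mu>"
    using open_inner_seq[OF U] by blast
  have "\<exists>E\<in>product_sets. K n \<subseteq> E \<and> E \<subseteq> U" for n
    using product_set_between[OF K(1) U(1) K(2)] .
  then obtain E where E: "\<And>n. E n \<in> product_sets" "\<And>n. K n \<subseteq> E n" "\<And>n. E n \<subseteq> U" by metis
  have mem: "(\<Union>n. E n) \<in> product_sets" using E(1) by blast
  then have "U - (\<Union>n. E n) \<in> sets \<mu>" using U(1) by (auto simp: product_sets_def)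
  moreover have "U - (\<Union>n. E n) \<subseteq> U - (\<Union>n. K n)" using E(2) by blast
  ultimately have "U - (\<Union>n. E n) \<in> null_sets \<mu>" by (rule null_sets_subset[OF K(3)])
  then show ?thesis using mem E(3) by blast
qed

text \<open>By outer regularity \<open>B\<close> is, up to a null set, the intersection of open sets
  \<open>U n\<close> whose measure exceeds that of \<open>B\<close> by less than 1/(n+1). Each
  \<open>U n\<close> is then traded for the product set inside it.\<close>

lemma product_set_finite:
  assumes B: "B \<in> sets borel" "emeasure \<mu> B < \<infinity>"
  shows "\<exists>E\<in>product_sets. AE x in \<mu>. x \<in> B \<longleftrightarrow> x \<in> E"
proof -
  interpret P: sigma_algebra UNIV product_sets by (rule sigma_algebra_product_sets)
  have "\<exists>U. open U \<and> B \<subseteq> U \<and> emeasure \<mu> U < emeasure \<mu> B + ennreal (1 / real (Suc n))" for n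
  proof -
    have "emeasure \<mu> B < emeasure \<mu> B + ennreal (1 / real (Suc n))"
      using B(2) by (cases "emeasure \<mu> B") (auto simp: ennreal_plus[symmetric] ennreal_less_iff simp del: ennreal_plus)
    from outer_approx[OF B(1) this] show ?thesis by metis
  qed
  then obtain U where U: "\<And>n. open (U n)" "\<And>n. B \<subseteq> U n"
      "\<And>n. emeasure \<mu> (U n) < emeasure \<mu> B + ennreal (1 / real (Suc n))" by metis
  have U_fin: "emeasure \<mu> (U n) < \<infinity>" for n
    using U(3)[of n] by (auto intro: less_le_trans)
  obtain E where E: "\<And>n. E n \<in> product_sets" "\<And>n. E n \<subseteq> U n" "\<And>n. U n - E n \<in> null_sets \<mu>"
    using product_set_open[OF U(1) U_fin] by metis
  have "emeasure \<mu> (\<Inter>n. U n) \<le> emeasure \<mu> B"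
  proof (rule ennreal_le_epsilon)
    fix e :: real assume "0 < e"
    then obtain n where n: "1 / real (Suc n) < e" using nat_approx_posE by blast
    have "emeasure \<mu> (\<Inter>n. U n) \<le> emeasure \<mu> (U n)" using U(1) by (intro emeasure_mono) auto
    also have "\<dots> \<le> emeasure \<mu> B + ennreal (1 / real (Suc n))" using U(3) by (rule less_imp_le)
    also have "\<dots> \<le> emeasure \<mu> B + ennreal e" using n by (intro add_left_mono ennreal_leI) simp
    finally show "emeasure \<mu> (\<Inter>n. U n) \<le> emeasure \<mu> B + ennreal e" .
  qed
  moreover have Ub: "(\<Inter>n. U n) \<in> sets borel" using U(1) by (intro sets.countable_INT) auto
  moreover have "B \<subseteq> (\<Inter>n. U n)" using U(2) by blast
  moreover from this have "emeasure \<mu> B \<le> emeasure \<mu> (\<Inter>n. U n)" using Ub by (intro emeasure_mono) auto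
  ultimately have "emeasure \<mu> ((\<Inter>n. U n) - B) = 0"
    using emeasure_Diff[of \<mu> B "\<Inter>n. U n"] B antisym[of "emeasure \<mu> (\<Inter>n. U n)" "emeasure \<mu> B"]
    by (auto simp: less_top ennreal_diff_self)
  then have "(\<Inter>n. U n) - B \<in> null_sets \<mu>" using Ub B by (auto simp: null_sets_def)
  then have 1: "AE x in \<mu>. x \<notin> (\<Inter>n. U n) - B" by (rule AE_not_in)
  have 2: "AE x in \<mu>. \<forall>n. x \<notin> U n - E n" by (intro AE_all_countable[THEN iffD2] allI AE_not_in E(3))
  have "(\<Inter>n. E n) \<in> product_sets" using E(1) P.countable_INT[of E] by auto
  moreover have "AE x in \<mu>. x \<in> B \<longleftrightarrow> x \<in> (\<Inter>n. E n)"
    using 1 2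
  proof eventually_elim
    fix x assume x: "x \<notin> (\<Inter>n. U n) - B" "\<forall>n. x \<notin> U n - E n"
    have "x \<in> U n" if "x \<in> B" for n using U(2) that by (rule subsetD)
    then show "x \<in> B \<longleftrightarrow> x \<in> (\<Inter>n. E n)" using x E(2) by blast
  qed
  ultimately show ?thesis by (rule bexI[rotated])
qed

lemma product_set_ae:
  assumes B: "B \<in> sets borel"
  shows "\<exists>E\<in>product_sets. AE x in \<mu>. x \<in> H \<longrightarrow> (x \<in> B \<longleftrightarrow> x \<in> E)"
proof -
  interpret P: sigma_algebra UNIV product_sets by (rule sigma_algebra_product_sets)
  obtain C :: "nat \<Rightarrow> 'g set" where C: "\<And>n. compact (C n)" "H = (\<Union>n. C n)"
    using H by (auto simp: open_sigma_subgroup_def)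
  have "\<exists>E\<in>product_sets. AE x in \<mu>. x \<in> B \<inter> C n \<longleftrightarrow> x \<in> E" for n
  proof (rule product_set_finite)
    have c: "C n \<in> sets borel" using C(1) by (intro borel_closed compact_imp_closed)
    then show "B \<inter> C n \<in> sets borel" using B by simp
    have "emeasure \<mu> (B \<inter> C n) \<le> emeasure \<mu> (C n)" using c by (intro emeasure_mono) auto
    then show "emeasure \<mu> (B \<inter> C n) < \<infinity>" using emeasure_compact_finite[OF C(1)] by (rule le_less_trans)
  qed
  then obtain E where E: "\<And>n. E n \<in> product_sets" "\<And>n. AE x in \<mu>. x \<in> B \<inter> C n \<longleftrightarrow> x \<in> E n" by metis
  have "AE x in \<mu>. \<forall>n. x \<in> B \<inter> C n \<longleftrightarrow> x \<in> E n" using E(2) by (simp add: AE_all_countable)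
  then have "AE x in \<mu>. x \<in> H \<longrightarrow> (x \<in> B \<longleftrightarrow> x \<in> (\<Union>n. E n))"
    by eventually_elim (use C(2) in blast)
  moreover have "(\<Union>n. E n) \<in> product_sets" using E(1) by blast
  ultimately show ?thesis by blast
qed

lemma ex_PB_version_ennreal:
  fixes f :: "'g \<Rightarrow> ennreal"
  assumes "f \<in> borel_measurable borel"
  shows "\<exists>f'\<in>borel_measurable PB. AE x in \<mu>. x \<in> H \<longrightarrow> f x = f' x"
  using assms
proof (induction f rule: borel_measurable_induct)
  case (cong f g)
  then show ?case by simp
next
  case (set A)
  then obtain E where "E \<in> product_sets" "AE x in \<mu>. x \<in> H \<longrightarrow> (x \<in> A \<longleftrightarrow> x \<in> E)"
    using product_set_ae by blast
  then show ?case
    using borel_measurable_indicator[of E PB]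
    by (intro bexI[of _ "indicator E"]) (auto simp: sets_PB indicator_def elim!: eventually_mono)
next
  case (mult u c)
  then obtain f' where "f' \<in> borel_measurable PB" "AE x in \<mu>. x \<in> H \<longrightarrow> u x = f' x" by blast
  then show ?case by (intro bexI[of _ "\<lambda>x. c * f' x"]) auto
next
  case (add u v)
  then obtain f' g' where "f' \<in> borel_measurable PB" "AE x in \<mu>. x \<in> H \<longrightarrow> u x = f' x"
    "g' \<in> borel_measurable PB" "AE x in \<mu>. x \<in> H \<longrightarrow> v x = g' x" by blast
  then show ?case by (intro bexI[of _ "\<lambda>x. g' x + f' x"]) auto
next
  case (seq U)
  then obtain f' where f': "\<And>i. f' i \<in> borel_measurable PB" "\<And>i. AE x in \<mu>. x \<in> H \<longrightarrow> U i x = f' i x"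
    by metis
  have "AE x in \<mu>. \<forall>i. x \<in> H \<longrightarrow> U i x = f' i x"
    using f'(2) by (intro AE_all_countable[THEN iffD2] allI)
  then have "AE x in \<mu>. x \<in> H \<longrightarrow> (SUP i. U i) x = (SUP i. f' i x)"
    by eventually_elim (simp add: image_image)
  moreover have "(\<lambda>x. SUP i. f' i x) \<in> borel_measurable PB" using f'(1) by simp
  ultimately show ?case by (rule bexI)
qed

text \<open>Real and imaginary parts are split into positive and negative parts by means of
  \<open>ennreal\<close>, which sends negative reals to \<open>0\<close>.\<close>

lemma ex_PB_version:
  fixes f :: "'g \<Rightarrow> complex"
  assumes [measurable]: "f \<in> borel_measurable borel"
  shows "\<exists>f'\<in>borel_measurable PB. AE x in \<mu>. x \<in> H \<longrightarrow> f x = f' x"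
proof -
  have *: "\<exists>g'\<in>borel_measurable PB. AE x in \<mu>. x \<in> H \<longrightarrow> g x = g' x"
    if [measurable]: "g \<in> borel_measurable borel" for g :: "'g \<Rightarrow> real"
  proof -
    obtain p where [measurable]: "p \<in> borel_measurable PB" and p: "AE x in \<mu>. x \<in> H \<longrightarrow> ennreal (g x) = p x"
      using ex_PB_version_ennreal[of "\<lambda>x. ennreal (g x)"] by auto
    obtain q where [measurable]: "q \<in> borel_measurable PB" and q: "AE x in \<mu>. x \<in> H \<longrightarrow> ennreal (- g x) = q x"
      using ex_PB_version_ennreal[of "\<lambda>x. ennreal (- g x)"] by auto
    have "AE x in \<mu>. x \<in> H \<longrightarrow> g x = enn2real (p x) - enn2real (q x)"
      using p q
    proof eventually_elim
      fix x assume "x \<in> H \<longrightarrow> ennreal (g x) = p x" "x \<in> H \<longrightarrow> ennreal (- g x) = q x"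
      then show "x \<in> H \<longrightarrow> g x = enn2real (p x) - enn2real (q x)"
        by (cases "g x \<ge> 0") (auto simp: ennreal_neg enn2real_ennreal dest!: sym[of _ "p x"] sym[of _ "q x"])
    qed
    then show ?thesis by (intro bexI[of _ "\<lambda>x. enn2real (p x) - enn2real (q x)"]) auto
  qed
  obtain a where [measurable]: "a \<in> borel_measurable PB" and a: "AE x in \<mu>. x \<in> H \<longrightarrow> Re (f x) = a x"
    using *[of "\<lambda>x. Re (f x)"] by auto
  obtain b where [measurable]: "b \<in> borel_measurable PB" and b: "AE x in \<mu>. x \<in> H \<longrightarrow> Im (f x) = b x"
    using *[of "\<lambda>x. Im (f x)"] by auto
  have "AE x in \<mu>. x \<in> H \<longrightarrow> f x = complex_of_real (a x) + \<i> * complex_of_real (b x)"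
    using a b by eventually_elim (auto simp: complex_eq_iff)
  then show ?thesis
    by (intro bexI[of _ "\<lambda>x. complex_of_real (a x) + \<i> * complex_of_real (b x)"]) auto
qed

end

text \<open>Normal forms of words in a noncommutative additive group: associated to the right,
  inverses pushed to the letters, neighbours cancelled.\<close>

lemmas group_word_simps = diff_conv_add_uminus add.assoc minus_add_cancel add_minus_cancel
  left_minus right_minus minus_add minus_minus add_0_left add_0_right

text \<open>Choose a symmetric \<open>V\<close> with V + V inside \<open>W\<close> and the interior
  of \<open>K\<close>. Every point of the closure of \<open>V\<close> is a sum of two elements of
  \<open>V\<close>, so this closure is a closed subset of the compact \<open>K\<close> and still
  lies in \<open>W\<close>.\<close>

lemma compact_nbhd_basis:
  fixes K W :: "'g::{topological_group_add, t2_space} set"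
  assumes K: "compact K" "0 \<in> interior K" and W: "open W" "0 \<in> W"
  shows "\<exists>M. compact M \<and> 0 \<in> interior M \<and> M \<subseteq> W"
proof -
  obtain V where V: "open V" "0 \<in> V" "\<forall>v\<in>V. - v \<in> V" "\<forall>v\<in>V. \<forall>w\<in>V. v + w \<in> W \<inter> interior K"
    using ex_symmetric_nbhd[of "W \<inter> interior K"] K W by auto
  have sub: "x \<in> W \<inter> interior K" if x: "x \<in> closure V" for x
  proof -
    have "open ((\<lambda>y. - y + x) -` V)"
      using open_vimage[OF open_vimage[OF V(1) continuous_right_translation[of UNIV x]] continuous_uminus]
      by (simp add: vimage_def)
    moreover have "x \<in> (\<lambda>y. - y + x) -` V" using V(2) by simp
    ultimately obtain y where "y \<in> V" "- y + x \<in> V"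
      using x unfolding closure_iff_nhds_not_empty by blast
    then have "y + (- y + x) \<in> W \<inter> interior K" using V(4) by blast
    then show ?thesis by (simp add: add.assoc[symmetric])
  qed
  have "closure V = K \<inter> closure V" using sub interior_subset by blast
  then have "compact (closure V)" using compact_Int_closed[OF K(1) closed_closure] by metis
  moreover have "0 \<in> interior (closure V)" using V closure_subset by (meson interiorI)
  ultimately show ?thesis using sub by blast
qed

lemma compact_add:
  fixes A B :: "'g::topological_group_add set"
  assumes "compact A" "compact B"
  shows "compact {a + b | a b. a \<in> A \<and> b \<in> B}"
proof -
  have "continuous_on (A \<times> B) (\<lambda>p. fst p + snd p)" by (intro continuous_intros)
  then have "compact ((\<lambda>p. fst p + snd p) ` (A \<times> B))" by (intro compact_continuous_image compact_Times assms)
  moreover have "(\<lambda>p. fst p + snd p) ` (A \<times> B) = {a + b | a b. a \<in> A \<and> b \<in> B}"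
    by (auto simp: image_iff Bex_def; blast)
  ultimately show ?thesis by simp
qed

section \<open>The \<sigma>-finite restriction and the comparison of a set with its inverse\<close>

context haar_subgroup
begin

lemma emeasure_N: "A \<in> sets N \<Longrightarrow> emeasure N A = emeasure \<mu> A"
  unfolding N_def by (subst emeasure_restrict_space) (auto simp: sets_restrict_space_iff)

lemma nn_integral_N: "(\<integral>\<^sup>+x. f x \<partial>N) = (\<integral>\<^sup>+x. f x * indicator H x \<partial>\<mu>)"
  unfolding N_def by (rule nn_integral_restrict_space) simp

lemma AE_N_iff: "(AE x in N. P x) \<longleftrightarrow> (AE x in \<mu>. x \<in> H \<longrightarrow> P x)"
  unfolding N_def by (rule AE_restrict_space_iff) simp

sublocale N: sigma_finite_measure N
proof
  obtain C :: "nat \<Rightarrow> 'g set" where C: "\<And>n. compact (C n)" "H = (\<Union>n. C n)"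
    using H by (auto simp: open_sigma_subgroup_def)
  have s: "C n \<in> sets N" for n
    unfolding sets_N_iff using borel_closed[OF compact_imp_closed[OF C(1)]] C(2) by blast
  show "\<exists>A. countable A \<and> A \<subseteq> sets N \<and> \<Union> A = space N \<and> (\<forall>a\<in>A. emeasure N a \<noteq> \<infinity>)"
  proof (intro exI conjI ballI)
    show "countable (range C)" "range C \<subseteq> sets N" using s by auto
    show "\<Union> (range C) = space N" by (rule trans[OF C(2)[symmetric] space_N[symmetric]])
    fix a assume "a \<in> range C"
    then obtain n where "a = C n" by blast
    then show "emeasure N a \<noteq> \<infinity>" using emeasure_N[OF s, of n] emeasure_compact_finite[OF C(1), of n] by simp
  qed
qed

sublocale NN: pair_sigma_finite N N ..

lemma measurable_translate_N: "h \<in> H \<Longrightarrow> (\<lambda>x. h + x) \<in> measurable N N"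
  by (rule measurable_into_N) (auto intro: measurable_N add_H)

lemma distr_translate_N:
  assumes h: "h \<in> H"
  shows "distr N N (\<lambda>x. h + x) = N"
proof (rule measure_eqI)
  fix A assume "A \<in> sets (distr N N (\<lambda>x. h + x))"
  then have A: "A \<in> sets N" by simp
  have eq: "(\<lambda>x. h + x) -` A \<inter> H = (\<lambda>x. h + x) -` A"
  proof -
    have "x \<in> H" if "h + x \<in> A" for x
    proof -
      have "h + x \<in> H" using that A by (auto simp: sets_N_iff)
      then have "- h + (h + x) \<in> H" using add_H uminus_H h by blast
      then show ?thesis by (simp add: add.assoc[symmetric])
    qed
    then show ?thesis by auto
  qed
  have "(\<lambda>x. h + x) -` A \<in> sets N"
    using measurable_sets[OF measurable_translate_N[OF h] A] by (simp add: eq)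
  then show "emeasure (distr N N (\<lambda>x. h + x)) A = emeasure N A"
    using A h by (simp add: emeasure_distr measurable_translate_N eq emeasure_N emeasure_translate sets_N_iff)
qed simp

lemma nn_integral_translate_N:
  assumes "h \<in> H" "f \<in> borel_measurable N"
  shows "(\<integral>\<^sup>+x. f (h + x) \<partial>N) = (\<integral>\<^sup>+x. f x \<partial>N)"
  using nn_integral_distr[OF measurable_translate_N[OF assms(1)], of f] assms
  by (simp add: distr_translate_N)

lemma measurable_translate_PB:
  assumes "h \<in> H"
  shows "(\<lambda>x. h + x) \<in> measurable N PB" "(\<lambda>x. x + h) \<in> measurable N PB"
    "(\<lambda>x. - x + h) \<in> measurable N PB" "(\<lambda>x. h - x) \<in> measurable N PB"
    "(\<lambda>x. x) \<in> measurable N PB"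
proof -
  have c: "(\<lambda>x. c) \<in> measurable N N" if "c \<in> H" for c using that by simp
  note [measurable] = c[OF assms] c[OF zero_H]
  show "(\<lambda>x. h + x) \<in> measurable N PB" "(\<lambda>x. x + h) \<in> measurable N PB"
    "(\<lambda>x. - x + h) \<in> measurable N PB" "(\<lambda>x. h - x) \<in> measurable N PB" by measurable
  have "(\<lambda>x. x + 0) \<in> measurable N PB" by measurable
  then show "(\<lambda>x. x) \<in> measurable N PB" by simp
qed

lemma product_set_measurable:
  assumes "E \<in> product_sets"
  shows "(indicator E :: 'g \<Rightarrow> ennreal) \<in> borel_measurable PB" "E \<in> sets borel"
  using borel_measurable_indicator[of E PB] assms by (auto simp: sets_PB product_sets_def)

text \<open>Compare both orders of integration of \<open>1\<^sub>F(x) 1\<^sub>E(y + x)\<close>, where \<open>E\<close> nearly exhausts an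
  invariant neighbourhood \<open>V\<close>: invariance of \<open>V\<close> makes its right translates have equal measure.\<close>

lemma emeasure_le_uminus:
  fixes K :: "'g set"
  assumes V: "open V" "0 \<in> V" "emeasure \<mu> V < \<infinity>" "V \<subseteq> H"
    and inv: "\<And>g x. g + x + - g \<in> V \<longleftrightarrow> x \<in> V"
    and K: "compact K" "0 \<in> interior K"
    and L: "compact L" "L \<subseteq> H" and F: "F \<in> product_sets" "F \<subseteq> L"
  shows "emeasure \<mu> F \<le> emeasure \<mu> (uminus -` F)"
proof -
  \<comment> \<open>Conjugation by \<open>x\<close> takes z + x to x + z, so right translates of
    \<open>V\<close> are also left translates and have the measure of \<open>V\<close>.\<close>
  have inv': "z + x \<in> V \<longleftrightarrow> x + z \<in> V" for x z
    using inv[of x "z + x"] by (simp add: add.assoc[symmetric])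
  have right: "emeasure \<mu> {z. z + x \<in> V} = emeasure \<mu> V" for x
    using emeasure_translate[of V x] V by (simp add: inv' vimage_def)
  have V0: "emeasure \<mu> V > 0" using emeasure_open_pos V by blast
  \<comment> \<open>One product set \<open>E\<close> has to serve all \<open>x\<close> in
    \<open>L\<close>. Each \<open>x\<close> is served together with a neighbourhood of it, and
    compactness of \<open>L\<close> leaves finitely many compact subsets of \<open>V\<close> for
    \<open>E\<close> to enclose.\<close>
  have approx: "\<exists>E\<in>product_sets. E \<subseteq> V \<and> (\<forall>x\<in>L. c \<le> emeasure \<mu> {z. z + x \<in> E})" if c: "c < emeasure \<mu> V" for c
  proof -
    have "\<exists>M C. compact M \<and> 0 \<in> interior M \<and> compact C \<and> C \<subseteq> V \<and>
        (\<forall>w\<in>M. \<forall>E. E \<in> sets borel \<longrightarrow> C \<subseteq> E \<longrightarrow> c \<le> emeasure \<mu> {z. z + (x + w) \<in> E})" for x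
    proof -
      have op: "open ((\<lambda>z. z + x) -` V)" by (rule open_vimage[OF V(1) continuous_right_translation])
      have "c < emeasure \<mu> ((\<lambda>z. z + x) -` V)" using right[of x] c by (simp add: vimage_def)
      then obtain K' where K': "compact K'" "K' \<subseteq> (\<lambda>z. z + x) -` V" "c < emeasure \<mu> K'"
        by (rule inner_approx[OF op])
      have C1: "compact ((\<lambda>z. z + x) ` K')" "(\<lambda>z. z + x) ` K' \<subseteq> V"
        using K' by (auto intro: compact_continuous_image[OF continuous_right_translation])
      obtain W where W: "open W" "0 \<in> W" "\<forall>w\<in>W. \<forall>k\<in>(\<lambda>z. z + x) ` K'. k + w \<in> V"
        using compact_nbhd_right[OF C1(1) V(1) C1(2)] by blast
      obtain M where M: "compact M" "0 \<in> interior M" "M \<subseteq> W"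
        using compact_nbhd_basis[OF K W(1,2)] by blast
      \<comment> \<open>Every \<open>w\<close> in \<open>M\<close> moves K' + x into this compact
        subset of \<open>V\<close>. A set containing it therefore keeps measure at least
        \<open>c\<close> after pulling back along translation by x + w.\<close>
      let ?C = "{a + b | a b. a \<in> (\<lambda>z. z + x) ` K' \<and> b \<in> M}"
      have c1: "c \<le> emeasure \<mu> {z. z + (x + w) \<in> E}" if "w \<in> M" "E \<in> sets borel" "?C \<subseteq> E" for w E
      proof -
        have "K' \<subseteq> {z. z + (x + w) \<in> E}"
        proof
          fix k assume "k \<in> K'"
          then have "(k + x) + w \<in> ?C" using \<open>w \<in> M\<close> by blast
          then show "k \<in> {z. z + (x + w) \<in> E}" using \<open>?C \<subseteq> E\<close> by (auto simp: add.assoc)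
        qed
        moreover have "{z. z + (x + w) \<in> E} \<in> sets borel"
          using measurable_sets[OF borel_right_translation \<open>E \<in> sets borel\<close>, of "x + w"] by (simp add: vimage_def)
        ultimately have "emeasure \<mu> K' \<le> emeasure \<mu> {z. z + (x + w) \<in> E}" by (intro emeasure_mono) auto
        with K'(3) show ?thesis by simp
      qed
      have c2: "?C \<subseteq> V" using W M by blast
      have c3: "compact ?C" by (rule compact_add[OF C1(1) M(1)])
      show ?thesis
        by (rule exI[of _ M], rule exI[of _ ?C]) (intro conjI ballI allI impI M(1,2) c2 c3 c1)
    qed
    then obtain M C where MC: "\<And>x. compact (M x)" "\<And>x. 0 \<in> interior (M x)" "\<And>x. compact (C x)" "\<And>x. C x \<subseteq> V"
        "\<And>x w E. w \<in> M x \<Longrightarrow> E \<in> sets borel \<Longrightarrow> C x \<subseteq> E \<Longrightarrow> c \<le> emeasure \<mu> {z. z + (x + w) \<in> E}"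
      by metis
    have op: "open ((\<lambda>y. - x + y) -` interior (M x))" for x
      by (rule open_vimage[OF open_interior continuous_left_translation])
    have "L \<subseteq> (\<Union>x\<in>L. (\<lambda>y. - x + y) -` interior (M x))" using MC(2) by auto
    then obtain Z where Z: "Z \<subseteq> L" "finite Z" "L \<subseteq> (\<Union>x\<in>Z. (\<lambda>y. - x + y) -` interior (M x))"
      using compactE_image[OF L(1), of L "\<lambda>x. (\<lambda>y. - x + y) -` interior (M x)"] op by blast
    have "compact (\<Union>x\<in>Z. C x)" by (intro compact_UN Z MC)
    moreover have "(\<Union>x\<in>Z. C x) \<subseteq> V" by (intro UN_least MC)
    ultimately obtain E where E: "E \<in> product_sets" "(\<Union>x\<in>Z. C x) \<subseteq> E" "E \<subseteq> V"
      using product_set_between[OF _ V(1)] by blast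
    have "c \<le> emeasure \<mu> {z. z + y \<in> E}" if y: "y \<in> L" for y
    proof -
      obtain x where x: "x \<in> Z" "- x + y \<in> interior (M x)" using Z(3) y by blast
      then have "- x + y \<in> M x" using interior_subset by blast
      moreover have "C x \<subseteq> E" using E(2) x(1) by blast
      ultimately have "c \<le> emeasure \<mu> {z. z + (x + (- x + y)) \<in> E}"
        using product_set_measurable(2)[OF E(1)] by (intro MC(5))
      then show ?thesis by (simp add: add.assoc[symmetric])
    qed
    then show ?thesis using E by blast
  qed
  have bound: "c * emeasure \<mu> F \<le> emeasure \<mu> V * emeasure \<mu> (uminus -` F)" if c: "c < emeasure \<mu> V" for c
  proof -
    obtain E where E: "E \<in> product_sets" "E \<subseteq> V" "\<And>x. x \<in> L \<Longrightarrow> c \<le> emeasure \<mu> {z. z + x \<in> E}"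
      using approx[OF c] by blast
    have [measurable]: "E \<in> sets PB" "F \<in> sets PB" using E(1) F(1) by (simp_all add: sets_PB)
    note Eb = product_set_measurable(2)[OF E(1)] and Fb = product_set_measurable(2)[OF F(1)]
    have FN: "F \<in> sets N" and EN: "E \<in> sets N" using Fb Eb F(2) L(2) E(2) V(4) by (auto simp: sets_N_iff)
    note [measurable] = FN EN
    have "c * emeasure \<mu> F = (\<integral>\<^sup>+x. c * indicator F x \<partial>N)"
      using FN nn_integral_cmult_indicator[OF FN, of c] by (simp only: emeasure_N)
    also have "\<dots> \<le> (\<integral>\<^sup>+x. indicator F x * (\<integral>\<^sup>+y. indicator E (y + x) \<partial>N) \<partial>N)"
    proof (rule nn_integral_mono)
      fix x assume "x \<in> space N"
      show "c * indicator F x \<le> indicator F x * (\<integral>\<^sup>+y. indicator E (y + x) \<partial>N)"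
      proof (cases "x \<in> F")
        case True
        have sub: "{z. z + x \<in> E} \<subseteq> H"
        proof
          fix z assume "z \<in> {z. z + x \<in> E}"
          then have "z + x \<in> H" using E(2) V(4) by blast
          from diff_H[OF this, of x] show "z \<in> H" using \<open>x \<in> space N\<close> by simp
        qed
        have "{z. z + x \<in> E} \<in> sets borel"
          using measurable_sets[OF borel_right_translation Eb, of x] by (simp add: vimage_def)
        then have s: "{z. z + x \<in> E} \<in> sets N" using sub by (simp add: sets_N_iff)
        have "(\<integral>\<^sup>+y. indicator E (y + x) \<partial>N) = (\<integral>\<^sup>+y. indicator {z. z + x \<in> E} y \<partial>N)"
          by (intro nn_integral_cong) (simp add: indicator_def)
        also have "\<dots> = emeasure \<mu> {z. z + x \<in> E}" using s by (simp add: emeasure_N)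
        finally show ?thesis using E(3) True F(2) by auto
      qed simp
    qed
    also have "\<dots> = (\<integral>\<^sup>+x. \<integral>\<^sup>+y. indicator F x * indicator E (y + x) \<partial>N \<partial>N)"
      by (intro nn_integral_cong nn_integral_cmult[symmetric]) (auto intro!: measurable_add_PB')
    also have "\<dots> = (\<integral>\<^sup>+y. \<integral>\<^sup>+x. indicator F x * indicator E (y + x) \<partial>N \<partial>N)"
      by (rule NN.Fubini') measurable
    also have "\<dots> = (\<integral>\<^sup>+y. \<integral>\<^sup>+x. indicator F (- y + x) * indicator E x \<partial>N \<partial>N)"
    proof (rule nn_integral_cong)
      fix y assume "y \<in> space N"
      then have y: "y \<in> H" by simp
      note [measurable] = measurable_translate_PB[OF uminus_H[OF y]]
      have "(\<integral>\<^sup>+x. indicator F (- y + (y + x)) * indicator E (y + x) \<partial>N) =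
          (\<integral>\<^sup>+x. indicator F (- y + x) * indicator E x \<partial>N :: ennreal)"
        by (rule nn_integral_translate_N[OF y, of "\<lambda>x. indicator F (- y + x) * indicator E x"])
          measurable
      then show "(\<integral>\<^sup>+x. indicator F x * indicator E (y + x) \<partial>N) =
          (\<integral>\<^sup>+x. indicator F (- y + x) * indicator E x \<partial>N :: ennreal)"
        by (simp add: add.assoc[symmetric])
    qed
    also have "\<dots> = (\<integral>\<^sup>+x. \<integral>\<^sup>+y. indicator F (- y + x) * indicator E x \<partial>N \<partial>N)"
      by (rule NN.Fubini'[symmetric]) measurable
    also have "\<dots> = (\<integral>\<^sup>+x. emeasure \<mu> (uminus -` F) * indicator E x \<partial>N)"
    proof (rule nn_integral_cong)
      fix x assume "x \<in> space N"
      then have x: "x \<in> H" by simp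
      note [measurable] = measurable_translate_PB[OF x]
      have "(\<integral>\<^sup>+y. indicator F (- y + x) \<partial>N :: ennreal) = (\<integral>\<^sup>+y. indicator F (- (x + y) + x) \<partial>N)"
        by (rule nn_integral_translate_N[OF x, symmetric]) measurable
      also have "\<dots> = (\<integral>\<^sup>+y. indicator (uminus -` F) y \<partial>N)"
        by (intro nn_integral_cong) (simp add: indicator_def minus_add add.assoc)
      also have "\<dots> = emeasure \<mu> (uminus -` F)"
      proof -
        have "uminus -` F \<in> sets borel" using measurable_sets[OF borel_uminus Fb] by simp
        moreover have "uminus -` F \<subseteq> H" using F(2) L(2) uminus_H by force
        ultimately have "uminus -` F \<in> sets N" by (simp add: sets_N_iff)
        then show ?thesis by (simp add: emeasure_N)
      qed
      finally show "(\<integral>\<^sup>+y. indicator F (- y + x) * indicator E x \<partial>N) = emeasure \<mu> (uminus -` F) * indicator E x"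
        using x by (subst nn_integral_multc) auto
    qed
    also have "\<dots> = emeasure \<mu> (uminus -` F) * emeasure \<mu> E"
      using nn_integral_cmult_indicator[OF EN] EN by (simp only: emeasure_N)
    also have "\<dots> \<le> emeasure \<mu> (uminus -` F) * emeasure \<mu> V"
      using E(2) V(1) by (intro mult_left_mono emeasure_mono) auto
    finally show ?thesis by (simp add: mult.commute)
  qed
  \<comment> \<open>Let \<open>c\<close> increase to the measure of \<open>V\<close>; this number is
    positive and finite, so it cancels.\<close>
  have "emeasure \<mu> V * emeasure \<mu> F \<le> emeasure \<mu> V * emeasure \<mu> (uminus -` F)"
  proof -
    have "emeasure \<mu> V * emeasure \<mu> F = (SUP c\<in>{..<emeasure \<mu> V}. c) * emeasure \<mu> F" by simp
    also have "\<dots> = (SUP c\<in>{..<emeasure \<mu> V}. c * emeasure \<mu> F)" by (rule SUP_mult_right_ennreal)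
    also have "\<dots> \<le> emeasure \<mu> V * emeasure \<mu> (uminus -` F)" by (intro SUP_least) (auto intro: bound)
    finally show ?thesis .
  qed
  then show ?thesis using V0 V(3) by (simp add: ennreal_mult_le_mult_iff)
qed

end

section \<open>Unimodularity of [IN] groups\<close>

locale haar_IN = haar \<mu> for \<mu> :: "'g::{topological_group_add, t2_space} measure" +
  assumes IN: "IN_group TYPE('g)"
begin

definition K0 :: "'g set" where
  "K0 = (SOME K. compact K \<and> 0 \<in> interior K \<and> (\<forall>g. (\<lambda>x. g + x + - g) ` K = K))"

lemma K0: "compact K0" "0 \<in> interior K0" "(\<lambda>x. g + x + - g) ` K0 = K0"
  using someI_ex[OF IN[unfolded IN_group_def]] by (auto simp: K0_def)

lemma K0_invariant: "g + x + - g \<in> K0 \<longleftrightarrow> x \<in> K0"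
proof
  assume "g + x + - g \<in> K0"
  then have "- g + (g + x + - g) + - (- g) \<in> K0" using K0(3)[of "- g"] by blast
  then show "x \<in> K0" by (simp only: group_word_simps)
next
  assume "x \<in> K0" then show "g + x + - g \<in> K0" using K0(3)[of g] by blast
qed

lemma interior_K0_invariant: "g + x + - g \<in> interior K0 \<longleftrightarrow> x \<in> interior K0"
proof -
  have *: "- g + x + g \<in> interior K0" if "x \<in> interior K0" for g x
  proof -
    have "open ((\<lambda>y. - (- g) + y + - g) -` interior K0)"
      by (rule open_vimage[OF open_interior continuous_conj])
    moreover have "(\<lambda>y. - (- g) + y + - g) -` interior K0 \<subseteq> K0"
      using interior_subset[of K0] K0_invariant[of g] by auto
    ultimately have "(\<lambda>y. - (- g) + y + - g) -` interior K0 \<subseteq> interior K0" by (rule interior_maximal[rotated])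
    moreover have "- g + x + g \<in> (\<lambda>y. - (- g) + y + - g) -` interior K0"
      using that by (simp only: group_word_simps vimage_eq)
    ultimately show ?thesis by blast
  qed
  show ?thesis
    using *[of x "- g"] *[of "g + x + - g" g] by (simp only: group_word_simps) blast
qed

text \<open>Inner regularity reduces the claim to a compact \<open>K\<close>. A product set
  \<open>F\<close> between \<open>K\<close> and \<open>U\<close> is needed that lies in a compact
  subset of a \<sigma>-compact open subgroup; intersecting \<open>U\<close> with K + interior K0
  confines \<open>F\<close> to the compact set K + K0.\<close>

lemma emeasure_open_le_uminus:
  assumes U: "open U"
  shows "emeasure \<mu> U \<le> emeasure \<mu> (uminus -` U)"
  unfolding inner_regular[OF U]
proof (rule SUP_least)
  fix K assume "K \<in> {K. compact K \<and> K \<subseteq> U}"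
  then have K: "compact K" "K \<subseteq> U" by auto
  let ?L = "{a + b | a b. a \<in> K \<and> b \<in> K0}"
  have L: "compact ?L" by (rule compact_add[OF K(1) K0(1)])
  have "\<exists>H. open_sigma_subgroup H \<and> (\<Union>n::nat. K0 \<union> ?L) \<subseteq> H"
    by (rule ex_open_sigma_subgroup[OF K0(1,2)]) (intro compact_Un K0(1) L)
  then obtain H where H: "open_sigma_subgroup H" "K0 \<subseteq> H" "?L \<subseteq> H" by auto
  interpret S: haar_subgroup \<mu> H by unfold_locales (rule H(1))
  let ?U = "U \<inter> (\<Union>k\<in>K. (+) k ` interior K0)"
  have "open ?U" by (intro open_Int U open_UN ballI open_left_translate open_interior)
  moreover have "K \<subseteq> ?U"
  proof
    fix k assume "k \<in> K"
    moreover have "k \<in> (+) k ` interior K0" using K0(2) by (intro image_eqI[of _ _ 0]) auto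
    ultimately show "k \<in> ?U" using K(2) by blast
  qed
  ultimately obtain F where F: "F \<in> S.product_sets" "K \<subseteq> F" "F \<subseteq> ?U"
    using S.product_set_between[OF K(1)] by blast
  have FL: "F \<subseteq> ?L" using F(3) interior_subset[of K0] by blast
  have "emeasure \<mu> K \<le> emeasure \<mu> F" using F S.product_set_measurable(2) by (intro emeasure_mono) auto
  also have "\<dots> \<le> emeasure \<mu> (uminus -` F)"
  proof (rule S.emeasure_le_uminus[OF open_interior K0(2) _ _ interior_K0_invariant K0(1,2) L H(3) F(1) FL])
    have "emeasure \<mu> (interior K0) \<le> emeasure \<mu> K0"
      using K0(1) interior_subset by (intro emeasure_mono) (auto intro: borel_closed compact_imp_closed)
    then show "emeasure \<mu> (interior K0) < \<infinity>" using emeasure_compact_finite[OF K0(1)] by (rule le_less_trans)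
    show "interior K0 \<subseteq> H" using H(2) interior_subset by blast
  qed
  also have "\<dots> \<le> emeasure \<mu> (uminus -` U)"
    using F(3) open_vimage[OF U continuous_uminus] by (intro emeasure_mono) auto
  finally show "emeasure \<mu> K \<le> emeasure \<mu> (uminus -` U)" .
qed

text \<open>The inequality for open sets, applied to the reflection of an open \<open>U\<close>,
  bounds the measure of the reflection by that of \<open>U\<close>. Outer regularity carries this to
  Borel sets.\<close>

lemma emeasure_uminus_le:
  assumes E: "E \<in> sets borel"
  shows "emeasure \<mu> (uminus -` E) \<le> emeasure \<mu> E"
  unfolding outer_regular[OF E]
proof (rule INF_greatest)
  fix U assume "U \<in> {U. open U \<and> E \<subseteq> U}"
  then have U: "open U" "E \<subseteq> U" by auto
  have U': "open (uminus -` U)" by (rule open_vimage[OF U(1) continuous_uminus])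
  have "emeasure \<mu> (uminus -` E) \<le> emeasure \<mu> (uminus -` U)" using U U' by (intro emeasure_mono) auto
  also have "\<dots> \<le> emeasure \<mu> (uminus -` uminus -` U)" by (rule emeasure_open_le_uminus[OF U'])
  finally show "emeasure \<mu> (uminus -` E) \<le> emeasure \<mu> U" by (simp add: vimage_def)
qed

lemma emeasure_uminus:
  assumes E: "E \<in> sets borel"
  shows "emeasure \<mu> (uminus -` E) = emeasure \<mu> E"
proof (rule antisym[OF emeasure_uminus_le[OF E]])
  have "uminus -` E \<in> sets borel" using measurable_sets[OF borel_uminus E] by simp
  from emeasure_uminus_le[OF this] show "emeasure \<mu> E \<le> emeasure \<mu> (uminus -` E)" by (simp add: vimage_def)
qed

lemma distr_uminus: "distr \<mu> borel uminus = \<mu>"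
  by (rule measure_eqI) (auto simp: emeasure_distr emeasure_uminus)

text \<open>Unimodularity: right translation is left translation conjugated by inversion, and both
  preserve the measure.\<close>

lemma distr_right_translate: "distr \<mu> borel (\<lambda>x. x + g) = \<mu>"
proof -
  have "(\<lambda>x. x + g) = uminus \<circ> (\<lambda>x. - g + x) \<circ> uminus"
    by (auto simp: fun_eq_iff minus_add)
  then have "distr \<mu> borel (\<lambda>x. x + g) = distr (distr (distr \<mu> borel uminus) borel (\<lambda>x. - g + x)) borel uminus"
    by (simp add: distr_distr o_assoc)
  then show ?thesis by (simp add: distr_uminus distr_translate)
qed

end

section \<open>Passing between a measure and its completion\<close>

lemma measurable_completion_AE:
  assumes g: "g \<in> borel_measurable M" and ae: "AE x in M. f x = g x"
  shows "f \<in> borel_measurable (completion M)"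
proof (rule measurableI)
  fix A :: "'b set" assume "A \<in> sets borel"
  then have "g -` A \<inter> space M \<in> sets (completion M)" using g by (simp add: measurable_sets)
  moreover have "AE x in completion M. x \<in> g -` A \<inter> space M \<longleftrightarrow> x \<in> f -` A \<inter> space M"
  proof (rule AE_completion)
    show "AE x in M. x \<in> g -` A \<inter> space M \<longleftrightarrow> x \<in> f -` A \<inter> space M" using ae by eventually_elim simp
  qed
  ultimately have "f -` A \<inter> space M \<in> sets (completion M)"
    using completion.in_sets_AE[of "g -` A \<inter> space M" "f -` A \<inter> space M" M] by simp
  then show "f -` A \<inter> space (completion M) \<in> sets (completion M)" by simp
qed simp

lemma
  fixes f g :: "'a \<Rightarrow> 'b::{banach, second_countable_topology}"
  assumes g: "g \<in> borel_measurable M" and ae: "AE x in M. f x = g x"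
  shows integral_completion_AE: "integral\<^sup>L (completion M) f = integral\<^sup>L M g"
    and integrable_completion_AE: "integrable (completion M) f \<longleftrightarrow> integrable M g"
proof -
  note m = measurable_completion_AE[OF g ae] measurable_completion[OF g]
  note ae' = AE_completion[OF ae]
  show "integral\<^sup>L (completion M) f = integral\<^sup>L M g"
    using integral_cong_AE[OF m ae'] integral_completion[OF g] by simp
  show "integrable (completion M) f \<longleftrightarrow> integrable M g"
    using integrable_cong_AE[OF m ae'] integrable_completion[OF g] by simp
qed

lemma completion_ex_borel_measurable_complex:
  fixes f :: "'a \<Rightarrow> complex"
  assumes f: "f \<in> borel_measurable (completion M)"
  shows "\<exists>g\<in>borel_measurable M. AE x in M. f x = g x"
proof -
  obtain a where [measurable]: "a \<in> borel_measurable M" and a: "AE x in M. Re (f x) = a x"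
    using completion_ex_borel_measurable_real[of "\<lambda>x. Re (f x)" M] f by auto
  obtain b where [measurable]: "b \<in> borel_measurable M" and b: "AE x in M. Im (f x) = b x"
    using completion_ex_borel_measurable_real[of "\<lambda>x. Im (f x)" M] f by auto
  have "AE x in M. f x = complex_of_real (a x) + \<i> * complex_of_real (b x)"
    using a b by eventually_elim (auto simp: complex_eq_iff)
  then show ?thesis
    by (intro bexI[of _ "\<lambda>x. complex_of_real (a x) + \<i> * complex_of_real (b x)"]) auto
qed

section \<open>Convolution on an open subgroup\<close>

locale haar_IN_subgroup = haar_IN \<mu> + haar_subgroup \<mu> H
  for \<mu> :: "'g::{topological_group_add, t2_space} measure" and H
begin

lemma distr_N:
  assumes T: "T \<in> measurable borel borel" "distr \<mu> borel T = \<mu>" and TH: "\<And>x. T x \<in> H \<longleftrightarrow> x \<in> H"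
  shows "distr N N T = N"
proof (rule measure_eqI)
  have TN: "T \<in> measurable N N" by (rule measurable_into_N) (auto intro: measurable_N T simp: TH)
  fix A assume "A \<in> sets (distr N N T)"
  then have A: "A \<in> sets N" by simp
  have eq: "T -` A \<inter> H = T -` A" using A TH by (auto simp: sets_N_iff)
  have "T -` A \<in> sets N" using measurable_sets[OF TN A] by (simp add: eq)
  moreover have "emeasure \<mu> (T -` A) = emeasure \<mu> A"
    using emeasure_distr[of T \<mu> borel A] T A by (simp add: sets_N_iff)
  ultimately show "emeasure (distr N N T) A = emeasure N A"
    using A by (simp add: emeasure_distr[OF TN] eq emeasure_N)
qed simp

lemma measurable_T_N:
  "T \<in> measurable borel borel \<Longrightarrow> (\<And>x. x \<in> H \<Longrightarrow> T x \<in> H) \<Longrightarrow> T \<in> measurable N N"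
  by (rule measurable_into_N) (auto intro: measurable_N)

lemma uminus_H_iff: "- x \<in> H \<longleftrightarrow> x \<in> H"
  using uminus_H[of x] uminus_H[of "- x"] by auto

lemma add_right_H_iff: "h \<in> H \<Longrightarrow> x + h \<in> H \<longleftrightarrow> x \<in> H"
  using add_H[of x h] add_H[of "x + h" "- h"] uminus_H[of h] by (auto simp: add.assoc)

lemma add_left_H_iff: "h \<in> H \<Longrightarrow> h + x \<in> H \<longleftrightarrow> x \<in> H"
  using add_H[of h x] add_H[of "- h" "h + x"] uminus_H[of h] by (auto simp: add.assoc[symmetric])

lemma distr_uminus_N: "distr N N uminus = N"
  by (rule distr_N[OF borel_uminus distr_uminus uminus_H_iff])

lemma distr_right_translate_N: "h \<in> H \<Longrightarrow> distr N N (\<lambda>x. x + h) = N"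
  by (rule distr_N[OF borel_right_translation distr_right_translate add_right_H_iff])

lemma integral_translate_N:
  fixes f :: "'g \<Rightarrow> complex"
  assumes "h \<in> H" "f \<in> borel_measurable N"
  shows "(LINT x|N. f (h + x)) = (LINT x|N. f x)"
  using integral_distr[OF measurable_translate_N[OF assms(1)] assms(2)]
  by (simp add: distr_translate_N assms)

lemma integral_uminus_N:
  fixes f :: "'g \<Rightarrow> complex"
  assumes "f \<in> borel_measurable N"
  shows "(LINT x|N. f (- x)) = (LINT x|N. f x)"
  using integral_distr[OF measurable_uminus_N assms] by (simp add: distr_uminus_N)

text \<open>Convolution computed on the subgroup and extended by \<open>0\<close>. For functions
  vanishing off \<open>H\<close> it is \<open>convolution\<close>, by
  \<open>convolution_eq_convN\<close>; here Fubini's theorem is available.\<close>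

definition convN :: "('g \<Rightarrow> complex) \<Rightarrow> ('g \<Rightarrow> complex) \<Rightarrow> 'g \<Rightarrow> complex" where
  "convN f h x = (if x \<in> H then LINT y|N. f y * h (- y + x) else 0)"

lemma measurable_N_PB [measurable (raw)]: "f \<in> measurable M N \<Longrightarrow> f \<in> measurable M PB"
  using measurable_compose[OF _ measurable_translate_PB(5)[OF zero_H], of f M] by simp

lemma PB_N: "f \<in> measurable PB M \<Longrightarrow> f \<in> measurable N M"
  by (rule measurable_N[OF PB_borel])

text \<open>Tonelli followed by the substitution of y + x for \<open>x\<close>. The assumption on
  \<open>G\<close> makes the integrand jointly measurable.\<close>

lemma nn_integral_conv:
  fixes F G w :: "'g \<Rightarrow> ennreal"
  assumes [measurable]: "F \<in> borel_measurable N" "G \<in> borel_measurable PB" "w \<in> borel_measurable N"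
  shows "(\<integral>\<^sup>+x. (\<integral>\<^sup>+y. F y * G (- y + x) \<partial>N) * w x \<partial>N) = (\<integral>\<^sup>+y. F y * (\<integral>\<^sup>+x. G x * w (y + x) \<partial>N) \<partial>N)"
proof -
  have "(\<integral>\<^sup>+x. (\<integral>\<^sup>+y. F y * G (- y + x) \<partial>N) * w x \<partial>N) = (\<integral>\<^sup>+x. \<integral>\<^sup>+y. F y * (G (- y + x) * w x) \<partial>N \<partial>N)"
  proof (rule nn_integral_cong)
    fix x assume "x \<in> space N"
    then have x: "x \<in> H" by simp
    note [measurable] = measurable_translate_PB[OF x]
    show "(\<integral>\<^sup>+y. F y * G (- y + x) \<partial>N) * w x = (\<integral>\<^sup>+y. F y * (G (- y + x) * w x) \<partial>N)"
      by (subst nn_integral_multc[symmetric]) (auto simp: mult.assoc)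
  qed
  also have "\<dots> = (\<integral>\<^sup>+y. \<integral>\<^sup>+x. F y * (G (- y + x) * w x) \<partial>N \<partial>N)"
    by (rule NN.Fubini') measurable
  also have "\<dots> = (\<integral>\<^sup>+y. F y * (\<integral>\<^sup>+x. G x * w (y + x) \<partial>N) \<partial>N)"
  proof (rule nn_integral_cong)
    fix y assume "y \<in> space N"
    then have y: "y \<in> H" by simp
    note [measurable] = measurable_translate_PB[OF uminus_H[OF y]] measurable_translate_N[OF y]
    have "(\<integral>\<^sup>+x. F y * (G (- y + x) * w x) \<partial>N) = F y * (\<integral>\<^sup>+x. G (- y + x) * w x \<partial>N)"
      by (rule nn_integral_cmult) measurable
    also have "(\<integral>\<^sup>+x. G (- y + x) * w x \<partial>N) = (\<integral>\<^sup>+x. G (- y + (y + x)) * w (y + x) \<partial>N)"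
      by (rule nn_integral_translate_N[OF y, symmetric]) measurable
    also have "\<dots> = (\<integral>\<^sup>+x. G x * w (y + x) \<partial>N)" by (simp add: add.assoc[symmetric])
    finally show "(\<integral>\<^sup>+x. F y * (G (- y + x) * w x) \<partial>N) = F y * (\<integral>\<^sup>+x. G x * w (y + x) \<partial>N)" .
  qed
  finally show ?thesis .
qed

lemma convN_measurable:
  assumes [measurable]: "f \<in> borel_measurable N" "h \<in> borel_measurable PB"
  shows "convN f h \<in> borel_measurable N"
proof -
  have "(\<lambda>x. LINT y|N. f y * h (- y + x)) \<in> borel_measurable N" by measurable
  then show ?thesis
    by (rule measurable_cong[THEN iffD1, rotated]) (simp add: convN_def)
qed

lemma borel_measurable_supported:
  fixes f :: "'g \<Rightarrow> complex"
  assumes f: "f \<in> borel_measurable N" and supp: "\<And>x. x \<notin> H \<Longrightarrow> f x = 0"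
  shows "f \<in> borel_measurable borel"
proof -
  have "f \<in> borel_measurable (restrict_space borel H)"
    using f unfolding measurable_cong_sets[OF sets_N refl] .
  then have "(\<lambda>x. if x \<in> H then f x else 0) \<in> borel_measurable borel"
    by (subst (asm) measurable_restrict_space_iff[of _ _ 0]) auto
  moreover have "(\<lambda>x. if x \<in> H then f x else 0) = f" using supp by auto
  ultimately show ?thesis by simp
qed

lemma integral_N_eq:
  fixes f :: "'g \<Rightarrow> 'b::{banach, second_countable_topology}"
  assumes supp: "\<And>x. x \<notin> H \<Longrightarrow> f x = 0"
  shows "integral\<^sup>L N f = integral\<^sup>L \<mu> f" "integrable N f \<longleftrightarrow> integrable \<mu> f"
proof -
  have "(\<lambda>x. indicator H x *\<^sub>R f x) = f" using supp by (auto simp: indicator_def)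
  then show "integral\<^sup>L N f = integral\<^sup>L \<mu> f" "integrable N f \<longleftrightarrow> integrable \<mu> f"
    unfolding N_def by (simp_all add: integral_restrict_space integrable_restrict_space)
qed

text \<open>Commutativity only needs one of the factors to be a class function, because
  \<open>f * h(x) = \<integral> f(x - y) h(y) dy\<close> by unimodularity.\<close>

lemma convN_commute:
  assumes [measurable]: "f \<in> borel_measurable PB" "h \<in> borel_measurable PB"
    and central: "\<And>g. g \<in> H \<Longrightarrow> AE x in N. f (- g + x + g) = f x"
  shows "AE x in N. convN f h x = convN h f x"
proof -
  note [measurable] = PB_N[OF assms(1)] PB_N[OF assms(2)]
  \<comment> \<open>The class function property for conjugation by \<open>y\<close>, taken at x - y
    instead of \<open>x\<close>; right invariance keeps the exceptional set null.\<close>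
  have "AE x in N. f (x - y) = f (- y + x)" if "y \<in> space N" for y
  proof -
    have y: "y \<in> H" "- y \<in> H" using that uminus_H by auto
    have "AE x in distr N N (\<lambda>x. x + - y). f (- y + x + y) = f x"
      using central[OF y(1)] by (simp only: distr_right_translate_N[OF y(2)])
    then have "AE x in N. f (- y + (x + - y) + y) = f (x + - y)"
      by (rule AE_distrD[rotated]) (rule measurable_T_N[OF borel_right_translation], simp only: add_right_H_iff[OF y(2)])
    then show ?thesis by (simp only: group_word_simps eq_commute)
  qed
  \<comment> \<open>The exceptional set depends on \<open>y\<close>. Exchanging the quantifiers uses
    joint measurability, and then for almost every \<open>x\<close> the identity can be used under
    an integral in \<open>y\<close>.\<close>
  then have "AE y in N. AE x in N. f (x - y) = f (- y + x)" by (rule AE_I2)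
  then have "AE x in N. AE y in N. f (x - y) = f (- y + x)"
    by (subst NN.AE_commute[symmetric]) measurable
  then show ?thesis
  proof (rule AE_mp, intro AE_I2 impI)
    fix x assume "x \<in> space N" and ae: "AE y in N. f (x - y) = f (- y + x)"
    then have x: "x \<in> H" by simp
    note [measurable] = measurable_translate_PB[OF x] measurable_translate_N[OF x]
    have "convN f h x = (LINT y|N. f y * h (- y + x))" using x by (simp add: convN_def)
    also have "\<dots> = (LINT y|N. f (x + y) * h (- (x + y) + x))"
      by (rule integral_translate_N[OF x, symmetric]) measurable
    also have "\<dots> = (LINT y|N. f (x + y) * h (- y))" by (simp only: group_word_simps)
    also have "\<dots> = (LINT y|N. f (x + - y) * h (- (- y)))"
      by (rule integral_uminus_N[symmetric]) measurable
    also have "\<dots> = (LINT y|N. h y * f (x - y))" by (simp add: mult.commute)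
    also have "\<dots> = (LINT y|N. h y * f (- y + x))"
    proof (rule integral_cong_AE)
      show "AE y in N. h y * f (x - y) = h y * f (- y + x)" using ae by eventually_elim simp
    qed measurable
    also have "\<dots> = convN h f x" using x by (simp add: convN_def)
    finally show "convN f h x = convN h f x" .
  qed
qed

context
  fixes \<omega> :: "'g \<Rightarrow> real"
  assumes \<omega>: "weight \<omega>"
begin

lemma weight_measurable [measurable]: "\<omega> \<in> borel_measurable borel"
  and weight_pos: "\<omega> x > 0" and weight_mult: "\<omega> (x + y) \<le> \<omega> x * \<omega> y"
  using \<omega> by (auto simp: weight_def)

abbreviation nnorm :: "('g \<Rightarrow> ennreal) \<Rightarrow> ennreal" where
  "nnorm F \<equiv> (\<integral>\<^sup>+x. F x * ennreal (\<omega> x) \<partial>N)"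

abbreviation cnorm :: "('g \<Rightarrow> complex) \<Rightarrow> ennreal" where
  "cnorm f \<equiv> nnorm (\<lambda>x. ennreal (cmod (f x)))"

text \<open>After \<open>nn_integral_conv\<close> the weight stands at y + x, and
  submultiplicativity of \<omega> separates the variables.\<close>

lemma nnorm_conv_le:
  assumes [measurable]: "F \<in> borel_measurable N" "G \<in> borel_measurable PB"
  shows "nnorm (\<lambda>x. \<integral>\<^sup>+y. F y * G (- y + x) \<partial>N) \<le> nnorm F * nnorm G"
proof -
  note [measurable] = PB_N[OF assms(2)] measurable_N[OF weight_measurable]
  have "nnorm (\<lambda>x. \<integral>\<^sup>+y. F y * G (- y + x) \<partial>N) = (\<integral>\<^sup>+y. F y * (\<integral>\<^sup>+x. G x * ennreal (\<omega> (y + x)) \<partial>N) \<partial>N)"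
    by (rule nn_integral_conv) measurable
  also have "\<dots> \<le> (\<integral>\<^sup>+y. F y * (\<integral>\<^sup>+x. ennreal (\<omega> y) * (G x * ennreal (\<omega> x)) \<partial>N) \<partial>N)"
  proof (intro nn_integral_mono mult_left_mono)
    fix x y
    have "ennreal (\<omega> (y + x)) \<le> ennreal (\<omega> y) * ennreal (\<omega> x)"
      using weight_mult[of y x] weight_pos by (simp add: ennreal_mult'[symmetric] less_imp_le ennreal_leI)
    then have "G x * ennreal (\<omega> (y + x)) \<le> G x * (ennreal (\<omega> y) * ennreal (\<omega> x))" by (rule mult_left_mono) simp
    then show "G x * ennreal (\<omega> (y + x)) \<le> ennreal (\<omega> y) * (G x * ennreal (\<omega> x))" by (simp add: mult_ac)
  qed simp
  also have "\<dots> = (\<integral>\<^sup>+y. (F y * ennreal (\<omega> y)) * nnorm G \<partial>N)"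
    by (intro nn_integral_cong) (simp add: nn_integral_cmult mult.assoc)
  also have "\<dots> = nnorm F * nnorm G" by (rule nn_integral_multc) measurable
  finally show ?thesis .
qed

lemma nnorm_finite_AE:
  assumes [measurable]: "F \<in> borel_measurable N" and fin: "nnorm F < \<infinity>"
  shows "AE x in N. F x < \<infinity>"
proof -
  note [measurable] = measurable_N[OF weight_measurable]
  have "AE x in N. F x * ennreal (\<omega> x) \<noteq> \<infinity>"
    using fin by (intro nn_integral_noteq_infinite) auto
  then show ?thesis
  proof eventually_elim
    fix x assume "F x * ennreal (\<omega> x) \<noteq> \<infinity>"
    then show "F x < \<infinity>" using weight_pos[of x] by (auto simp: ennreal_mult_eq_top_iff less_top[symmetric] not_le)
  qed
qed

lemma convN_norm_le:
  assumes [measurable]: "f \<in> borel_measurable N" "h \<in> borel_measurable PB"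
  shows "cnorm (convN f h) \<le> cnorm f * cnorm h"
proof -
  have "cnorm (convN f h) \<le> nnorm (\<lambda>x. \<integral>\<^sup>+y. ennreal (cmod (f y)) * ennreal (cmod (h (- y + x))) \<partial>N)"
  proof (intro nn_integral_mono mult_right_mono)
    fix x assume "x \<in> space N"
    then have x: "x \<in> H" by simp
    show "ennreal (cmod (convN f h x)) \<le> (\<integral>\<^sup>+y. ennreal (cmod (f y)) * ennreal (cmod (h (- y + x))) \<partial>N)"
    \<comment> \<open>Where the integrand is not integrable, the Bochner integral is
      \<open>0\<close> by convention and the bound is trivial.\<close>
    proof (cases "integrable N (\<lambda>y. f y * h (- y + x))")
      case True
      from integral_norm_bound_ennreal[OF this] x show ?thesis
        by (simp add: convN_def norm_mult ennreal_mult)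
    qed (simp add: convN_def not_integrable_integral_eq)
  qed simp
  also have "\<dots> \<le> cnorm f * cnorm h" by (rule nnorm_conv_le) measurable
  finally show ?thesis .
qed

lemma convN_integrable_AE:
  assumes [measurable]: "f \<in> borel_measurable N" "h \<in> borel_measurable PB"
    and fin: "cnorm f < \<infinity>" "cnorm h < \<infinity>"
  shows "AE x in N. integrable N (\<lambda>y. f y * h (- y + x))"
proof -
  let ?c = "\<lambda>x. \<integral>\<^sup>+y. ennreal (cmod (f y)) * ennreal (cmod (h (- y + x))) \<partial>N"
  have "nnorm ?c \<le> cnorm f * cnorm h" by (rule nnorm_conv_le) measurable
  also have "\<dots> < \<infinity>" using fin by (simp add: ennreal_mult_less_top)
  finally have "AE x in N. ?c x < \<infinity>" by (intro nnorm_finite_AE) measurable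
  then show ?thesis
  proof (rule AE_mp, intro AE_I2 impI)
    fix x assume "x \<in> space N" and c: "?c x < \<infinity>"
    then have x: "x \<in> H" by simp
    note [measurable] = measurable_translate_PB[OF x]
    show "integrable N (\<lambda>y. f y * h (- y + x))"
      using c by (intro integrableI_bounded) (auto simp: norm_mult ennreal_mult)
  qed
qed

text \<open>Two applications of \<open>nnorm_conv_le\<close> show that the double integral converges
  absolutely for almost every \<open>x\<close>. At such an \<open>x\<close> Fubini's theorem and the
  substitution of y + z for \<open>z\<close> give the identity.\<close>

lemma convN_assoc:
  assumes [measurable]: "f \<in> borel_measurable PB" "h \<in> borel_measurable PB" "k \<in> borel_measurable PB"
    and fin: "cnorm f < \<infinity>" "cnorm h < \<infinity>" "cnorm k < \<infinity>"
  shows "AE x in N. convN (convN f h) k x = convN f (convN h k) x"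
proof -
  note [measurable] = PB_N[OF assms(1)] PB_N[OF assms(2)] PB_N[OF assms(3)]
  let ?p = "\<lambda>z. \<integral>\<^sup>+y. ennreal (cmod (f y)) * ennreal (cmod (h (- y + z))) \<partial>N"
  let ?q = "\<lambda>x. \<integral>\<^sup>+z. ?p z * ennreal (cmod (k (- z + x))) \<partial>N"
  have pq: "nnorm ?p \<le> cnorm f * cnorm h" by (rule nnorm_conv_le) measurable
  have "nnorm ?q \<le> nnorm ?p * cnorm k" by (rule nnorm_conv_le) measurable
  also have "\<dots> \<le> (cnorm f * cnorm h) * cnorm k"
    by (rule mult_right_mono[OF pq]) simp
  also have "\<dots> < \<infinity>" using fin by (simp add: ennreal_mult_less_top)
  finally have "AE x in N. ?q x < \<infinity>" by (intro nnorm_finite_AE) measurable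
  then show ?thesis
  proof (rule AE_mp, intro AE_I2 impI)
    fix x assume "x \<in> space N" and q: "?q x < \<infinity>"
    then have x: "x \<in> H" by simp
    note [measurable] = measurable_translate_PB[OF x]
    let ?g = "\<lambda>z y. f y * h (- y + z) * k (- z + x)"
    have int: "integrable (N \<Otimes>\<^sub>M N) (\<lambda>(z, y). ?g z y)"
    proof (rule integrableI_bounded)
      have "(\<integral>\<^sup>+p. ennreal (norm (case p of (z, y) \<Rightarrow> ?g z y)) \<partial>(N \<Otimes>\<^sub>M N)) =
          (\<integral>\<^sup>+z. \<integral>\<^sup>+y. ennreal (norm (?g z y)) \<partial>N \<partial>N)"
        by (subst N.nn_integral_fst[symmetric]) (auto simp: case_prod_beta)
      also have "\<dots> = ?q x"
      proof (rule nn_integral_cong)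
        fix z assume "z \<in> space N"
        then have z: "z \<in> H" by simp
        note [measurable] = measurable_translate_PB[OF z]
        show "(\<integral>\<^sup>+y. ennreal (norm (?g z y)) \<partial>N) = ?p z * ennreal (cmod (k (- z + x)))"
          by (subst nn_integral_multc[symmetric]) (auto simp: norm_mult ennreal_mult)
      qed
      finally show "(\<integral>\<^sup>+p. ennreal (norm (case p of (z, y) \<Rightarrow> ?g z y)) \<partial>(N \<Otimes>\<^sub>M N)) < \<infinity>" using q by simp
    qed measurable
    have "convN (convN f h) k x = (LINT z|N. (LINT y|N. f y * h (- y + z)) * k (- z + x))"
      unfolding convN_def using x by (auto intro!: Bochner_Integration.integral_cong)
    also have "\<dots> = (LINT z|N. LINT y|N. ?g z y)" by simp
    also have "\<dots> = (LINT y|N. LINT z|N. ?g z y)"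
      using NN.Fubini_integral[OF int] by simp
    also have "\<dots> = (LINT y|N. f y * convN h k (- y + x))"
    proof (rule Bochner_Integration.integral_cong[OF refl])
      fix y assume "y \<in> space N"
      then have y: "y \<in> H" by simp
      then have yx: "- y + x \<in> H" using x add_H uminus_H by blast
      note [measurable] = measurable_translate_PB[OF uminus_H[OF y]] measurable_translate_N[OF y]
      have "(LINT z|N. ?g z y) = f y * (LINT z|N. h (- y + z) * k (- z + x))" by (simp add: mult.assoc)
      also have "(LINT z|N. h (- y + z) * k (- z + x)) = (LINT z|N. h (- y + (y + z)) * k (- (y + z) + x))"
        by (rule integral_translate_N[OF y, symmetric]) measurable
      also have "\<dots> = (LINT z|N. h z * k (- z + (- y + x)))" by (simp only: group_word_simps)
      also have "\<dots> = convN h k (- y + x)" using yx by (simp add: convN_def)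
      finally show "(LINT z|N. ?g z y) = f y * convN h k (- y + x)" .
    qed
    also have "\<dots> = convN f (convN h k) x" using x by (simp add: convN_def)
    finally show "convN (convN f h) k x = convN f (convN h k) x" .
  qed
qed

text \<open>The bound of \<phi> by \<omega> makes the double integral absolutely convergent; after
  exchanging the order and translating, \<phi>(y + x) factors.\<close>

lemma convN_character:
  assumes [measurable]: "f \<in> borel_measurable PB" "h \<in> borel_measurable PB"
    and fin: "cnorm f < \<infinity>" "cnorm h < \<infinity>"
    and [measurable]: "\<phi> \<in> borel_measurable borel" and \<phi>_pos: "\<And>x. 0 < \<phi> x"
    and \<phi>_le: "\<And>x. \<phi> x \<le> \<omega> x" and \<phi>_add: "\<And>x y. \<phi> (x + y) = \<phi> x * \<phi> y"
  shows "(LINT x|N. convN f h x * complex_of_real (\<phi> x)) =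
    (LINT x|N. f x * complex_of_real (\<phi> x)) * (LINT x|N. h x * complex_of_real (\<phi> x))"
proof -
  note [measurable] = PB_N[OF assms(1)] PB_N[OF assms(2)] measurable_N[OF assms(5)] measurable_N[OF weight_measurable]
  let ?g = "\<lambda>x y. f y * h (- y + x) * complex_of_real (\<phi> x)"
  have int: "integrable (N \<Otimes>\<^sub>M N) (\<lambda>(x, y). ?g x y)"
  proof (rule integrableI_bounded)
    have "(\<integral>\<^sup>+p. ennreal (norm (case p of (x, y) \<Rightarrow> ?g x y)) \<partial>(N \<Otimes>\<^sub>M N)) =
        (\<integral>\<^sup>+x. \<integral>\<^sup>+y. ennreal (norm (?g x y)) \<partial>N \<partial>N)"
      by (subst N.nn_integral_fst[symmetric]) (auto simp: case_prod_beta)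
    also have "\<dots> \<le> nnorm (\<lambda>x. \<integral>\<^sup>+y. ennreal (cmod (f y)) * ennreal (cmod (h (- y + x))) \<partial>N)"
    proof (rule nn_integral_mono)
      fix x assume "x \<in> space N"
      then have x: "x \<in> H" by simp
      note [measurable] = measurable_translate_PB[OF x]
      have "(\<integral>\<^sup>+y. ennreal (norm (?g x y)) \<partial>N) =
          (\<integral>\<^sup>+y. ennreal (cmod (f y)) * ennreal (cmod (h (- y + x))) \<partial>N) * ennreal (\<phi> x)"
        using less_imp_le[OF \<phi>_pos] by (subst nn_integral_multc[symmetric]) (auto simp: norm_mult ennreal_mult)
      also have "\<dots> \<le> (\<integral>\<^sup>+y. ennreal (cmod (f y)) * ennreal (cmod (h (- y + x))) \<partial>N) * ennreal (\<omega> x)"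
        using \<phi>_le by (intro mult_left_mono ennreal_leI) auto
      finally show "(\<integral>\<^sup>+y. ennreal (norm (?g x y)) \<partial>N) \<le> \<dots>" .
    qed
    also have "\<dots> \<le> cnorm f * cnorm h" by (rule nnorm_conv_le) measurable
    also have "\<dots> < \<infinity>" using fin by (simp add: ennreal_mult_less_top)
    finally show "(\<integral>\<^sup>+p. ennreal (norm (case p of (x, y) \<Rightarrow> ?g x y)) \<partial>(N \<Otimes>\<^sub>M N)) < \<infinity>" .
  qed measurable
  have "(LINT x|N. convN f h x * complex_of_real (\<phi> x)) = (LINT x|N. LINT y|N. ?g x y)"
    unfolding convN_def by (auto intro!: Bochner_Integration.integral_cong)
  also have "\<dots> = (LINT y|N. LINT x|N. ?g x y)" using NN.Fubini_integral[OF int] by simp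
  also have "\<dots> = (LINT y|N. (f y * complex_of_real (\<phi> y)) * (LINT x|N. h x * complex_of_real (\<phi> x)))"
  proof (rule Bochner_Integration.integral_cong[OF refl])
    fix y assume "y \<in> space N"
    then have y: "y \<in> H" by simp
    note [measurable] = measurable_translate_PB[OF uminus_H[OF y]] measurable_translate_N[OF y]
    have "(LINT x|N. ?g x y) = f y * (LINT x|N. h (- y + x) * complex_of_real (\<phi> x))" by (simp add: mult.assoc)
    also have "(LINT x|N. h (- y + x) * complex_of_real (\<phi> x)) =
        (LINT x|N. h (- y + (y + x)) * complex_of_real (\<phi> (y + x)))"
      by (rule integral_translate_N[OF y, symmetric]) measurable
    also have "\<dots> = (LINT x|N. complex_of_real (\<phi> y) * (h x * complex_of_real (\<phi> x)))"
      by (simp only: group_word_simps \<phi>_add of_real_mult mult_ac)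
    also have "\<dots> = complex_of_real (\<phi> y) * (LINT x|N. h x * complex_of_real (\<phi> x))" by simp
    finally show "(LINT x|N. ?g x y) = (f y * complex_of_real (\<phi> y)) * (LINT x|N. h x * complex_of_real (\<phi> x))"
      by (simp add: mult.assoc)
  qed
  also have "\<dots> = (LINT x|N. f x * complex_of_real (\<phi> x)) * (LINT x|N. h x * complex_of_real (\<phi> x))" by simp
  finally show ?thesis .
qed

end

end

section \<open>Supports of integrable functions and versions carried by a subgroup\<close>

context haar
begin

text \<open>By Markov's inequality the sets where |g| is at least 1/(n+1) have finite measure. Outer
  regularity encloses each in an open set of finite measure, which countably many compact sets
  exhaust up to a null set.\<close>

lemma integrable_sigma_compact_support:
  fixes g :: "'g \<Rightarrow> real"
  assumes g: "integrable \<mu> g"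
  shows "\<exists>C :: nat \<Rightarrow> 'g set. (\<forall>n. compact (C n)) \<and> (AE x in \<mu>. g x \<noteq> 0 \<longrightarrow> x \<in> (\<Union>n. C n))"
proof -
  define A where "A n = {x. 1 \<le> ennreal (real (Suc n)) * ennreal \<bar>g x\<bar>}" for n
  have [measurable]: "g \<in> borel_measurable borel" using borel_measurable_integrable[OF g] by simp
  have A: "A n \<in> sets borel" for n unfolding A_def by measurable
  have A_fin: "emeasure \<mu> (A n) < \<infinity>" for n
  proof -
    have "emeasure \<mu> (A n) \<le> ennreal (real (Suc n)) * (\<integral>\<^sup>+x. ennreal \<bar>g x\<bar> * indicator UNIV x \<partial>\<mu>)"
      using nn_integral_Markov_inequality[of "\<lambda>x. ennreal \<bar>g x\<bar>" UNIV \<mu> "ennreal (real (Suc n))"]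
      by (simp add: A_def)
    also have "\<dots> < \<infinity>"
      using g by (simp add: integrable_iff_bounded ennreal_mult_less_top)
    finally show ?thesis .
  qed
  have "\<exists>U. open U \<and> A n \<subseteq> U \<and> emeasure \<mu> U < \<infinity>" for n
    using outer_approx[OF A A_fin] by metis
  then obtain U where U: "\<And>n. open (U n)" "\<And>n. A n \<subseteq> U n" "\<And>n. emeasure \<mu> (U n) < \<infinity>" by metis
  obtain K :: "nat \<Rightarrow> nat \<Rightarrow> 'g set" where K: "\<And>n m. compact (K n m)" "\<And>n. U n - (\<Union>m. K n m) \<in> null_sets \<mu>"
    using open_inner_seq[OF U(1) U(3)] by metis
  have "AE x in \<mu>. \<forall>n. x \<notin> U n - (\<Union>m. K n m)"
    by (intro AE_all_countable[THEN iffD2] allI AE_not_in K(2))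
  then have "AE x in \<mu>. g x \<noteq> 0 \<longrightarrow> x \<in> (\<Union>k. K (fst (prod_decode k)) (snd (prod_decode k)))"
  proof eventually_elim
    fix x assume x: "\<forall>n. x \<notin> U n - (\<Union>m. K n m)"
    show "g x \<noteq> 0 \<longrightarrow> x \<in> (\<Union>k. K (fst (prod_decode k)) (snd (prod_decode k)))"
    proof
      assume "g x \<noteq> 0"
      then obtain n where "1 / real (Suc n) < \<bar>g x\<bar>" using nat_approx_posE[of "\<bar>g x\<bar>"] by auto
      then have "1 \<le> real (Suc n) * \<bar>g x\<bar>" by (simp add: field_simps)
      then have "x \<in> A n" unfolding A_def by (simp add: ennreal_mult[symmetric] del: of_nat_Suc)
      then obtain m where "x \<in> K n m" using x U(2) by blast
      then show "x \<in> (\<Union>k. K (fst (prod_decode k)) (snd (prod_decode k)))"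
        by (intro UN_I[of "prod_encode (n, m)"]) simp_all
    qed
  qed
  then show ?thesis using K(1) by (intro exI[of _ "\<lambda>k. K (fst (prod_decode k)) (snd (prod_decode k))"]) simp
qed

end

context haar_subgroup
begin

text \<open>Three corrections on null sets: a Borel version, a \<open>PB\<close> version on
  \<open>H\<close>, and the factor \<open>indicator H\<close>, which is \<open>PB\<close> measurable
  because \<open>H\<close> is closed under addition.\<close>

lemma ex_supported_PB_version:
  fixes f :: "'g \<Rightarrow> complex"
  assumes f: "f \<in> borel_measurable (completion \<mu>)" and supp: "AE x in \<mu>. x \<notin> H \<longrightarrow> f x = 0"
  shows "\<exists>f'\<in>borel_measurable PB. (\<forall>x. x \<notin> H \<longrightarrow> f' x = 0) \<and> (AE x in \<mu>. f x = f' x)"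
proof -
  obtain f0 where f0: "f0 \<in> borel_measurable \<mu>" "AE x in \<mu>. f x = f0 x"
    using completion_ex_borel_measurable_complex[OF f] by blast
  then have "f0 \<in> borel_measurable borel" by simp
  then obtain f1 where [measurable]: "f1 \<in> borel_measurable PB" and f1: "AE x in \<mu>. x \<in> H \<longrightarrow> f0 x = f1 x"
    using ex_PB_version by blast
  have "{p\<in>H \<times> H. fst p + snd p \<in> H} = space (N \<Otimes>\<^sub>M N)" using add_H by (auto simp: space_pair_measure)
  then have [measurable]: "H \<in> sets PB" by (simp add: sets_PB product_sets_def)
  have "AE x in \<mu>. f x = indicator H x * f1 x"
    using f0(2) f1 supp by eventually_elim (auto simp: indicator_def)
  moreover have "(\<lambda>x. indicator H x * f1 x) \<in> borel_measurable PB" by measurable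
  ultimately show ?thesis by (intro bexI[of _ "\<lambda>x. indicator H x * f1 x"]) (auto simp: indicator_def)
qed

end

section \<open>Convolution on the whole group and class functions\<close>

context haar_IN
begin

lemma distr_reflect: "distr \<mu> borel (\<lambda>y. - y + x) = \<mu>"
proof -
  have "distr \<mu> borel (\<lambda>y. - y + x) = distr (distr \<mu> borel uminus) borel (\<lambda>y. y + x)"
    by (subst distr_distr) (auto simp: comp_def)
  then show ?thesis by (simp add: distr_uminus distr_right_translate)
qed

lemma distr_conj: "distr \<mu> borel (\<lambda>x. - g + x + g) = \<mu>"
proof -
  have "distr \<mu> borel (\<lambda>x. - g + x + g) = distr (distr \<mu> borel (\<lambda>x. - g + x)) borel (\<lambda>x. x + g)"
    by (subst distr_distr) (auto simp: comp_def)
  then show ?thesis by (simp add: distr_translate distr_right_translate)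
qed

lemma borel_reflect [measurable]: "(\<lambda>y. - y + x :: 'g) \<in> borel_measurable borel"
  using measurable_compose[OF borel_uminus borel_right_translation] .

lemma borel_conj [measurable]: "(\<lambda>x. - g + x + g :: 'g) \<in> borel_measurable borel"
  by (intro borel_measurable_continuous_onI continuous_conj)

lemma AE_reflect: "(AE y in \<mu>. P y) \<Longrightarrow> AE y in \<mu>. P (- y + x)"
  using AE_distrD[of "\<lambda>y. - y + x" \<mu> borel P] unfolding distr_reflect by simp

lemma AE_conj: "(AE x in \<mu>. P x) \<Longrightarrow> AE x in \<mu>. P (- g + x + g)"
  using AE_distrD[of "\<lambda>x. - g + x + g" \<mu> borel P] unfolding distr_conj by simp

text \<open>Valid at every \<open>x\<close>, not merely almost everywhere: the map taking
  \<open>y\<close> to - y + x preserves the measure, so replacing \<open>h\<close> by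
  \<open>h0\<close> changes the integrand on a null set only.\<close>

lemma convolution_borel:
  assumes [measurable]: "f0 \<in> borel_measurable borel" "h0 \<in> borel_measurable borel"
    and ae: "AE x in \<mu>. f x = f0 x" "AE x in \<mu>. h x = h0 x"
  shows "convolution \<mu> f h x = (LINT y|\<mu>. f0 y * h0 (- y + x))"
  unfolding convolution_def
proof (rule integral_completion_AE)
  show "AE y in \<mu>. f y * h (- y + x) = f0 y * h0 (- y + x)"
    using ae(1) AE_reflect[OF ae(2), where x = x] by eventually_elim simp
qed measurable

definition central :: "('g \<Rightarrow> complex) \<Rightarrow> bool" where
  "central f \<longleftrightarrow> (\<forall>g. AE x in \<mu>. f (- g + x + g) = f x)"

lemma central_cong:
  assumes "AE x in \<mu>. f x = f' x" "central f"
  shows "central f'"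
  unfolding central_def
proof
  fix g
  show "AE x in \<mu>. f' (- g + x + g) = f' x"
    using assms(1) AE_conj[OF assms(1), where g = g] assms(2)[unfolded central_def, rule_format, of g]
    by eventually_elim simp
qed

text \<open>Conjugation preserves Haar measure and can be substituted in the integral; both factors
  then return to their original values almost everywhere. The result holds at every
  \<open>x\<close>.\<close>

lemma central_convolution:
  assumes f: "f \<in> borel_measurable (completion \<mu>)" "central f"
    and h: "h \<in> borel_measurable (completion \<mu>)" "central h"
  shows "convolution \<mu> f h (- g + x + g) = convolution \<mu> f h x"
proof -
  obtain f0 where "f0 \<in> borel_measurable \<mu>" and f0: "AE x in \<mu>. f x = f0 x"
    using completion_ex_borel_measurable_complex[OF f(1)] by blast
  then have [measurable]: "f0 \<in> borel_measurable borel" by simp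
  obtain h0 where "h0 \<in> borel_measurable \<mu>" and h0: "AE x in \<mu>. h x = h0 x"
    using completion_ex_borel_measurable_complex[OF h(1)] by blast
  then have [measurable]: "h0 \<in> borel_measurable borel" by simp
  have "convolution \<mu> f h (- g + x + g) = (LINT y|distr \<mu> borel (\<lambda>x. - g + x + g). f0 y * h0 (- y + (- g + x + g)))"
    unfolding distr_conj by (rule convolution_borel[OF _ _ f0 h0]) measurable
  also have "\<dots> = (LINT y|\<mu>. f0 (- g + y + g) * h0 (- (- g + y + g) + (- g + x + g)))"
    by (rule integral_distr) measurable
  also have "\<dots> = (LINT y|\<mu>. f0 (- g + y + g) * h0 (- g + (- y + x) + g))"
    by (simp only: group_word_simps)
  also have "\<dots> = (LINT y|\<mu>. f0 y * h0 (- y + x))"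
  proof (rule integral_cong_AE)
    have "AE y in \<mu>. f0 (- g + y + g) = f0 y" "AE y in \<mu>. h0 (- g + y + g) = h0 y"
      using central_cong[OF f0 f(2)] central_cong[OF h0 h(2)] by (auto simp: central_def)
    from this(1) AE_reflect[OF this(2), where x = x]
    show "AE y in \<mu>. f0 (- g + y + g) * h0 (- g + (- y + x) + g) = f0 y * h0 (- y + x)"
      by eventually_elim simp
    have "(\<lambda>y. - g + (- y + x) + g) \<in> borel_measurable borel"
      using measurable_compose[OF borel_reflect borel_conj] .
    from measurable_compose[OF this, of h0]
    show "(\<lambda>y. f0 (- g + y + g) * h0 (- g + (- y + x) + g)) \<in> borel_measurable \<mu>" by measurable
  qed measurable
  also have "\<dots> = convolution \<mu> f h x" by (rule convolution_borel[OF _ _ f0 h0, symmetric]) measurable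
  finally show ?thesis .
qed

end

context haar_IN_subgroup
begin

text \<open>For \<open>x\<close> outside \<open>H\<close> and \<open>y\<close> inside, - y + x is
  outside as well, so the integrand vanishes identically. For \<open>x\<close> in \<open>H\<close>
  the first factor confines the integral to \<open>H\<close>.\<close>

lemma convolution_eq_convN:
  assumes "f0 \<in> borel_measurable borel" "h0 \<in> borel_measurable borel"
    and ae: "AE x in \<mu>. f x = f0 x" "AE x in \<mu>. h x = h0 x"
    and supp: "\<And>x. x \<notin> H \<Longrightarrow> f0 x = 0" "\<And>x. x \<notin> H \<Longrightarrow> h0 x = 0"
  shows "convolution \<mu> f h = convN f0 h0"
proof
  fix x
  have eq: "convolution \<mu> f h x = (LINT y|\<mu>. f0 y * h0 (- y + x))" by (rule convolution_borel[OF assms(1-4)])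
  show "convolution \<mu> f h x = convN f0 h0 x"
  proof (cases "x \<in> H")
    case True
    then show ?thesis using integral_N_eq(1)[of "\<lambda>y. f0 y * h0 (- y + x)"] supp(1) by (simp add: eq convN_def)
  next
    case False
    have "f0 y * h0 (- y + x) = 0" for y
      using False supp add_left_H_iff[of "- y" x] uminus_H[of y] by (cases "y \<in> H") auto
    then have "(\<lambda>y. f0 y * h0 (- y + x)) = (\<lambda>y. 0)" by (rule ext)
    then show ?thesis using False by (simp only: eq convN_def if_False integral_zero)
  qed
qed

lemma convN_supp: "x \<notin> H \<Longrightarrow> convN f h x = 0"
  by (simp add: convN_def)

lemma convN_supp': "\<forall>x. x \<notin> H \<longrightarrow> convN f h x = 0"
  by (simp add: convN_def)

lemma AE_of_N:
  assumes "AE x in N. P x" "\<And>x. x \<notin> H \<Longrightarrow> P x"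
  shows "AE x in \<mu>. P x"
  using assms(1) unfolding AE_N_iff by eventually_elim (use assms(2) in blast)

end

section \<open>Beurling functions and their convolution\<close>

locale beurling = haar_IN \<mu> for \<mu> :: "'g::{topological_group_add, t2_space} measure" +
  fixes \<omega> :: "'g \<Rightarrow> real"
  assumes weight: "weight \<omega>"
begin

abbreviation "Bf \<equiv> beurling_functions \<mu> \<omega>"
abbreviation "B0 \<equiv> beurling_function_algebra \<mu> \<omega>"

lemma omega_measurable [measurable]: "\<omega> \<in> borel_measurable borel"
  and omega_pos: "\<omega> x > 0" and omega_mult: "\<omega> (x + y) \<le> \<omega> x * \<omega> y"
  using weight by (auto simp: weight_def)

lemma omega_completion [measurable]: "\<omega> \<in> borel_measurable (completion \<mu>)"
  by (intro measurable_completion) simp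

text \<open>A common subgroup for finitely many functions lets an algebraic law in several variables
  be checked on a single \<sigma>-finite space. The weight is positive, so the support of
  \<open>f\<close> is that of the integrable function
  \<open>cmod (f x) * \<omega> x\<close>.\<close>

lemma ex_subgroup:
  assumes S: "finite S" "S \<subseteq> Bf"
  shows "\<exists>H. open_sigma_subgroup H \<and> (\<forall>f\<in>S. AE x in \<mu>. x \<notin> H \<longrightarrow> f x = 0)"
proof -
  have "\<exists>C :: nat \<Rightarrow> 'g set. (\<forall>n. compact (C n)) \<and> (AE x in \<mu>. f x \<noteq> 0 \<longrightarrow> x \<in> (\<Union>n. C n))" if f: "f \<in> S" for f
  proof -
    have fB: "f \<in> borel_measurable (completion \<mu>)" "integrable (completion \<mu>) (\<lambda>x. cmod (f x) * \<omega> x)"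
      using f S(2) by (auto simp: beurling_functions_def)
    obtain f0 where "f0 \<in> borel_measurable \<mu>" and f0: "AE x in \<mu>. f x = f0 x"
      using completion_ex_borel_measurable_complex[OF fB(1)] by blast
    then have [measurable]: "f0 \<in> borel_measurable borel" by simp
    have ae: "AE x in \<mu>. cmod (f x) * \<omega> x = cmod (f0 x) * \<omega> x" using f0 by eventually_elim simp
    have m: "(\<lambda>x. cmod (f0 x) * \<omega> x) \<in> borel_measurable \<mu>" by measurable
    have "integrable \<mu> (\<lambda>x. cmod (f0 x) * \<omega> x)"
      using fB(2) by (simp only: integrable_completion_AE[OF m ae])
    then obtain C :: "nat \<Rightarrow> 'g set" where C: "\<forall>n. compact (C n)"
        "AE x in \<mu>. cmod (f0 x) * \<omega> x \<noteq> 0 \<longrightarrow> x \<in> (\<Union>n. C n)"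
      using integrable_sigma_compact_support by blast
    have "AE x in \<mu>. f x \<noteq> 0 \<longrightarrow> x \<in> (\<Union>n. C n)"
      using C(2) f0
    proof eventually_elim
      fix x assume "cmod (f0 x) * \<omega> x \<noteq> 0 \<longrightarrow> x \<in> (\<Union>n. C n)" "f x = f0 x"
      then show "f x \<noteq> 0 \<longrightarrow> x \<in> (\<Union>n. C n)" using omega_pos[of x] by auto
    qed
    then show ?thesis using C(1) by blast
  qed
  then obtain C :: "('g \<Rightarrow> complex) \<Rightarrow> nat \<Rightarrow> 'g set" where C: "\<And>f n. f \<in> S \<Longrightarrow> compact (C f n)"
      "\<And>f. f \<in> S \<Longrightarrow> AE x in \<mu>. f x \<noteq> 0 \<longrightarrow> x \<in> (\<Union>n. C f n)"
    by metis
  have "compact (\<Union>f\<in>S. C f n)" for n using S(1) C(1) by (intro compact_UN) auto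
  then have "\<exists>H. open_sigma_subgroup H \<and> (\<Union>n. \<Union>f\<in>S. C f n) \<subseteq> H"
    by (rule ex_open_sigma_subgroup[OF K0(1,2)])
  then obtain H where H: "open_sigma_subgroup H" "(\<Union>n. \<Union>f\<in>S. C f n) \<subseteq> H"
    by (elim exE conjE)
  have "AE x in \<mu>. x \<notin> H \<longrightarrow> f x = 0" if f: "f \<in> S" for f
    using C(2)[OF f]
  proof eventually_elim
    fix x assume x: "f x \<noteq> 0 \<longrightarrow> x \<in> (\<Union>n. C f n)"
    have "(\<Union>n. C f n) \<subseteq> H"
      by (intro UN_least order_trans[OF _ H(2)] subsetI UN_I[OF UNIV_I] UN_I[OF f])
    then show "x \<notin> H \<longrightarrow> f x = 0" using x by (meson subsetD)
  qed
  then show ?thesis using H(1) by blast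
qed

end

locale beurling_subgroup = beurling \<mu> \<omega> + haar_IN_subgroup \<mu> H
  for \<mu> :: "'g::{topological_group_add, t2_space} measure" and \<omega> H
begin

abbreviation wnorm :: "('g \<Rightarrow> complex) \<Rightarrow> ennreal" where
  "wnorm f \<equiv> (\<integral>\<^sup>+x. ennreal (cmod (f x)) * ennreal (\<omega> x) \<partial>N)"

lemma beurling_iff:
  assumes [measurable]: "f' \<in> borel_measurable borel" and supp: "\<forall>x. x \<notin> H \<longrightarrow> f' x = 0"
    and ae: "AE x in \<mu>. f x = f' x"
  shows "f \<in> Bf \<longleftrightarrow> wnorm f' < \<infinity>" "f \<in> Bf \<Longrightarrow> ennreal (vnorm B0 f) = wnorm f'"
proof -
  have ae': "AE x in \<mu>. cmod (f x) * \<omega> x = cmod (f' x) * \<omega> x" using ae by eventually_elim simp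
  have m: "f \<in> borel_measurable (completion \<mu>)" by (rule measurable_completion_AE[OF _ ae]) simp
  have eq: "wnorm f' = (\<integral>\<^sup>+x. ennreal (cmod (f' x) * \<omega> x) \<partial>\<mu>)"
    unfolding nn_integral_N
  proof (rule nn_integral_cong)
    fix x
    show "ennreal (cmod (f' x)) * ennreal (\<omega> x) * indicator H x = ennreal (cmod (f' x) * \<omega> x)"
      using supp omega_pos[of x] by (cases "x \<in> H") (auto simp: ennreal_mult less_imp_le)
  qed
  have abs: "\<bar>cmod (f' x) * \<omega> x\<bar> = cmod (f' x) * \<omega> x" for x
    using omega_pos[of x] by (simp add: abs_mult)
  have int: "integrable (completion \<mu>) (\<lambda>x. cmod (f x) * \<omega> x) \<longleftrightarrow> integrable \<mu> (\<lambda>x. cmod (f' x) * \<omega> x)"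
    by (rule integrable_completion_AE[OF _ ae']) measurable
  then show "f \<in> Bf \<longleftrightarrow> wnorm f' < \<infinity>"
    unfolding eq beurling_functions_def using m by (simp add: integrable_iff_bounded abs)
  assume "f \<in> Bf"
  then have i: "integrable \<mu> (\<lambda>x. cmod (f' x) * \<omega> x)" using int by (simp add: beurling_functions_def)
  have "vnorm B0 f = (LINT x|\<mu>. cmod (f' x) * \<omega> x)"
    unfolding beurling_function_algebra_def nspace.simps
    by (rule integral_completion_AE[OF _ ae']) measurable
  then show "ennreal (vnorm B0 f) = wnorm f'"
    unfolding eq using nn_integral_eq_integral[OF i] omega_pos by (simp add: less_imp_le)
qed

text \<open>\<open>f'\<close> is the version of \<open>f\<close> used in calculations: it vanishes
  everywhere off \<open>H\<close>, has jointly measurable translates, and expresses the norm as an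
  integral over \<open>N\<close>.\<close>

definition rep :: "('g \<Rightarrow> complex) \<Rightarrow> ('g \<Rightarrow> complex) \<Rightarrow> bool" where
  "rep f f' \<longleftrightarrow> f' \<in> borel_measurable PB \<and> (\<forall>x. x \<notin> H \<longrightarrow> f' x = 0) \<and> (AE x in \<mu>. f x = f' x) \<and>
     wnorm f' < \<infinity> \<and> ennreal (vnorm B0 f) = wnorm f'"

lemma repD:
  assumes "rep f f'"
  shows "f' \<in> borel_measurable PB" "f' \<in> borel_measurable borel" "f' \<in> borel_measurable N"
    "\<And>x. x \<notin> H \<Longrightarrow> f' x = 0" "AE x in \<mu>. f x = f' x" "wnorm f' < \<infinity>" "ennreal (vnorm B0 f) = wnorm f'"
    "\<forall>x. x \<notin> H \<longrightarrow> f' x = 0"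
proof -
  show "f' \<in> borel_measurable PB" using assms by (simp add: rep_def)
  then show "f' \<in> borel_measurable borel" "f' \<in> borel_measurable N" by (rule PB_borel, rule PB_N)
qed (use assms in \<open>simp_all add: rep_def\<close>)

lemma ex_rep:
  assumes f: "f \<in> Bf" and supp: "AE x in \<mu>. x \<notin> H \<longrightarrow> f x = 0"
  shows "\<exists>f'. rep f f'"
proof -
  have "f \<in> borel_measurable (completion \<mu>)" using f by (simp add: beurling_functions_def)
  then obtain f' where f': "f' \<in> borel_measurable PB" "\<forall>x. x \<notin> H \<longrightarrow> f' x = 0" "AE x in \<mu>. f x = f' x"
    using ex_supported_PB_version[OF _ supp] by blast
  note iff = beurling_iff[OF PB_borel[OF f'(1)] f'(2) f'(3)]
  have "rep f f'" unfolding rep_def using f' iff(1) iff(2)[OF f] f by (intro conjI) simp_all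
  then show ?thesis by (rule exI[of _ f'])
qed

lemma convolution_closed:
  assumes f: "f \<in> Bf" "AE x in \<mu>. x \<notin> H \<longrightarrow> f x = 0" and h: "h \<in> Bf" "AE x in \<mu>. x \<notin> H \<longrightarrow> h x = 0"
  shows "convolution \<mu> f h \<in> Bf" "vnorm B0 (convolution \<mu> f h) \<le> vnorm B0 f * vnorm B0 h"
proof -
  obtain f' where "rep f f'" using ex_rep[OF f] by blast
  note f' = repD[OF this]
  obtain h' where "rep h h'" using ex_rep[OF h] by blast
  note h' = repD[OF this]
  have eq: "convolution \<mu> f h = convN f' h'" by (rule convolution_eq_convN) fact+
  have m: "convN f' h' \<in> borel_measurable borel"
    by (rule borel_measurable_supported[OF convN_measurable[OF f'(3) h'(1)] convN_supp])
  have le: "wnorm (convN f' h') \<le> wnorm f' * wnorm h'"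
    by (rule convN_norm_le[OF weight f'(3) h'(1)])
  also have "\<dots> < \<infinity>" using f'(6) h'(6) by (simp add: ennreal_mult_less_top)
  finally have fin: "wnorm (convN f' h') < \<infinity>" .
  note bi = beurling_iff[OF m convN_supp' AE_I2[OF refl]]
  show c: "convolution \<mu> f h \<in> Bf" unfolding eq using bi(1) fin by blast
  have "ennreal (vnorm B0 (convolution \<mu> f h)) \<le> ennreal (vnorm B0 f) * ennreal (vnorm B0 h)"
    unfolding eq f'(7) h'(7) using bi(2) c[unfolded eq] le by simp
  moreover have "0 \<le> vnorm B0 f" "0 \<le> vnorm B0 h"
    using omega_pos by (auto simp: beurling_function_algebra_def less_imp_le intro!: Bochner_Integration.integral_nonneg)
  ultimately show "vnorm B0 (convolution \<mu> f h) \<le> vnorm B0 f * vnorm B0 h"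
    by (simp add: ennreal_mult[symmetric])
qed

lemma convolution_assoc_AE:
  assumes f: "f \<in> Bf" "AE x in \<mu>. x \<notin> H \<longrightarrow> f x = 0" and h: "h \<in> Bf" "AE x in \<mu>. x \<notin> H \<longrightarrow> h x = 0"
    and k: "k \<in> Bf" "AE x in \<mu>. x \<notin> H \<longrightarrow> k x = 0"
  shows "AE x in \<mu>. convolution \<mu> (convolution \<mu> f h) k x = convolution \<mu> f (convolution \<mu> h k) x"
proof -
  obtain f' where "rep f f'" using ex_rep[OF f] by blast
  note f' = repD[OF this]
  obtain h' where "rep h h'" using ex_rep[OF h] by blast
  note h' = repD[OF this]
  obtain k' where "rep k k'" using ex_rep[OF k] by blast
  note k' = repD[OF this]
  have m: "convN f' h' \<in> borel_measurable borel" "convN h' k' \<in> borel_measurable borel"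
    using borel_measurable_supported[OF convN_measurable convN_supp] f' h' k' by blast+
  have 1: "convolution \<mu> f h = convN f' h'" "convolution \<mu> h k = convN h' k'"
    by (rule convolution_eq_convN; fact)+
  have 2: "convolution \<mu> (convN f' h') k = convN (convN f' h') k'"
    by (rule convolution_eq_convN[OF m(1) k'(2) _ k'(5) convN_supp k'(4)]) auto
  have 3: "convolution \<mu> f (convN h' k') = convN f' (convN h' k')"
    by (rule convolution_eq_convN[OF f'(2) m(2) f'(5) _ f'(4) convN_supp]) auto
  show ?thesis
    unfolding 1 2 3
    by (rule AE_of_N[OF convN_assoc[OF weight f'(1) h'(1) k'(1) f'(6) h'(6) k'(6)]]) (simp add: convN_supp)
qed

lemma convolution_commute_AE:
  assumes f: "f \<in> Bf" "AE x in \<mu>. x \<notin> H \<longrightarrow> f x = 0" and h: "h \<in> Bf" "AE x in \<mu>. x \<notin> H \<longrightarrow> h x = 0"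
    and central: "central f"
  shows "AE x in \<mu>. convolution \<mu> f h x = convolution \<mu> h f x"
proof -
  obtain f' where "rep f f'" using ex_rep[OF f] by blast
  note f' = repD[OF this]
  obtain h' where "rep h h'" using ex_rep[OF h] by blast
  note h' = repD[OF this]
  have eq: "convolution \<mu> f h = convN f' h'" "convolution \<mu> h f = convN h' f'"
    by (rule convolution_eq_convN; fact)+
  have "AE x in N. f' (- g + x + g) = f' x" for g
    using central_cong[OF f'(5) central] unfolding AE_N_iff central_def by (auto elim: eventually_mono)
  then show ?thesis
    unfolding eq by (intro AE_of_N[OF convN_commute[OF f'(1) h'(1)]]) (simp_all add: convN_supp)
qed

text \<open>Additivity of the Bochner integral needs both integrands to be integrable, which
  \<open>convN_integrable_AE\<close> guarantees for almost every \<open>x\<close>. Hence the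
  statement is almost everywhere.\<close>

lemma convolution_add_AE:
  assumes f: "f \<in> Bf" "AE x in \<mu>. x \<notin> H \<longrightarrow> f x = 0" and h: "h \<in> Bf" "AE x in \<mu>. x \<notin> H \<longrightarrow> h x = 0"
    and k: "k \<in> Bf" "AE x in \<mu>. x \<notin> H \<longrightarrow> k x = 0"
  shows "AE x in \<mu>. convolution \<mu> f (\<lambda>x. h x + k x) x = convolution \<mu> f h x + convolution \<mu> f k x"
proof -
  obtain f' where "rep f f'" using ex_rep[OF f] by blast
  note f' = repD[OF this]
  obtain h' where "rep h h'" using ex_rep[OF h] by blast
  note h' = repD[OF this]
  obtain k' where "rep k k'" using ex_rep[OF k] by blast
  note k' = repD[OF this]
  have eq: "convolution \<mu> f h = convN f' h'" "convolution \<mu> f k = convN f' k'"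
    by (rule convolution_eq_convN; fact)+
  have eq': "convolution \<mu> f (\<lambda>x. h x + k x) = convN f' (\<lambda>x. h' x + k' x)"
  proof (rule convolution_eq_convN[OF f'(2) _ f'(5) _ f'(4)])
    show "AE x in \<mu>. h x + k x = h' x + k' x" using h'(5) k'(5) by eventually_elim simp
    show "(\<lambda>x. h' x + k' x) \<in> borel_measurable borel" using h'(2) k'(2) by measurable
    show "h' x + k' x = 0" if "x \<notin> H" for x using h'(4) k'(4) that by simp
  qed
  have "AE x in N. convN f' (\<lambda>x. h' x + k' x) x = convN f' h' x + convN f' k' x"
    using convN_integrable_AE[OF weight f'(3) h'(1) f'(6) h'(6)] convN_integrable_AE[OF weight f'(3) k'(1) f'(6) k'(6)]
    by eventually_elim (simp add: convN_def distrib_left)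
  then show ?thesis
    unfolding eq eq' by (rule AE_of_N) (simp add: convN_supp)
qed

lemma convolution_character:
  assumes f: "f \<in> Bf" "AE x in \<mu>. x \<notin> H \<longrightarrow> f x = 0" and h: "h \<in> Bf" "AE x in \<mu>. x \<notin> H \<longrightarrow> h x = 0"
    and \<phi>: "\<phi> \<in> borel_measurable borel" "\<And>x. 0 < \<phi> x" "\<And>x. \<phi> x \<le> \<omega> x" "\<And>x y. \<phi> (x + y) = \<phi> x * \<phi> y"
  shows "(LINT x|completion \<mu>. convolution \<mu> f h x * complex_of_real (\<phi> x)) =
    (LINT x|completion \<mu>. f x * complex_of_real (\<phi> x)) * (LINT x|completion \<mu>. h x * complex_of_real (\<phi> x))"
proof -
  obtain f' where "rep f f'" using ex_rep[OF f] by blast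
  note f' = repD[OF this]
  obtain h' where "rep h h'" using ex_rep[OF h] by blast
  note h' = repD[OF this]
  have eq: "convolution \<mu> f h = convN f' h'" by (rule convolution_eq_convN) fact+
  have m: "convN f' h' \<in> borel_measurable borel"
    by (rule borel_measurable_supported[OF convN_measurable[OF f'(3) h'(1)] convN_supp])
  have to_N: "(LINT x|completion \<mu>. u x * complex_of_real (\<phi> x)) = (LINT x|N. u' x * complex_of_real (\<phi> x))"
    if u: "u' \<in> borel_measurable borel" "\<forall>x. x \<notin> H \<longrightarrow> u' x = 0" "AE x in \<mu>. u x = u' x" for u u'
  proof -
    have "(LINT x|completion \<mu>. u x * complex_of_real (\<phi> x)) = (LINT x|\<mu>. u' x * complex_of_real (\<phi> x))"
    proof (rule integral_completion_AE)
      show "(\<lambda>x. u' x * complex_of_real (\<phi> x)) \<in> borel_measurable \<mu>" using u(1) \<phi>(1) by measurable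
      show "AE x in \<mu>. u x * complex_of_real (\<phi> x) = u' x * complex_of_real (\<phi> x)"
        using u(3) by eventually_elim simp
    qed
    also have "\<dots> = (LINT x|N. u' x * complex_of_real (\<phi> x))"
      using u(2) by (intro integral_N_eq(1)[symmetric]) simp
    finally show ?thesis .
  qed
  show ?thesis
    unfolding eq to_N[OF m convN_supp' AE_I2[OF refl]] to_N[OF f'(2,8,5)] to_N[OF h'(2,8,5)]
    by (rule convN_character[OF weight f'(1) h'(1) f'(6) h'(6) \<phi>])
qed

end

section \<open>Weights\<close>

context haar
begin

text \<open>For \<open>v\<close> near \<open>0\<close> the translate by \<open>v\<close> of a large
  part of \<open>E\<close> stays in an open set only slightly larger than \<open>E\<close>. There is
  no room there for two disjoint copies, and a common point expresses \<open>v\<close> as a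
  difference.\<close>

lemma steinhaus:
  assumes E: "E \<in> sets borel" "0 < emeasure \<mu> E" "emeasure \<mu> E < \<infinity>"
  shows "\<exists>V. open V \<and> 0 \<in> V \<and> (\<forall>v\<in>V. \<exists>a\<in>E. \<exists>b\<in>E. v = a - b)"
proof -
  define m where "m = measure \<mu> E"
  have m: "emeasure \<mu> E = ennreal m" using E(3) by (simp add: m_def emeasure_eq_ennreal_measure)
  then have m0: "0 < m" using E(2) by simp
  \<comment> \<open>The constants: \<open>U\<close> has measure below 4m/3, and \<open>K\<close>
    misses less than m/3 of \<open>U\<close>, so \<open>E'\<close> has measure above 2m/3. Two
    disjoint copies of \<open>E'\<close> would exceed \<open>U\<close>.\<close>
  have "emeasure \<mu> E < ennreal (m + m / 3)" using m m0 by (simp add: ennreal_less_iff)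
  then obtain U where U: "open U" "E \<subseteq> U" "emeasure \<mu> U < ennreal (m + m / 3)" by (rule outer_approx[OF E(1)])
  define u where "u = measure \<mu> U"
  have U_fin: "emeasure \<mu> U < \<infinity>" using U(3) by (auto intro: less_trans)
  then have u: "emeasure \<mu> U = ennreal u" by (simp add: u_def emeasure_eq_ennreal_measure)
  have u_le: "u < m + m / 3" using U(3) m0 unfolding u by (simp add: ennreal_less_iff u_def)
  have "m \<le> u" using emeasure_mono[OF U(2), of \<mu>] U(1) unfolding m u by (simp add: u_def)
  then have "ennreal (u - m / 3) < emeasure \<mu> U" unfolding u using m0 by (simp add: ennreal_less_iff)
  then obtain K where K: "compact K" "K \<subseteq> U" "ennreal (u - m / 3) < emeasure \<mu> K" by (rule inner_approx[OF U(1)])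
  have Kb: "K \<in> sets borel" using K(1) by (intro borel_closed compact_imp_closed)
  have K_fin: "emeasure \<mu> K < \<infinity>" by (rule emeasure_compact_finite[OF K(1)])
  have k: "u - m / 3 < measure \<mu> K"
    using K(3) \<open>m \<le> u\<close> m0 K_fin by (simp add: emeasure_eq_ennreal_measure ennreal_less_iff)
  obtain V where V: "open V" "0 \<in> V" "\<forall>v\<in>V. \<forall>k\<in>K. v + k \<in> U"
    using compact_nbhd_left[OF K(1) U(1) K(2)] by blast
  define E' where "E' = E \<inter> K"
  have E'b: "E' \<in> sets borel" using E(1) Kb by (simp add: E'_def)
  have E'_fin: "emeasure \<mu> E' < \<infinity>"
    using emeasure_mono[of E' E \<mu>] E by (auto simp: E'_def intro: le_less_trans)
  have e': "measure \<mu> E' > 2 * m / 3"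
  proof -
    have "m \<le> measure \<mu> (E' \<union> (U - K))"
      unfolding m_def
    proof (rule measure_mono_fmeasurable)
      show "E' \<union> (U - K) \<in> fmeasurable \<mu>"
      proof (rule fmeasurableI)
        have "emeasure \<mu> (E' \<union> (U - K)) \<le> emeasure \<mu> U"
          using U K E'b Kb by (intro emeasure_mono) (auto simp: E'_def)
        then show "emeasure \<mu> (E' \<union> (U - K)) < \<infinity>" using U_fin by (rule le_less_trans)
      qed (use U(1) Kb E'b in auto)
    qed (use U E in \<open>auto simp: E'_def\<close>)
    also have "\<dots> \<le> measure \<mu> E' + measure \<mu> (U - K)"
      using E'b U(1) Kb by (intro measure_Un_le) auto
    also have "measure \<mu> (U - K) = u - measure \<mu> K"
      unfolding u_def using U K Kb U_fin by (intro measure_Diff) auto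
    finally show ?thesis using k by simp
  qed
  have "\<exists>a\<in>E. \<exists>b\<in>E. v = a - b" if v: "v \<in> V" for v
  proof (rule ccontr)
    assume neg: "\<not> (\<exists>a\<in>E. \<exists>b\<in>E. v = a - b)"
    let ?T = "(\<lambda>x. - v + x) -` E'"
    have Tb: "?T \<in> sets borel" using measurable_sets[OF borel_left_translation E'b, of "- v"] by simp
    have T: "emeasure \<mu> ?T = emeasure \<mu> E'" by (rule emeasure_translate[OF E'b])
    have TU: "?T \<subseteq> U"
    proof
      fix x assume "x \<in> ?T"
      then have "- v + x \<in> K" by (simp add: E'_def)
      from V(3)[rule_format, OF v this] show "x \<in> U" by (simp only: group_word_simps)
    qed
    have disj: "E' \<inter> ?T = {}"
    proof (rule ccontr)
      assume "E' \<inter> ?T \<noteq> {}"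
      then obtain x where x: "x \<in> E" "- v + x \<in> E" by (auto simp: E'_def)
      moreover have "v = x - (- v + x)" by (simp only: group_word_simps)
      ultimately show False using neg by blast
    qed
    have "measure \<mu> (E' \<union> ?T) = measure \<mu> E' + measure \<mu> ?T"
      using E'b Tb E'_fin T disj by (intro measure_Union) auto
    also have "measure \<mu> ?T = measure \<mu> E'" using T by (simp add: measure_def)
    finally have "measure \<mu> (E' \<union> ?T) = 2 * measure \<mu> E'" by simp
    moreover have "measure \<mu> (E' \<union> ?T) \<le> u"
      unfolding u_def using TU U K(2) U_fin E'b Tb
      by (intro measure_mono_fmeasurable fmeasurableI) (auto simp: E'_def)
    ultimately show False using e' u_le m0 by simp
  qed
  then show ?thesis using V by blast
qed

end

context beurling
begin

text \<open>The sets \<open>E n\<close> cover \<open>K0\<close>, so one of them has positive measure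
  and its differences fill a neighbourhood of \<open>0\<close>. Bounding the weight at - x as well
  is what controls a difference a - b.\<close>

lemma weight_bounded_nbhd: "\<exists>V C. open V \<and> 0 \<in> V \<and> (\<forall>v\<in>V. \<omega> v \<le> C)"
proof -
  define E where "E n = {x\<in>K0. \<omega> x \<le> real n \<and> \<omega> (- x) \<le> real n}" for n
  have K0b: "K0 \<in> sets borel" using K0(1) by (intro borel_closed compact_imp_closed)
  have Eb: "E n \<in> sets borel" for n
  proof -
    have "(\<lambda>x. \<omega> (- x)) \<in> borel_measurable borel"
      using measurable_compose[OF borel_uminus omega_measurable] .
    then have "K0 \<inter> {x. \<omega> x \<le> real n} \<inter> {x. \<omega> (- x) \<le> real n} \<in> sets borel"
      using K0b by (intro sets.Int) (auto intro!: borel_measurable_le[of _ borel "\<lambda>_. real n", simplified])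
    moreover have "E n = K0 \<inter> {x. \<omega> x \<le> real n} \<inter> {x. \<omega> (- x) \<le> real n}" by (auto simp: E_def)
    ultimately show ?thesis by simp
  qed
  have "\<exists>n. 0 < emeasure \<mu> (E n)"
  proof (rule ccontr)
    assume "\<not> (\<exists>n. 0 < emeasure \<mu> (E n))"
    then have null: "(\<Union>n. E n) \<in> null_sets \<mu>" using Eb by (intro null_sets_UN) (auto simp: null_sets_def)
    have sub: "interior K0 \<subseteq> (\<Union>n. E n)"
    proof
      fix x assume "x \<in> interior K0"
      then have "x \<in> K0" using interior_subset by blast
      obtain n where "max (\<omega> x) (\<omega> (- x)) \<le> real n" using real_arch_simple by blast
      then have "x \<in> E n" using \<open>x \<in> K0\<close> by (simp add: E_def)
      then show "x \<in> (\<Union>n. E n)" by blast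
    qed
    have "interior K0 \<in> null_sets \<mu>" by (rule null_sets_subset[OF null _ sub]) simp
    moreover have "interior K0 \<noteq> {}" using K0(2) by blast
    ultimately show False using emeasure_open_pos[OF open_interior, of K0] by (simp add: null_sets_def)
  qed
  then obtain n where n: "0 < emeasure \<mu> (E n)" by blast
  have "emeasure \<mu> (E n) \<le> emeasure \<mu> K0" using K0b by (intro emeasure_mono) (auto simp: E_def)
  then have "emeasure \<mu> (E n) < \<infinity>" using emeasure_compact_finite[OF K0(1)] by (rule le_less_trans)
  from steinhaus[OF Eb n this] obtain V where V: "open V" "0 \<in> V" "\<forall>v\<in>V. \<exists>a\<in>E n. \<exists>b\<in>E n. v = a - b" by blast
  have "\<omega> v \<le> real n * real n" if v: "v \<in> V" for v
  proof -
    obtain a b where ab: "a \<in> E n" "b \<in> E n" "v = a - b" using V(3) v by blast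
    have "\<omega> v \<le> \<omega> a * \<omega> (- b)" using omega_mult[of a "- b"] ab(3) by simp
    also have "\<dots> \<le> real n * real n"
      using ab(1,2) omega_pos by (intro mult_mono) (auto simp: E_def less_imp_le)
    finally show ?thesis .
  qed
  then show ?thesis using V by blast
qed

text \<open>Finitely many translates of the neighbourhood cover \<open>K0\<close>; the sum over
  \<open>Y\<close> dominates each single value of the positive weight.\<close>

lemma weight_bounded_K0: "\<exists>C. \<forall>x\<in>K0. \<omega> x \<le> C"
proof -
  obtain V C where V: "open V" "0 \<in> V" "\<forall>v\<in>V. \<omega> v \<le> C" using weight_bounded_nbhd by blast
  obtain Y where Y: "finite Y" "\<forall>x\<in>K0. \<exists>y\<in>Y. x - y \<in> V"
    using compact_finite_translates[OF K0(1) V(1,2)] by blast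
  have "\<omega> x \<le> C * (\<Sum>y\<in>Y. \<omega> y)" if x: "x \<in> K0" for x
  proof -
    obtain y where y: "y \<in> Y" "x - y \<in> V" using Y(2) x by blast
    have "\<omega> x \<le> \<omega> (x - y) * \<omega> y" using omega_mult[of "x - y" y] by simp
    also have "\<dots> \<le> C * (\<Sum>y\<in>Y. \<omega> y)"
      using V(3) y Y(1) omega_pos less_imp_le[OF omega_pos] order_trans[OF less_imp_le[OF omega_pos]]
      by (intro mult_mono member_le_sum) (auto intro: sum_nonneg)
    finally show ?thesis .
  qed
  then show ?thesis by blast
qed

text \<open>White's construction: average the cocycle \<open>ln \<omega>(y + x) - ln \<omega>(x)\<close> over \<open>x\<close>.\<close>

lemma ex_character:
  assumes "amenable \<mu>"
  shows "\<exists>\<phi>. \<phi> \<in> borel_measurable borel \<and> (\<forall>x. 0 < \<phi> x) \<and> (\<forall>x. \<phi> x \<le> \<omega> x) \<and>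
    (\<forall>x y. \<phi> (x + y) = \<phi> x * (\<phi> y :: real))"
proof -
  obtain m where "left_invariant_mean \<mu> m" using assms by (auto simp: amenable_def)
  then have m_add: "\<And>f h. f \<in> Linfty \<mu> \<Longrightarrow> h \<in> Linfty \<mu> \<Longrightarrow> m (\<lambda>x. f x + h x) = m f + m h"
    and m_scale: "\<And>c f. f \<in> Linfty \<mu> \<Longrightarrow> m (\<lambda>x. c * f x) = c * m f"
    and m_bound: "\<And>f C. f \<in> Linfty \<mu> \<Longrightarrow> locally_AE \<mu> (\<lambda>x. cmod (f x) \<le> C) \<Longrightarrow> cmod (m f) \<le> C"
    and m_one: "m (\<lambda>x. 1) = 1"
    and m_inv: "\<And>g f. f \<in> Linfty \<mu> \<Longrightarrow> m (\<lambda>x. f (- g + x)) = m f"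
    unfolding left_invariant_mean_def by blast+
  have Linfty: "f \<in> Linfty \<mu>" if "f \<in> borel_measurable borel" "\<And>x. cmod (f x) \<le> C" for f C
  proof -
    have "f \<in> borel_measurable (completion \<mu>)" using that(1) by (intro measurable_completion) simp
    then show ?thesis
      unfolding Linfty_def locally_AE_def using that(2)
      by (auto intro!: measurable_restrict_space1 exI[of _ C])
  qed
  define L where "L y x = ln (\<omega> (y + x)) - ln (\<omega> x)" for y x
  have L_upper: "L y x \<le> ln (\<omega> y)" for y x
  proof -
    have "ln (\<omega> (y + x)) \<le> ln (\<omega> y * \<omega> x)" using omega_mult omega_pos by (subst ln_le_cancel_iff) auto
    then show ?thesis using omega_pos[of y] omega_pos[of x] by (simp add: L_def ln_mult)
  qed
  have L_lower: "- ln (\<omega> (- y)) \<le> L y x" for y x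
  proof -
    have "\<omega> x \<le> \<omega> (- y) * \<omega> (y + x)" using omega_mult[of "- y" "y + x"] by (simp only: group_word_simps)
    then have "ln (\<omega> x) \<le> ln (\<omega> (- y) * \<omega> (y + x))" using omega_pos by (subst ln_le_cancel_iff) auto
    then show ?thesis using omega_pos[of "- y"] omega_pos[of "y + x"] by (simp add: L_def ln_mult)
  qed
  have L_abs: "\<bar>L y x\<bar> \<le> \<bar>ln (\<omega> y)\<bar> + \<bar>ln (\<omega> (- y))\<bar>" for y x
    using L_upper[of y x] L_lower[of y x] by linarith
  have L_meas: "(\<lambda>x. L y x) \<in> borel_measurable borel" for y
    unfolding L_def using measurable_compose[OF borel_left_translation omega_measurable, of y] by measurable
  have L_Linfty: "(\<lambda>x. complex_of_real (L y x)) \<in> Linfty \<mu>" for y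
    by (rule Linfty[where C = "\<bar>ln (\<omega> y)\<bar> + \<bar>ln (\<omega> (- y))\<bar>"]) (use L_meas L_abs in \<open>auto simp: norm_of_real\<close>)
  define \<psi> where "\<psi> y = Re (m (\<lambda>x. complex_of_real (L y x)))" for y
  have \<psi>_add: "\<psi> (y + z) = \<psi> y + \<psi> z" for y z
  proof -
    \<comment> \<open>The logarithms telescope through \<omega>(z + x). Invariance of the mean is
      stated for translation by \<open>- g\<close>, hence the form \<open>- (- z)\<close>.\<close>
    have split: "complex_of_real (L (y + z) x) = complex_of_real (L y (- (- z) + x)) + complex_of_real (L z x)" for x
      by (simp add: L_def add.assoc)
    have "(\<lambda>x. complex_of_real (L y (- (- z) + x))) \<in> Linfty \<mu>"
      using measurable_compose[OF borel_left_translation L_meas] L_abs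
      by (intro Linfty[where C = "\<bar>ln (\<omega> y)\<bar> + \<bar>ln (\<omega> (- y))\<bar>"]) auto
    then have "m (\<lambda>x. complex_of_real (L (y + z) x)) =
        m (\<lambda>x. complex_of_real (L y (- (- z) + x))) + m (\<lambda>x. complex_of_real (L z x))"
      unfolding split by (rule m_add[OF _ L_Linfty])
    also have "m (\<lambda>x. complex_of_real (L y (- (- z) + x))) = m (\<lambda>x. complex_of_real (L y x))"
      by (rule m_inv[OF L_Linfty])
    finally show ?thesis by (simp add: \<psi>_def)
  qed
  have \<psi>_le: "\<psi> y \<le> ln (\<omega> y)" for y
  proof -
    \<comment> \<open>The mean is controlled through bounds on the modulus. Adding a constant
      \<open>t\<close> this large ensures that \<open>L y x + t\<close> has modulus at most ln
      \<omega>(y) + t, so the one-sided bound survives; \<open>t\<close> is subtracted again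
      afterwards.\<close>
    define t where "t = 2 * (\<bar>ln (\<omega> y)\<bar> + \<bar>ln (\<omega> (- y))\<bar>)"
    have one: "(\<lambda>x. 1) \<in> Linfty \<mu>" by (rule Linfty[where C = 1]) auto
    have tL: "(\<lambda>x. complex_of_real t * 1) \<in> Linfty \<mu>" by (rule Linfty[where C = "\<bar>t\<bar>"]) auto
    have sL: "(\<lambda>x. complex_of_real (L y x) + complex_of_real t * 1) \<in> Linfty \<mu>"
    proof (rule Linfty[where C = "\<bar>ln (\<omega> y)\<bar> + \<bar>ln (\<omega> (- y))\<bar> + \<bar>t\<bar>"])
      show "cmod (complex_of_real (L y x) + complex_of_real t * 1) \<le> \<bar>ln (\<omega> y)\<bar> + \<bar>ln (\<omega> (- y))\<bar> + \<bar>t\<bar>" for x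
        using L_abs[of y x] norm_triangle_ineq[of "complex_of_real (L y x)" "complex_of_real t"] by simp
    qed (use L_meas in measurable)
    have "cmod (complex_of_real (L y x) + complex_of_real t * 1) \<le> ln (\<omega> y) + t" for x
    proof -
      have "\<bar>L y x + t\<bar> \<le> ln (\<omega> y) + t"
        using L_upper[of y x] L_lower[of y x] by (simp add: t_def abs_le_iff)
      then show ?thesis by (metis mult.right_neutral norm_of_real of_real_add)
    qed
    then have "cmod (m (\<lambda>x. complex_of_real (L y x) + complex_of_real t * 1)) \<le> ln (\<omega> y) + t"
      by (intro m_bound[OF sL]) (simp add: locally_AE_def)
    also have "m (\<lambda>x. complex_of_real (L y x) + complex_of_real t * 1) =
        m (\<lambda>x. complex_of_real (L y x)) + complex_of_real t"
      using m_add[OF L_Linfty tL] m_scale[OF one, of "complex_of_real t"] m_one by simp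
    finally have "cmod (m (\<lambda>x. complex_of_real (L y x)) + complex_of_real t) \<le> ln (\<omega> y) + t" .
    then show ?thesis
      using complex_Re_le_cmod[of "m (\<lambda>x. complex_of_real (L y x)) + complex_of_real t"] by (simp add: \<psi>_def)
  qed
  have \<psi>_zero: "\<psi> 0 = 0" using \<psi>_add[of 0 0] by simp
  have \<psi>_minus: "\<psi> (- y) = - \<psi> y" for y using \<psi>_add[of y "- y"] \<psi>_zero by simp
  obtain V C where V: "open V" "0 \<in> V" "\<forall>v\<in>V. \<omega> v \<le> C" using weight_bounded_nbhd by blast
  \<comment> \<open>An additive function bounded near \<open>0\<close> is small near
    \<open>0\<close>: if w + w lies in the previous neighbourhood, the bound at \<open>w\<close> is
    halved. At the start an upper bound suffices, since the neighbourhood is symmetric and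
    \<open>\<psi>\<close> is odd.\<close>
  have small: "\<exists>W. open W \<and> 0 \<in> W \<and> (\<forall>w\<in>W. \<bar>\<psi> w\<bar> \<le> ln C / 2 ^ k)" for k
  proof (induction k)
    case 0
    obtain W where W: "open W" "0 \<in> W" "\<forall>w\<in>W. - w \<in> W" "\<forall>v\<in>W. \<forall>w\<in>W. v + w \<in> V"
      using ex_symmetric_nbhd[OF V(1,2)] by blast
    have "\<psi> w \<le> ln C" if "w \<in> W" for w
    proof -
      have "w + 0 \<in> V" using W that by blast
      then have "\<omega> w \<le> C" using V(3) by simp
      then have "ln (\<omega> w) \<le> ln C" using omega_pos[of w] by simp
      then show ?thesis using \<psi>_le[of w] by simp
    qed
    then have "\<bar>\<psi> w\<bar> \<le> ln C" if "w \<in> W" for w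
      using W(3) that \<psi>_minus[of w] by (metis abs_leI)
    then show ?case using W by (intro exI[of _ W]) simp
  next
    case (Suc k)
    then obtain W where W: "open W" "0 \<in> W" "\<forall>w\<in>W. \<bar>\<psi> w\<bar> \<le> ln C / 2 ^ k" by blast
    obtain W' where W': "open W'" "0 \<in> W'" "\<forall>v\<in>W'. \<forall>w\<in>W'. v + w \<in> W"
      using ex_symmetric_nbhd[OF W(1,2)] by blast
    have "\<bar>\<psi> w\<bar> \<le> ln C / 2 ^ Suc k" if "w \<in> W'" for w
    proof -
      have "\<bar>\<psi> (w + w)\<bar> \<le> ln C / 2 ^ k" using W(3) W'(3) that by blast
      moreover have "\<psi> (w + w) = 2 * \<psi> w" by (simp add: \<psi>_add)
      ultimately show ?thesis by (simp add: abs_mult field_simps)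
    qed
    then show ?case using W' by blast
  qed
  have \<psi>_meas: "\<psi> \<in> borel_measurable borel"
  proof (rule borel_measurableI)
    fix S :: "real set" assume S: "open S"
    have "open (\<psi> -` S)"
    proof (subst open_subopen, rule ballI)
      fix x assume "x \<in> \<psi> -` S"
      then obtain e where e: "e > 0" "\<And>r. dist r (\<psi> x) < e \<Longrightarrow> r \<in> S"
        using S by (auto simp: open_dist)
      have "(\<lambda>k. ln C / 2 ^ k) \<longlonglongrightarrow> 0" by (intro LIMSEQ_divide_realpow_zero) simp
      then have "eventually (\<lambda>k. ln C / 2 ^ k < e) sequentially" using e(1) by (rule order_tendstoD)
      then obtain k where k: "ln C / 2 ^ k < e" by (auto simp: eventually_sequentially)
      obtain W where W: "open W" "0 \<in> W" "\<forall>w\<in>W. \<bar>\<psi> w\<bar> \<le> ln C / 2 ^ k" using small by blast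
      have "(+) x ` W \<subseteq> \<psi> -` S"
      proof
        fix z assume "z \<in> (+) x ` W"
        then obtain w where w: "w \<in> W" "z = x + w" by blast
        then have "dist (\<psi> z) (\<psi> x) < e" using W(3) k by (auto simp: \<psi>_add dist_real_def)
        then show "z \<in> \<psi> -` S" using e(2) by simp
      qed
      moreover have "x \<in> (+) x ` W" using W(2) by (intro image_eqI[of _ _ 0]) auto
      ultimately show "\<exists>T. open T \<and> x \<in> T \<and> T \<subseteq> \<psi> -` S" using open_left_translate[OF W(1)] by blast
    qed
    then show "\<psi> -` S \<inter> space borel \<in> sets borel" by simp
  qed
  have "exp (\<psi> x) \<le> \<omega> x" for x
    using \<psi>_le[of x] omega_pos[of x] by (metis exp_le_cancel_iff exp_ln)
  then show ?thesis
    using \<psi>_meas by (intro exI[of _ "\<lambda>x. exp (\<psi> x)"]) (auto simp: \<psi>_add exp_add)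
qed

end

section \<open>The central Beurling algebra\<close>

context beurling
begin

abbreviation "Z \<equiv> central_beurling_algebra \<mu> \<omega>"

definition ae_eq :: "(('g \<Rightarrow> complex) \<times> ('g \<Rightarrow> complex)) set" where
  "ae_eq = {(f, h). f \<in> Bf \<and> h \<in> Bf \<and> (AE x in completion \<mu>. f x = h x)}"

lemma ae_eq_iff: "(f, h) \<in> ae_eq \<longleftrightarrow> f \<in> Bf \<and> h \<in> Bf \<and> (AE x in \<mu>. f x = h x)"
  by (simp add: ae_eq_def AE_completion_iff)

lemma B0_simps [simp]:
  "carrier B0 = Bf" "vadd B0 = (\<lambda>f h x. f x + h x)" "vscale B0 = (\<lambda>c f x. c * f x)"
  "amult B0 = convolution \<mu>"
  by (simp_all add: beurling_function_algebra_def)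

lemma norm_B0: "vnorm B0 f = (LINT x|completion \<mu>. cmod (f x) * \<omega> x)"
  by (simp add: beurling_function_algebra_def)

lemma BfD:
  assumes "f \<in> Bf"
  shows "f \<in> borel_measurable (completion \<mu>)" "integrable (completion \<mu>) (\<lambda>x. cmod (f x) * \<omega> x)"
  using assms by (auto simp: beurling_functions_def)

lemma Bf_zero: "(\<lambda>x. 0) \<in> Bf"
  by (simp add: beurling_functions_def)

lemma Bf_add:
  assumes "f \<in> Bf" "h \<in> Bf"
  shows "(\<lambda>x. f x + h x) \<in> Bf"
proof -
  note [measurable] = BfD(1)[OF assms(1)] BfD(1)[OF assms(2)]
  have "integrable (completion \<mu>) (\<lambda>x. cmod (f x + h x) * \<omega> x)"
  proof (rule Bochner_Integration.integrable_bound)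
    show "integrable (completion \<mu>) (\<lambda>x. cmod (f x) * \<omega> x + cmod (h x) * \<omega> x)"
      using BfD(2) assms by simp
    show "AE x in completion \<mu>. norm (cmod (f x + h x) * \<omega> x) \<le> norm (cmod (f x) * \<omega> x + cmod (h x) * \<omega> x)"
    proof (rule AE_I2)
      fix x
      have "cmod (f x + h x) * \<omega> x \<le> (cmod (f x) + cmod (h x)) * \<omega> x"
        using omega_pos[of x] by (intro mult_right_mono norm_triangle_ineq) simp
      then show "norm (cmod (f x + h x) * \<omega> x) \<le> norm (cmod (f x) * \<omega> x + cmod (h x) * \<omega> x)"
        using omega_pos[of x] by (simp add: abs_mult distrib_right)
    qed
  qed measurable
  then show ?thesis by (simp add: beurling_functions_def)
qed

lemma Bf_scale:
  assumes "f \<in> Bf"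
  shows "(\<lambda>x. c * f x) \<in> Bf"
proof -
  note [measurable] = BfD(1)[OF assms]
  have "integrable (completion \<mu>) (\<lambda>x. cmod c * (cmod (f x) * \<omega> x))" using BfD(2)[OF assms] by simp
  then show ?thesis by (simp add: beurling_functions_def norm_mult mult.assoc)
qed

lemma subgroup_locale: "open_sigma_subgroup H \<Longrightarrow> beurling_subgroup \<mu> \<omega> H"
  by unfold_locales

lemma Bf_convolution:
  assumes "f \<in> Bf" "h \<in> Bf"
  shows "convolution \<mu> f h \<in> Bf" "vnorm B0 (convolution \<mu> f h) \<le> vnorm B0 f * vnorm B0 h"
proof -
  obtain H where H: "open_sigma_subgroup H" "\<forall>f\<in>{f, h}. AE x in \<mu>. x \<notin> H \<longrightarrow> f x = 0"
    using ex_subgroup[of "{f, h}"] assms by auto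
  interpret S: beurling_subgroup \<mu> \<omega> H by (rule subgroup_locale[OF H(1)])
  show "convolution \<mu> f h \<in> Bf" "vnorm B0 (convolution \<mu> f h) \<le> vnorm B0 f * vnorm B0 h"
    using S.convolution_closed assms H(2) by simp_all
qed

text \<open>Equality at every point, because \<open>convolution_borel\<close> computes both sides
  from the same Borel versions.\<close>

lemma convolution_cong:
  assumes "f \<in> Bf" "h \<in> Bf" "AE x in \<mu>. f x = f' x" "AE x in \<mu>. h x = h' x"
  shows "convolution \<mu> f h = convolution \<mu> f' h'"
proof
  fix x
  obtain f0 where "f0 \<in> borel_measurable \<mu>" and f0: "AE x in \<mu>. f x = f0 x"
    using completion_ex_borel_measurable_complex[OF BfD(1)[OF assms(1)]] by blast
  then have mf: "f0 \<in> borel_measurable borel" by simp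
  obtain h0 where "h0 \<in> borel_measurable \<mu>" and h0: "AE x in \<mu>. h x = h0 x"
    using completion_ex_borel_measurable_complex[OF BfD(1)[OF assms(2)]] by blast
  then have mh: "h0 \<in> borel_measurable borel" by simp
  have f0': "AE x in \<mu>. f' x = f0 x" using f0 assms(3) by eventually_elim simp
  have h0': "AE x in \<mu>. h' x = h0 x" using h0 assms(4) by eventually_elim simp
  show "convolution \<mu> f h x = convolution \<mu> f' h' x"
    by (simp only: convolution_borel[OF mf mh f0 h0] convolution_borel[OF mf mh f0' h0'])
qed

sublocale beurling_congruence: algebra_congruence B0 ae_eq
proof
  show "carrier B0 \<noteq> {}" using Bf_zero by auto
  show "equiv (carrier B0) ae_eq"
  proof (rule equivI)
    show "refl_on (carrier B0) ae_eq" by (auto simp: refl_on_def ae_eq_iff)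
    show "sym ae_eq"
      by (rule symI) (auto simp: ae_eq_iff elim: eventually_mono)
    show "trans ae_eq"
    proof (rule transI)
      fix f h k assume *: "(f, h) \<in> ae_eq" "(h, k) \<in> ae_eq"
      then have "AE x in \<mu>. f x = h x" "AE x in \<mu>. h x = k x" by (auto simp: ae_eq_iff)
      then have "AE x in \<mu>. f x = k x" by eventually_elim simp
      then show "(f, k) \<in> ae_eq" using * by (simp add: ae_eq_iff)
    qed
  qed (auto simp: ae_eq_iff)
next
  fix f h c assume "f \<in> carrier B0" "h \<in> carrier B0"
  then show "vadd B0 f h \<in> carrier B0" "amult B0 f h \<in> carrier B0"
    by (simp_all add: Bf_add Bf_convolution)
next
  fix f c assume "f \<in> carrier B0"
  then show "vscale B0 c f \<in> carrier B0" by (simp add: Bf_scale)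
  show "0 \<le> vnorm B0 f" using omega_pos by (auto simp: norm_B0 less_imp_le intro!: Bochner_Integration.integral_nonneg)
  show "vnorm B0 (vscale B0 c f) = cmod c * vnorm B0 f" by (simp add: norm_B0 norm_mult mult.assoc)
next
  fix f f' h h' assume *: "(f, f') \<in> ae_eq" "(h, h') \<in> ae_eq"
  then have ae: "AE x in \<mu>. f x = f' x" "AE x in \<mu>. h x = h' x" by (auto simp: ae_eq_iff)
  then have "AE x in \<mu>. f x + h x = f' x + h' x" by eventually_elim simp
  then show "(vadd B0 f h, vadd B0 f' h') \<in> ae_eq" using * by (simp add: ae_eq_iff Bf_add)
  show "(amult B0 f h, amult B0 f' h') \<in> ae_eq"
    using * convolution_cong[OF _ _ ae] by (simp add: ae_eq_iff Bf_convolution)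
next
  fix f f' c assume *: "(f, f') \<in> ae_eq"
  then have ae: "AE x in \<mu>. f x = f' x" by (auto simp: ae_eq_iff)
  then have "AE x in \<mu>. c * f x = c * f' x" by eventually_elim simp
  then show "(vscale B0 c f, vscale B0 c f') \<in> ae_eq" using * by (simp add: ae_eq_iff Bf_scale)
  show "vnorm B0 f = vnorm B0 f'"
    unfolding norm_B0
  proof (rule integral_cong_AE)
    note [measurable] = BfD(1)
    show "(\<lambda>x. cmod (f x) * \<omega> x) \<in> borel_measurable (completion \<mu>)"
      "(\<lambda>x. cmod (f' x) * \<omega> x) \<in> borel_measurable (completion \<mu>)"
      using BfD(2) * by (auto simp: ae_eq_iff)
    show "AE x in completion \<mu>. cmod (f x) * \<omega> x = cmod (f' x) * \<omega> x"
      by (rule AE_completion) (use ae in eventually_elim, simp)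
  qed
qed

abbreviation "cls \<equiv> beurling_congruence.cls"

lemma central_beurling_eq: "Z = (beurling_congruence.Q)\<lparr>carrier := {F \<in> carrier beurling_congruence.Q.
    \<forall>f\<in>F. \<forall>g. AE x in completion \<mu>. f (- g + x + g) = f x}\<rparr>"
  by (simp add: central_beurling_algebra_def beurling_algebra_def ae_eq_def)

lemma Z_simps [simp]:
  "vadd Z = vadd beurling_congruence.Q" "vscale Z = vscale beurling_congruence.Q"
  "vnorm Z = vnorm beurling_congruence.Q" "amult Z = amult beurling_congruence.Q"
  by (simp_all add: central_beurling_eq)

text \<open>The definition demands invariance of all representatives of a class;
  \<open>central_cong\<close> reduces this to a single one.\<close>

lemma carrier_Z: "carrier Z = {cls f | f. f \<in> Bf \<and> central f}"
proof -
  have "F \<in> carrier Z \<longleftrightarrow> (\<exists>f. F = cls f \<and> f \<in> Bf \<and> central f)" for F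
  proof
    assume F: "F \<in> carrier Z"
    then obtain f where f: "f \<in> Bf" "F = cls f"
      by (auto simp: central_beurling_eq beurling_congruence.carrier_Q)
    then have "f \<in> F" using beurling_congruence.cls_self by simp
    then show "\<exists>f. F = cls f \<and> f \<in> Bf \<and> central f"
      using F f by (auto simp: central_beurling_eq central_def AE_completion_iff)
  next
    assume "\<exists>f. F = cls f \<and> f \<in> Bf \<and> central f"
    then obtain f where f: "F = cls f" "f \<in> Bf" "central f" by blast
    have "central h" if "h \<in> F" for h
      using that f central_cong[OF _ f(3)] by (auto simp: ae_eq_iff)
    then show "F \<in> carrier Z"
      using f by (auto simp: central_beurling_eq beurling_congruence.carrier_Q central_def AE_completion_iff)
  qed
  then show ?thesis by blast
qed

lemma Z_cases:
  assumes "F \<in> carrier Z"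
  obtains f where "F = cls f" "f \<in> Bf" "central f"
  using assms carrier_Z by auto

lemma cls_ae: "f \<in> Bf \<Longrightarrow> h \<in> Bf \<Longrightarrow> AE x in \<mu>. f x = h x \<Longrightarrow> cls f = cls h"
  by (rule beurling_congruence.cls_eq) (simp add: ae_eq_iff)

lemma central_add: "central f \<Longrightarrow> central h \<Longrightarrow> central (\<lambda>x. f x + h x)"
  unfolding central_def
proof
  fix g
  assume "\<forall>g. AE x in \<mu>. f (- g + x + g) = f x" "\<forall>g. AE x in \<mu>. h (- g + x + g) = h x"
  then have "AE x in \<mu>. f (- g + x + g) = f x" "AE x in \<mu>. h (- g + x + g) = h x" by blast+
  then show "AE x in \<mu>. f (- g + x + g) + h (- g + x + g) = f x + h x" by eventually_elim simp
qed

lemma central_scale: "central f \<Longrightarrow> central (\<lambda>x. c * f x)"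
  unfolding central_def by (auto elim: eventually_mono)

lemma central_conv: "f \<in> Bf \<Longrightarrow> h \<in> Bf \<Longrightarrow> central f \<Longrightarrow> central h \<Longrightarrow> central (convolution \<mu> f h)"
  unfolding central_def[of "convolution \<mu> f h"] by (simp add: central_convolution BfD(1))

lemma Q_cls:
  assumes "f \<in> Bf" "h \<in> Bf"
  shows "vadd beurling_congruence.Q (cls f) (cls h) = cls (\<lambda>x. f x + h x)"
    "amult beurling_congruence.Q (cls f) (cls h) = cls (convolution \<mu> f h)"
    "vscale beurling_congruence.Q c (cls f) = cls (\<lambda>x. c * f x)"
    "vnorm beurling_congruence.Q (cls f) = vnorm B0 f"
  using assms beurling_congruence.add_Q[of f h] beurling_congruence.mult_Q[of f h]
    beurling_congruence.scale_Q[of f c] beurling_congruence.norm_Q[of f] by simp_all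

text \<open>Each product law involves at most three functions. The laws that require a change of
  order or splitting of integrals are transferred to one subgroup from \<open>ex_subgroup\<close>,
  and almost everywhere identities there are equalities of classes.\<close>

theorem comm_algebra_Z: "comm_algebra Z"
proof
  have "cls (\<lambda>x. 0) \<in> carrier Z" unfolding carrier_Z using Bf_zero by (auto simp: central_def)
  then show "carrier Z \<noteq> {}" by blast
next
  fix F G assume "F \<in> carrier Z" "G \<in> carrier Z"
  then obtain f h where f: "F = cls f" "f \<in> Bf" "central f" and h: "G = cls h" "h \<in> Bf" "central h"
    by (elim Z_cases)
  show "vadd Z F G \<in> carrier Z" "amult Z F G \<in> carrier Z"
    unfolding carrier_Z using f h by (auto simp: Q_cls intro: Bf_add central_add Bf_convolution central_conv)
  show "vnorm Z (amult Z F G) \<le> vnorm Z F * vnorm Z G"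
    using f h Bf_convolution by (simp add: Q_cls)
  obtain H where H: "open_sigma_subgroup H" "\<forall>f\<in>{f, h}. AE x in \<mu>. x \<notin> H \<longrightarrow> f x = 0"
    using ex_subgroup[of "{f, h}"] f h by auto
  interpret S: beurling_subgroup \<mu> \<omega> H by (rule subgroup_locale[OF H(1)])
  have "AE x in \<mu>. convolution \<mu> f h x = convolution \<mu> h f x"
    using S.convolution_commute_AE[of f h] f h H(2) by simp
  then have "cls (convolution \<mu> f h) = cls (convolution \<mu> h f)"
    using f h by (intro cls_ae Bf_convolution)
  then show "amult Z F G = amult Z G F" using f h by (simp add: Q_cls)
  have "convolution \<mu> f (\<lambda>x. c * h x) = (\<lambda>x. c * convolution \<mu> f h x)" for c
    by (simp add: convolution_def fun_eq_iff mult.left_commute)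
  then show "amult Z F (vscale Z c G) = vscale Z c (amult Z F G)" for c
    using f h by (simp add: Q_cls Bf_scale Bf_convolution)
next
  fix F G K assume "F \<in> carrier Z" "G \<in> carrier Z" "K \<in> carrier Z"
  then obtain f h k where f: "F = cls f" "f \<in> Bf" "central f" and h: "G = cls h" "h \<in> Bf" "central h"
    and k: "K = cls k" "k \<in> Bf" "central k"
    by (elim Z_cases)
  obtain H where H: "open_sigma_subgroup H" "\<forall>f\<in>{f, h, k}. AE x in \<mu>. x \<notin> H \<longrightarrow> f x = 0"
    using ex_subgroup[of "{f, h, k}"] f h k by auto
  interpret S: beurling_subgroup \<mu> \<omega> H by (rule subgroup_locale[OF H(1)])
  have "cls (convolution \<mu> (convolution \<mu> f h) k) = cls (convolution \<mu> f (convolution \<mu> h k))"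
    using f h k S.convolution_assoc_AE[of f h k] H(2) by (intro cls_ae Bf_convolution) auto
  then show "amult Z (amult Z F G) K = amult Z F (amult Z G K)"
    using f h k by (simp add: Q_cls Bf_convolution)
  have "cls (convolution \<mu> f (\<lambda>x. h x + k x)) = cls (\<lambda>x. convolution \<mu> f h x + convolution \<mu> f k x)"
    using f h k S.convolution_add_AE[of f h k] H(2) by (intro cls_ae Bf_convolution Bf_add) auto
  then show "amult Z F (vadd Z G K) = vadd Z (amult Z F G) (amult Z F K)"
    using f h k by (simp add: Q_cls Bf_convolution Bf_add)
next
  fix F c assume "F \<in> carrier Z"
  then obtain f where f: "F = cls f" "f \<in> Bf" "central f" by (elim Z_cases)
  show "vscale Z c F \<in> carrier Z"
    unfolding carrier_Z using f by (auto simp: Q_cls intro: Bf_scale central_scale)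
  show "0 \<le> vnorm Z F" "vnorm Z (vscale Z c F) = cmod c * vnorm Z F"
    using f beurling_congruence.norm_nonneg[of f] beurling_congruence.norm_scale[of f c]
    by (simp_all add: Q_cls Bf_scale)
qed

text \<open>Integration against the homomorphism \<phi>. Since \<phi> is at most \<omega>, the
  integral is bounded by the norm with constant 1.\<close>

theorem ex_character_Z:
  assumes "amenable \<mu>"
  shows "\<exists>\<Phi>. bounded_functional Z \<Phi> \<and>
    (\<forall>F\<in>carrier Z. \<forall>G\<in>carrier Z. \<Phi> (amult Z F G) = \<Phi> F * \<Phi> G) \<and> (\<exists>F\<in>carrier Z. \<Phi> F \<noteq> 0)"
proof -
  obtain \<phi> where \<phi>: "\<phi> \<in> borel_measurable borel" "\<And>x. 0 < \<phi> x" "\<And>x. \<phi> x \<le> \<omega> x"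
    "\<And>x y. \<phi> (x + y) = \<phi> x * \<phi> y"
    using ex_character[OF assms] by blast
  have [measurable]: "\<phi> \<in> borel_measurable (completion \<mu>)" using \<phi>(1) by (intro measurable_completion) simp
  define I where "I f = (LINT x|completion \<mu>. f x * complex_of_real (\<phi> x))" for f :: "'g \<Rightarrow> complex"
  \<comment> \<open>An arbitrary representative is used; \<open>I_cong\<close> makes the value
    independent of it.\<close>
  define \<Phi> where "\<Phi> F = I (SOME f. f \<in> F)" for F
  have int: "integrable (completion \<mu>) (\<lambda>x. f x * complex_of_real (\<phi> x))" if f: "f \<in> Bf" for f
  proof (rule Bochner_Integration.integrable_bound[OF BfD(2)[OF f]])
    show "(\<lambda>x. f x * complex_of_real (\<phi> x)) \<in> borel_measurable (completion \<mu>)"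
      using BfD(1)[OF f] by measurable
    show "AE x in completion \<mu>. norm (f x * complex_of_real (\<phi> x)) \<le> norm (cmod (f x) * \<omega> x)"
      using \<phi>(2,3) omega_pos by (auto simp: norm_mult abs_mult less_imp_le intro!: mult_left_mono)
  qed
  have I_cong: "I f = I h" if fh: "(f, h) \<in> ae_eq" for f h
    unfolding I_def
  proof (rule integral_cong_AE)
    show "(\<lambda>x. f x * complex_of_real (\<phi> x)) \<in> borel_measurable (completion \<mu>)"
      "(\<lambda>x. h x * complex_of_real (\<phi> x)) \<in> borel_measurable (completion \<mu>)"
      using int fh by (auto simp: ae_eq_iff)
    have "AE x in completion \<mu>. f x = h x" using fh by (simp add: ae_eq_def)
    then show "AE x in completion \<mu>. f x * complex_of_real (\<phi> x) = h x * complex_of_real (\<phi> x)"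
      by eventually_elim simp
  qed
  have \<Phi>: "\<Phi> (cls f) = I f" if f: "f \<in> Bf" for f
  proof -
    have "(SOME h. h \<in> cls f) \<in> cls f"
      using beurling_congruence.cls_self[of f] f by (intro someI[of "\<lambda>h. h \<in> cls f"]) simp
    then show ?thesis unfolding \<Phi>_def using I_cong[of f] by auto
  qed
  have "cmod (\<Phi> F) \<le> 1 * vnorm Z F" if F: "F \<in> carrier Z" for F
  proof -
    obtain f where f: "F = cls f" "f \<in> Bf" using F by (elim Z_cases)
    have "cmod (I f) \<le> (LINT x|completion \<mu>. cmod (f x * complex_of_real (\<phi> x)))"
      unfolding I_def by (rule integral_norm_bound)
    also have "\<dots> \<le> (LINT x|completion \<mu>. cmod (f x) * \<omega> x)"
      using \<phi>(2,3)
      by (intro integral_mono[OF integrable_norm[OF int[OF f(2)]] BfD(2)[OF f(2)]])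
        (simp add: norm_mult abs_of_pos mult_left_mono)
    finally show ?thesis using f by (simp add: \<Phi> Q_cls norm_B0)
  qed
  then have "\<exists>C. \<forall>F\<in>carrier Z. cmod (\<Phi> F) \<le> C * vnorm Z F" by blast
  moreover have "\<Phi> (vadd Z F G) = \<Phi> F + \<Phi> G" if FG: "F \<in> carrier Z" "G \<in> carrier Z" for F G
  proof -
    obtain f h where f: "F = cls f" "f \<in> Bf" and h: "G = cls h" "h \<in> Bf" using FG by (elim Z_cases)
    have "I (\<lambda>x. f x + h x) = I f + I h"
      unfolding I_def using int f h by (simp add: distrib_right)
    then show ?thesis using f h by (simp add: Q_cls \<Phi> Bf_add)
  qed
  moreover have "\<Phi> (vscale Z c F) = c * \<Phi> F" if F: "F \<in> carrier Z" for c F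
  proof -
    obtain f where f: "F = cls f" "f \<in> Bf" using F by (elim Z_cases)
    have "I (\<lambda>x. c * f x) = c * I f" unfolding I_def by (simp add: mult.assoc)
    then show ?thesis using f by (simp add: Q_cls \<Phi> Bf_scale)
  qed
  ultimately have "bounded_functional Z \<Phi>" unfolding bounded_functional_def by blast
  moreover have "\<Phi> (amult Z F G) = \<Phi> F * \<Phi> G" if FG: "F \<in> carrier Z" "G \<in> carrier Z" for F G
  proof -
    obtain f h where f: "F = cls f" "f \<in> Bf" and h: "G = cls h" "h \<in> Bf" using FG by (elim Z_cases)
    obtain H where H: "open_sigma_subgroup H" "\<forall>f\<in>{f, h}. AE x in \<mu>. x \<notin> H \<longrightarrow> f x = 0"
      using ex_subgroup[of "{f, h}"] f h by auto
    interpret S: beurling_subgroup \<mu> \<omega> H by (rule subgroup_locale[OF H(1)])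
    have "I (convolution \<mu> f h) = I f * I h"
      unfolding I_def using S.convolution_character[OF f(2) _ h(2) _ \<phi>] H(2) by simp
    then show ?thesis using f h by (simp add: Q_cls \<Phi> Bf_convolution)
  qed
  moreover have "\<exists>F\<in>carrier Z. \<Phi> F \<noteq> 0"
  proof -
    \<comment> \<open>Invariance of \<open>K0\<close> makes this a class function, and boundedness
      of the weight on the compact \<open>K0\<close> makes it integrable against \<omega>.\<close>
    let ?k = "indicator K0 :: 'g \<Rightarrow> complex"
    have K0b: "K0 \<in> sets borel" using K0(1) by (intro borel_closed compact_imp_closed)
    then have K0c: "K0 \<in> sets (completion \<mu>)" by simp
    obtain C where C: "\<And>x. x \<in> K0 \<Longrightarrow> \<omega> x \<le> C" using weight_bounded_K0 by blast
    have "integrable (completion \<mu>) (\<lambda>x. cmod (?k x) * \<omega> x)"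
    proof (rule Bochner_Integration.integrable_bound)
      show "integrable (completion \<mu>) (\<lambda>x. C * indicator K0 x)"
        using K0c K0b emeasure_compact_finite[OF K0(1)] by simp
      show "AE x in completion \<mu>. norm (cmod (?k x) * \<omega> x) \<le> norm (C * indicator K0 x :: real)"
      proof (rule AE_I2)
        fix x
        show "norm (cmod (?k x) * \<omega> x) \<le> norm (C * indicator K0 x :: real)"
          using C[of x] omega_pos[of x] by (cases "x \<in> K0") auto
      qed
    qed (use K0c in measurable)
    then have k: "?k \<in> Bf" using K0c by (simp add: beurling_functions_def)
    have inv: "- g + x + g \<in> K0 \<longleftrightarrow> x \<in> K0" for g x
      using K0_invariant[of "- g" x] by simp
    have "central ?k" unfolding central_def by (simp add: indicator_def inv)
    then have mem: "cls ?k \<in> carrier Z" unfolding carrier_Z using k by blast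
    have "I ?k = complex_of_real (LINT x|completion \<mu>. indicator K0 x * \<phi> x)"
      unfolding I_def by (subst integral_complex_of_real[symmetric]) (auto intro!: Bochner_Integration.integral_cong simp: indicator_def)
    \<comment> \<open>The integrand is positive on \<open>K0\<close>. A zero integral would make
      \<open>K0\<close> null, although its interior is a nonempty open set.\<close>
    moreover have "(LINT x|completion \<mu>. indicator K0 x * \<phi> x) \<noteq> 0"
    proof
      assume zero: "(LINT x|completion \<mu>. indicator K0 x * \<phi> x) = 0"
      have "integrable (completion \<mu>) (\<lambda>x. Re (?k x * complex_of_real (\<phi> x)))"
        using int[OF k] by (rule integrable_Re)
      moreover have "(\<lambda>x. Re (?k x * complex_of_real (\<phi> x))) = (\<lambda>x. indicator K0 x * \<phi> x)"
        by (auto simp: fun_eq_iff indicator_def)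
      ultimately have i: "integrable (completion \<mu>) (\<lambda>x. indicator K0 x * \<phi> x)" by (simp only:)
      have "AE x in completion \<mu>. indicator K0 x * \<phi> x = 0"
        using zero integral_nonneg_eq_0_iff_AE[OF i] \<phi>(2) by (simp add: less_imp_le)
      then have "AE x in \<mu>. x \<notin> K0"
        unfolding AE_completion_iff
      proof eventually_elim
        fix x assume "indicator K0 x * \<phi> x = 0"
        then show "x \<notin> K0" using \<phi>(2)[of x] by (auto simp: indicator_def split: if_splits)
      qed
      then have "emeasure \<mu> K0 = 0" using AE_iff_measurable[of K0 \<mu> "\<lambda>x. x \<notin> K0"] K0b by simp
      moreover have "emeasure \<mu> (interior K0) \<le> emeasure \<mu> K0" using K0b interior_subset by (intro emeasure_mono) auto
      ultimately show False using emeasure_open_pos[of "interior K0"] K0(2) by auto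
    qed
    ultimately have "\<Phi> (cls ?k) \<noteq> 0" using k by (simp add: \<Phi>)
    then show ?thesis using mem by blast
  qed
  ultimately show ?thesis by blast
qed

end

text \<open>The characters play crossed roles: that of \<open>B\<close> recovers \<open>A\<close>,
  and that of \<open>A\<close> recovers \<open>B\<close> after the factors have been
  exchanged.\<close>

lemma (in comm_algebra_pair) weakly_amenable_tensor_iff:
  assumes \<phi>: "bounded_functional A \<phi>" "\<forall>a\<in>carrier A. \<forall>a'\<in>carrier A. \<phi> (amult A a a') = \<phi> a * \<phi> a'"
      "\<exists>a\<in>carrier A. \<phi> a \<noteq> 0"
    and \<psi>: "bounded_functional B \<psi>" "\<forall>b\<in>carrier B. \<forall>b'\<in>carrier B. \<psi> (amult B b b') = \<psi> b * \<psi> b'"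
      "\<exists>b\<in>carrier B. \<psi> b \<noteq> 0"
  shows "weakly_amenable (A \<otimes>\<^sub>\<pi> B) \<longleftrightarrow> weakly_amenable A \<and> weakly_amenable B"
proof
  assume wa: "weakly_amenable (A \<otimes>\<^sub>\<pi> B)"
  interpret BA: comm_algebra_pair B A ..
  show "weakly_amenable A \<and> weakly_amenable B"
    using weakly_amenable_tensor_left[OF wa \<psi>(1)] \<psi>(2,3)
      BA.weakly_amenable_tensor_left[OF weakly_amenable_tensor_swap[OF wa] \<phi>(1)] \<phi>(2,3) by blast
qed (use weakly_amenable_tensor in blast)

theorem proposition2p3:
  fixes \<mu>1 :: "'g::{topological_group_add, t2_space} measure"
    and \<mu>2 :: "'h::{topological_group_add, t2_space} measure"
    and \<omega>1 :: "'g \<Rightarrow> real"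
    and \<omega>2 :: "'h \<Rightarrow> real"
  assumes "locally_compact_space (euclidean :: 'g topology)"
    and "locally_compact_space (euclidean :: 'h topology)"
    and "IN_group TYPE('g)" and "IN_group TYPE('h)"
    and "left_haar_measure \<mu>1" and "left_haar_measure \<mu>2"
    and "amenable \<mu>1" and "amenable \<mu>2"
    and "weight \<omega>1" and "weight \<omega>2"
  shows "weakly_amenable (central_beurling_algebra \<mu>1 \<omega>1 \<otimes>\<^sub>\<pi> central_beurling_algebra \<mu>2 \<omega>2) \<longleftrightarrow>
         weakly_amenable (central_beurling_algebra \<mu>1 \<omega>1) \<and>
         weakly_amenable (central_beurling_algebra \<mu>2 \<omega>2)"
proof -
  interpret b1: beurling \<mu>1 \<omega>1 by unfold_locales (use assms in auto)
  interpret b2: beurling \<mu>2 \<omega>2 by unfold_locales (use assms in auto)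
  interpret comm_algebra_pair b1.Z b2.Z
    by (intro comm_algebra_pair.intro b1.comm_algebra_Z b2.comm_algebra_Z)
  show ?thesis
    using b1.ex_character_Z[OF assms(7)] b2.ex_character_Z[OF assms(8)]
    by (elim exE conjE) (rule weakly_amenable_tensor_iff)
qed

end
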